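(* Let $w^{(t)}$ be the iterates of weak model training. For any $\varepsilon>0$ and $\delta\in(0,1)$ satisfying the data-scarce parameter conditions (listed in the context), with probability at least $1-\delta$ there exists $T_{wk}=\widetilde{\mathcal{O}}(\eta^{-1}\varepsilon^{-1}n_{wk}d^{-1}\sigma_p^{-2})$ such that for all $t\in[T_{wk},T^*]$ the following hold: 1. The training loss converges below $\varepsilon$: $L_{wk}(w^{(t)})<\varepsilon$. 2. Let $(X,y)\sim\mathcal{D}$ be an unseen test example, independent of the training set $\{(X_i,y_i)\}_{i=1}^{n_{wk}}$. Then $$\mathbb{P}\big[y f_{wk}(w^{(t)},X)<0 \,\big|\, (X,y)\in\mathcal{S}_e\cup\mathcal{S}_b\big]\le \exp\Big(-\frac{n_{wk}(2p_e+p_b)^2\|\mu\|^4}{C_1\sigma_p^4 d}\Big)=o(1),$$ where $C_1>0$ is a constant.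
   Context: Data distribution. Fix a dimension $d$, probabilities $p_e,p_h,p_b$ with $p_e+p_h+p_b=1$, a noise level $\sigma_p>0$, and mutually orthogonal signal vectors $\mu_1,\mu_{-1},\nu_1,\nu_{-1}\in\mathbb{R}^d$ with $\|\mu_1\|=\|\mu_{-1}\|=:\|\mu\|$ and $\|\nu_1\|=\|\nu_{-1}\|=:\|\nu\|$. The distribution $\mathcal{D}$ on $\mathbb{R}^{d\times 3}\times\{\pm1\}$ generates $(X,y)$ with $X=(x^{(1)},x^{(2)},x^{(3)})$ as follows. The label $y$ is uniform on $\{\pm1\}$. The pair of signal vectors $(v^{(1)},v^{(2)})$ equals $(\mu_y,\mu_y)$ with probability $p_e$ (easy-only data); is uniform on $\{(\nu_y,\nu_y),(\nu_y,-\nu_y),(-\nu_y,\nu_y),(-\nu_y,-\nu_y)\}$ with probability $p_h$ (hard-only data); is uniform on $\{(\mu_y,\nu_y),(\mu_y,-\nu_y),(\nu_y,\mu_y),(-\nu_y,\mu_y)\}$ with probability $p_b$ (both-signal data). Independently, the noise vector is $\xi\sim\mathcal{N}(0,\sigma_p^2\Lambda)$ with $\Lambda=I_d-\frac{\mu_1\mu_1^\top}{\|\mu\|^2}-\frac{\mu_{-1}\mu_{-1}^\top}{\|\mu\|^2}-\frac{\nu_1\nu_1^\top}{\|\nu\|^2}-\frac{\nu_{-1}\nu_{-1}^\top}{\|\nu\|^2}$. The patches $x^{(1)},x^{(2)},x^{(3)}$ are $v^{(1)},v^{(2)},\xi$ in a randomly shuffled order. $\mathcal{S}_e,\mathcal{S}_h,\mathcal{S}_b$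 denote the supports of easy-only, hard-only and both-signal data. Weak model and its training. For $w\in\mathbb{R}^d$, $f_{wk}(w,X)=\sum_{p\in[3]}\langle w,x^{(p)}\rangle$. Given $n_{wk}$ i.i.d. samples $(X_i,y_i)\sim\mathcal{D}$, $L_{wk}(w)=\frac1{n_{wk}}\sum_{i}\ell(y_if_{wk}(w,X_i))$ with logistic loss $\ell(z)=\log(1+e^{-z})$. Weak model training is gradient descent $w^{(t+1)}=w^{(t)}-\eta\nabla L_{wk}(w^{(t)})$ from $w^{(0)}=0$, with learning rate $\eta>0$. The probability $1-\delta$ is over the training set. Parameter conditions. $n_{st}$, $m$, $\sigma_0$ denote the sample size, number of filters and initialization scale used for a second (strong) model; they enter only through the conditions below. $T^*=\eta^{-1}\mathrm{poly}(\varepsilon^{-1},d,n_{st},n_{wk},m)$, with $\mathrm{poly}$ a sufficiently large polynomial, is the maximum admissible number of iterations. The regime is asymptotic: $\varepsilon^{-1},d,n_{st},n_{wk},m$ are considered sufficiently large, asymptotic notation ($\mathcal{O},o,\omega$) refers to this regime, and $\widetilde{\mathcal{O}}$ hides logarithmic factors. The base parameter conditions are that, for a sufficiently large constant $C>0$: (i) $d\ge C\max\{n_{wk}^2\log(Cn_{wk}^2/\delta),\,n_{st}\log(Cn_{st}/\delta)\}(\log T^* )^2$; (ii) $n_{wk},n_{st}\ge C\max\{p_e^{-2},p_b^{-2},p_h^{-2}\}\log(C/\delta)$ and $m\ge C\log(Cn_{st}/\delta)$; (iii) $\sigma_0\le C^{-1}\min\{\frac1{\|\mu\|},\frac1{\|\nu\|},\frac1{\sigma_p\sqrt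 d}\}\min\{\frac{n_{st}p_b\|\nu\|^2}{\sigma_p^2d},\frac{\sigma_p^2d}{(2p_e+p_b)n_{st}\|\mu\|^2}\}(\log(Cmn_{st}/\delta))^{-1/2}$; (iv) $\eta\le C^{-1}\sigma_p^{-2}d^{-3/2}$; (v) $(2p_e+p_b)\|\mu\|^2\ge Cp_b\|\nu\|^2$ and $n_{wk},n_{st}=\omega\big(\frac{\sigma_p^4d}{(2p_e+p_b)^2\|\mu\|^4}\big)$; (vi) $p_b\ge C\max\{p_h,\ \sigma_p\|\mu\|\|\nu\|^{-2}(\log T^* )^{1/2}\}$. The data-scarce parameter conditions are the base parameter conditions together with, for the same $C$, $n_{wk},n_{st}\le C^{-1}\sigma_p^2d/((2p_e+p_b)\|\mu\|^2\log T^* )$. *)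

theory Defs
  imports
    "HOL-Probability.Probability"
    "HOL-Library.Landau_Symbols"
    "HOL-Combinatorics.Permutations"
begin

text \<open>
  The dimension \<open>d\<close> is one of the parameters that grow in the asymptotic regime, so it cannot be a
  type. A vector of \<open>\<real>\<^sup>d\<close> is a function \<open>nat \<Rightarrow> real\<close> vanishing at all indices \<open>\<ge> d\<close>; its Euclidean
  norm is \<^const>\<open>L2_set\<close> over \<open>{..<d}\<close>. On functions the library topology is the product
  topology, which on these vectors is the usual topology of \<open>\<real>\<^sup>d\<close>, and \<^const>\<open>borel\<close> refers to it.
\<close>

type_synonym vec = "nat \<Rightarrow> real"

definition inner_d :: "nat \<Rightarrow> vec \<Rightarrow> vec \<Rightarrow> real" where
  "inner_d d u v = (\<Sum>i<d. u i * v i)"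

text \<open>
  A data point \<open>(X, y)\<close>: the patches of \<open>X\<close> are \<open>X p\<close> for \<open>p \<in> {1, 2, 3}\<close> (and \<open>X p = 0\<close>
  for the other \<open>p\<close>), the label is \<open>y \<in> {1, -1}\<close>.
\<close>

type_synonym data_point = "(nat \<Rightarrow> vec) \<times> real"

record params =
  dimn :: nat      \<comment> \<open>\<open>d\<close>\<close>
  n_wk :: nat
  n_st :: nat
  filters :: nat   \<comment> \<open>\<open>m\<close>\<close>
  p_e :: real
  p_h :: real
  p_b :: real
  sigma_p :: real
  sigma_0 :: real
  lr :: real       \<comment> \<open>the learning rate \<open>\<eta>\<close>\<close>
  mu :: "real \<Rightarrow> vec"   \<comment> \<open>indexed by the label; only \<open>mu 1\<close> and \<open>mu (-1)\<close> matter\<close>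
  nu :: "real \<Rightarrow> vec"
  eps :: real
  delta :: real

definition norm_mu :: "params \<Rightarrow> real" where
  "norm_mu Q = L2_set (mu Q 1) {..<dimn Q}"

definition norm_nu :: "params \<Rightarrow> real" where
  "norm_nu Q = L2_set (nu Q 1) {..<dimn Q}"

definition signals_ok :: "params \<Rightarrow> bool" where
  "signals_ok Q \<longleftrightarrow>
     (\<forall>s\<in>{1, -1}. \<forall>i\<ge>dimn Q. mu Q s i = 0 \<and> nu Q s i = 0) \<and>
     L2_set (mu Q (-1)) {..<dimn Q} = norm_mu Q \<and> 0 < norm_mu Q \<and>
     L2_set (nu Q (-1)) {..<dimn Q} = norm_nu Q \<and> 0 < norm_nu Q \<and>
     inner_d (dimn Q) (mu Q 1) (mu Q (-1)) = 0 \<and>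
     inner_d (dimn Q) (nu Q 1) (nu Q (-1)) = 0 \<and>
     (\<forall>s\<in>{1, -1}. \<forall>s'\<in>{1, -1}. inner_d (dimn Q) (mu Q s) (nu Q s') = 0)"

definition params_ok :: "params \<Rightarrow> bool" where
  "params_ok Q \<longleftrightarrow>
     0 < p_e Q \<and> 0 < p_h Q \<and> 0 < p_b Q \<and> p_e Q + p_h Q + p_b Q = 1 \<and>
     0 < sigma_p Q \<and> 0 < sigma_0 Q \<and> 0 < lr Q \<and>
     0 < eps Q \<and> 0 < delta Q \<and> delta Q < 1 \<and> signals_ok Q"


section \<open>The data distribution\<close>

definition Lambda :: "params \<Rightarrow> nat \<Rightarrow> nat \<Rightarrow> real" where
  "Lambda Q i j = (if i = j then 1 else 0)
     - mu Q 1 i * mu Q 1 j / (norm_mu Q)\<^sup>2 - mu Q (-1) i * mu Q (-1) j / (norm_mu Q)\<^sup>2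
     - nu Q 1 i * nu Q 1 j / (norm_nu Q)\<^sup>2 - nu Q (-1) i * nu Q (-1) j / (norm_nu Q)\<^sup>2"

text \<open>
  The centred Gaussian law on \<open>\<real>\<^sup>d\<close> with (possibly singular) covariance \<open>\<Sigma>\<close> is the law of \<open>A z\<close>,
  where \<open>z\<close> is a standard Gaussian vector and \<open>A A\<^sup>T = \<Sigma>\<close>. Such a square \<open>A\<close> exists for every
  positive semidefinite \<open>\<Sigma>\<close>, and the law does not depend on its choice.
\<close>

definition cov_factor :: "nat \<Rightarrow> (nat \<Rightarrow> nat \<Rightarrow> real) \<Rightarrow> nat \<Rightarrow> nat \<Rightarrow> real" where
  "cov_factor d \<Sigma> = (SOME A. \<forall>i<d. \<forall>j<d. (\<Sum>k<d. A i k * A j k) = \<Sigma> i j)"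

definition gaussian :: "nat \<Rightarrow> (nat \<Rightarrow> nat \<Rightarrow> real) \<Rightarrow> vec measure" where
  "gaussian d \<Sigma> =
     distr (\<Pi>\<^sub>M i\<in>{..<d}. density lborel (\<lambda>x. ennreal (std_normal_density x))) borel
       (\<lambda>z i. if i < d then \<Sum>k<d. cov_factor d \<Sigma> i k * z k else 0)"

definition noise :: "params \<Rightarrow> vec measure" where
  "noise Q = gaussian (dimn Q) (\<lambda>i j. (sigma_p Q)\<^sup>2 * Lambda Q i j)"

datatype kind = Easy | Hard | Both

definition kind_pmf :: "params \<Rightarrow> kind pmf" where
  "kind_pmf Q = embed_pmf (\<lambda>k. case k of Easy \<Rightarrow> p_e Q | Hard \<Rightarrow> p_h Q | Both \<Rightarrow> p_b Q)"

fun signal_pmf :: "params \<Rightarrow> real \<Rightarrow> kind \<Rightarrow> (vec \<times> vec) pmf" where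
  "signal_pmf Q y Easy = return_pmf (mu Q y, mu Q y)"
| "signal_pmf Q y Hard = pmf_of_set
     {(nu Q y, nu Q y), (nu Q y, - nu Q y), (- nu Q y, nu Q y), (- nu Q y, - nu Q y)}"
| "signal_pmf Q y Both = pmf_of_set
     {(mu Q y, nu Q y), (mu Q y, - nu Q y), (nu Q y, mu Q y), (- nu Q y, mu Q y)}"

text \<open>The discrete part of a sample: label, signal vectors and the shuffle of the patches.\<close>

definition discrete_pmf ::
    "params \<Rightarrow> kind pmf \<Rightarrow> (real \<times> (vec \<times> vec) \<times> (nat \<Rightarrow> nat)) pmf" where
  "discrete_pmf Q K =
     bind_pmf K (\<lambda>k.
     bind_pmf (pmf_of_set {1, -1}) (\<lambda>y.
     bind_pmf (signal_pmf Q y k) (\<lambda>v.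
     bind_pmf (pmf_of_set {\<pi>. \<pi> permutes {1, 2, 3}}) (\<lambda>\<pi>.
     return_pmf (y, v, \<pi>)))))"

definition unshuffled :: "vec \<Rightarrow> vec \<Rightarrow> vec \<Rightarrow> nat \<Rightarrow> vec" where
  "unshuffled v1 v2 \<xi> p =
     (if p = 1 then v1 else if p = 2 then v2 else if p = 3 then \<xi> else (\<lambda>_. 0))"

definition data_law :: "params \<Rightarrow> kind pmf \<Rightarrow> data_point measure" where
  "data_law Q K =
     distr (measure_pmf (discrete_pmf Q K) \<Otimes>\<^sub>M noise Q) borel
       (\<lambda>((y, (v1, v2), \<pi>), \<xi>). ((\<lambda>p. unshuffled v1 v2 \<xi> (\<pi> p)), y))"

definition data_dist :: "params \<Rightarrow> data_point measure" where
  "data_dist Q = data_law Q (kind_pmf Q)"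

definition law_support :: "'a::topological_space measure \<Rightarrow> 'a set" where
  "law_support M = {x \<in> space M. \<forall>U. open U \<and> x \<in> U \<longrightarrow> 0 < emeasure M (U \<inter> space M)}"

definition kind_support :: "params \<Rightarrow> kind \<Rightarrow> data_point set" where
  "kind_support Q k = law_support (data_law Q (return_pmf k))"


section \<open>The weak model and its training\<close>

definition f_wk :: "nat \<Rightarrow> vec \<Rightarrow> (nat \<Rightarrow> vec) \<Rightarrow> real" where
  "f_wk d w X = (\<Sum>p\<in>{1, 2, 3}. inner_d d w (X p))"

definition logistic_loss :: "real \<Rightarrow> real" where
  "logistic_loss z = ln (1 + exp (- z))"

text \<open>A training set is a function \<open>S\<close> whose values \<open>S i\<close>, \<open>i < n\<close>, are the samples.\<close>

definition L_wk :: "params \<Rightarrow> (nat \<Rightarrow> data_point) \<Rightarrow> vec \<Rightarrow> real" where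
  "L_wk Q S w = (1 / real (n_wk Q)) *
     (\<Sum>i<n_wk Q. logistic_loss (snd (S i) * f_wk (dimn Q) w (fst (S i))))"

definition gradient_d :: "nat \<Rightarrow> (vec \<Rightarrow> real) \<Rightarrow> vec \<Rightarrow> vec" where
  "gradient_d d L w = (\<lambda>i. if i < d then deriv (\<lambda>h. L (w(i := h))) (w i) else 0)"

primrec w_iter :: "params \<Rightarrow> (nat \<Rightarrow> data_point) \<Rightarrow> nat \<Rightarrow> vec" where
  "w_iter Q S 0 = (\<lambda>_. 0)"
| "w_iter Q S (Suc t) =
     (\<lambda>i. w_iter Q S t i - lr Q * gradient_d (dimn Q) (L_wk Q S) (w_iter Q S t) i)"

definition training_sets :: "params \<Rightarrow> (nat \<Rightarrow> data_point) measure" where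
  "training_sets Q = (\<Pi>\<^sub>M i\<in>{..<n_wk Q}. data_dist Q)"

text \<open>
  The test example is drawn from \<^const>\<open>data_dist\<close> independently of the training set, so
  for a given training set \<open>w\<close> is fixed and the probability is over the test example only.
\<close>

definition test_error :: "params \<Rightarrow> vec \<Rightarrow> real" where
  "test_error Q w =
     \<P>(Z in data_dist Q. snd Z * f_wk (dimn Q) w (fst Z) < 0
        \<bar> Z \<in> kind_support Q Easy \<union> kind_support Q Both)"


section \<open>Parameter conditions\<close>

text \<open>A real polynomial in five variables is a finite linear combination of monomials.\<close>

definition polynomial5 :: "(real \<Rightarrow> real \<Rightarrow> real \<Rightarrow> real \<Rightarrow> real \<Rightarrow> real) \<Rightarrow> bool" where
  "polynomial5 P \<longleftrightarrow> (\<exists>(J :: (nat \<times> nat \<times> nat \<times> nat \<times> nat) set) c. finite J \<and>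
     P = (\<lambda>x1 x2 x3 x4 x5. \<Sum>(a1, a2, a3, a4, a5)\<in>J.
            c (a1, a2, a3, a4, a5) * x1 ^ a1 * x2 ^ a2 * x3 ^ a3 * x4 ^ a4 * x5 ^ a5))"

definition T_star :: "(real \<Rightarrow> real \<Rightarrow> real \<Rightarrow> real \<Rightarrow> real \<Rightarrow> real) \<Rightarrow> params \<Rightarrow> real" where
  "T_star P Q = inverse (lr Q) *
     P (inverse (eps Q)) (real (dimn Q)) (real (n_st Q)) (real (n_wk Q)) (real (filters Q))"

text \<open>
  The base conditions that concern a single parameter tuple; the growth condition \<open>\<omega>\<close> on the
  sample sizes is \<open>sample_size_growth\<close> below.
\<close>

definition base_conditions ::
    "real \<Rightarrow> (real \<Rightarrow> real \<Rightarrow> real \<Rightarrow> real \<Rightarrow> real \<Rightarrow> real) \<Rightarrow> params \<Rightarrow> bool" where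
  "base_conditions C P Q \<longleftrightarrow>
    (let d = real (dimn Q); nw = real (n_wk Q); ns = real (n_st Q); m = real (filters Q);
         \<delta> = delta Q; \<sigma> = sigma_p Q; a = norm_mu Q; b = norm_nu Q; q = 2 * p_e Q + p_b Q;
         lT = ln (T_star P Q);
         pm = Max {1 / (p_e Q)\<^sup>2, 1 / (p_b Q)\<^sup>2, 1 / (p_h Q)\<^sup>2}
     in
      d \<ge> C * max (nw\<^sup>2 * ln (C * nw\<^sup>2 / \<delta>)) (ns * ln (C * ns / \<delta>)) * lT\<^sup>2 \<and>
      nw \<ge> C * pm * ln (C / \<delta>) \<and> ns \<ge> C * pm * ln (C / \<delta>) \<and> m \<ge> C * ln (C * ns / \<delta>) \<and>
      sigma_0 Q \<le> inverse C * Min {1 / a, 1 / b, 1 / (\<sigma> * sqrt d)}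
        * min (ns * p_b Q * b\<^sup>2 / (\<sigma>\<^sup>2 * d)) (\<sigma>\<^sup>2 * d / (q * ns * a\<^sup>2))
        / sqrt (ln (C * m * ns / \<delta>)) \<and>
      lr Q \<le> inverse C * \<sigma> powr (-2) * d powr (-3/2) \<and>
      q * a\<^sup>2 \<ge> C * p_b Q * b\<^sup>2 \<and>
      p_b Q \<ge> C * max (p_h Q) (\<sigma> * a / b\<^sup>2 * sqrt lT))"

definition data_scarce_bound ::
    "real \<Rightarrow> (real \<Rightarrow> real \<Rightarrow> real \<Rightarrow> real \<Rightarrow> real \<Rightarrow> real) \<Rightarrow> params \<Rightarrow> bool" where
  "data_scarce_bound C P Q \<longleftrightarrow>
    (let B = inverse C * (sigma_p Q)\<^sup>2 * real (dimn Q)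
             / ((2 * p_e Q + p_b Q) * (norm_mu Q)\<^sup>2 * ln (T_star P Q))
     in real (n_wk Q) \<le> B \<and> real (n_st Q) \<le> B)"

text \<open>
  The asymptotic regime: all parameters (including the dimension and the signal vectors) may vary
  along a sequence \<open>Q\<close>, along which \<open>1/\<epsilon>, d, n_st, n_wk, m\<close> tend to infinity; ``sufficiently
  large'', \<open>\<omega>\<close> and \<open>o(1)\<close> all refer to the limit along this sequence.
\<close>

definition large_regime :: "(nat \<Rightarrow> params) \<Rightarrow> bool" where
  "large_regime Q \<longleftrightarrow>
     filterlim (\<lambda>k. inverse (eps (Q k))) at_top sequentially \<and>
     filterlim (\<lambda>k. dimn (Q k)) at_top sequentially \<and>
     filterlim (\<lambda>k. n_st (Q k)) at_top sequentially \<and>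
     filterlim (\<lambda>k. n_wk (Q k)) at_top sequentially \<and>
     filterlim (\<lambda>k. filters (Q k)) at_top sequentially"

definition sample_size_growth :: "(nat \<Rightarrow> params) \<Rightarrow> bool" where
  "sample_size_growth Q \<longleftrightarrow>
    (let r = (\<lambda>k. sigma_p (Q k) ^ 4 * real (dimn (Q k))
                   / ((2 * p_e (Q k) + p_b (Q k))\<^sup>2 * norm_mu (Q k) ^ 4))
     in (\<lambda>k. real (n_wk (Q k))) \<in> \<omega>[sequentially](r) \<and>
        (\<lambda>k. real (n_st (Q k))) \<in> \<omega>[sequentially](r))"

definition data_scarce_conditions ::
    "real \<Rightarrow> (real \<Rightarrow> real \<Rightarrow> real \<Rightarrow> real \<Rightarrow> real \<Rightarrow> real) \<Rightarrow> (nat \<Rightarrow> params) \<Rightarrow> bool" where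
  "data_scarce_conditions C P Q \<longleftrightarrow>
     (\<forall>k. params_ok (Q k) \<and> base_conditions C P (Q k) \<and> data_scarce_bound C P (Q k)) \<and>
     sample_size_growth Q"

text \<open>
  \<open>K\<close> and \<open>q\<close> are the constants of the soft-O bound, whose logarithmic factors are in the
  quantities that tend to infinity.
\<close>

definition T_wk_bound :: "real \<Rightarrow> nat \<Rightarrow> params \<Rightarrow> real" where
  "T_wk_bound K q Q =
     K * (real (n_wk Q) / (lr Q * eps Q * real (dimn Q) * (sigma_p Q)\<^sup>2)) *
     ln (inverse (eps Q) * real (dimn Q) * real (n_st Q) * real (n_wk Q) * real (filters Q)) ^ q"

definition test_bound :: "real \<Rightarrow> params \<Rightarrow> real" where
  "test_bound C1 Q = exp (- (real (n_wk Q) * (2 * p_e Q + p_b Q)\<^sup>2 * norm_mu Q ^ 4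
                             / (C1 * sigma_p Q ^ 4 * real (dimn Q))))"

end

theory Submission
  imports Defs
begin

text \<open>
  The model is linear, so gradient descent from 0 stays in the span of the label-weighted patch
  sums \<open>z\<^sub>i\<close>, say \<open>w = \<Sum>\<^sub>i a\<^sub>i z\<^sub>i\<close>. In the data-scarce regime the Gram matrix of the \<open>z\<^sub>i\<close> differs from
  \<open>\<sigma>\<^sup>2 d\<close> times the identity by row sums of order \<open>\<sigma>\<^sup>2 d / log T*\<close>, and the coefficients never exceed the
  order \<open>log T* / (\<sigma>\<^sup>2 d)\<close>; hence every margin equals \<open>\<sigma>\<^sup>2 d a\<^sub>i\<close> up to an additive constant. The
  scalar recursions decouple: \<open>exp (\<sigma>\<^sup>2 d a\<^sub>i)\<close> grows linearly in time, which gives convergence of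
  the loss, and all \<open>a\<^sub>i\<close> stay within a constant factor of each other. With such balanced
  coefficients \<open>w\<close> behaves like the plain average of the \<open>z\<^sub>i\<close>: its component along the easy signal of
  either label is of order \<open>n (2 p\<^sub>e + p\<^sub>b) a\<close>, the hard signal is dominated by it, and its noise component has
  squared norm of order \<open>n a\<^sup>2 \<sigma>\<^sup>2 d\<close>. A Gaussian tail bound then yields the test error.
\<close>

subsection \<open>Gaussian moment generating functions\<close>

text \<open>All quantitative steps concern one parameter tuple; the limit enters only through n >=
  1, d >= 1, eps <= 1 and the convergence of the test bound. The randomness of the training set is
  confined to one event \<open>good\<close>, after which all times up to T* are treated
  deterministically, so there is no union bound over time. The horizon costs a logarithm instead:
  with L = ln T* and D = sigma^2 d, coefficients of at most 2 L / D meet Gram errors of row sum at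
  most D / (2 L), whence an error of 1 in each margin. Half of this budget is spent on the noise,
  which forces d to be of order n^2 L^2 log, and half on the signals, which is the data-scarce
  bound. The noise is awkward because its covariance factor A is an arbitrary choice of which only A
  A^T is known. Linear forms are unaffected, but the squared norm is not visibly a sum of d - 4
  squares, so it is compared with the full chi-square |z|^2. The numerical constants left open in
  the schematic goals are fixed by their proofs.\<close>

abbreviation std_normal :: "real measure" where
  "std_normal \<equiv> density lborel (\<lambda>x. ennreal (std_normal_density x))"

abbreviation gauss :: "nat \<Rightarrow> (nat \<Rightarrow> real) measure" where
  "gauss d \<equiv> \<Pi>\<^sub>M i\<in>{..<d}. std_normal"

lemma nn_integral_normal_density_eq_1:
  "s > 0 \<Longrightarrow> (\<integral>\<^sup>+x. ennreal (normal_density m s x) \<partial>lborel) = 1"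
  using prob_space.emeasure_space_1[OF prob_space_normal_density, of s m]
  by (simp add: emeasure_density)

text \<open>All moment generating functions are nonnegative integrals, so no integrability has to be
  shown. Completing the square turns the integrand into a multiple of the N(t, 1) density.\<close>

lemma std_normal_mgf:
  "(\<integral>\<^sup>+x. ennreal (exp (t * x)) \<partial>std_normal) = ennreal (exp (t\<^sup>2 / 2))"
proof -
  have "(\<integral>\<^sup>+x. ennreal (exp (t * x)) \<partial>std_normal)
      = (\<integral>\<^sup>+x. ennreal (exp (t\<^sup>2 / 2)) * ennreal (normal_density t 1 x) \<partial>lborel)"
  proof (subst nn_integral_density, simp, simp, intro nn_integral_cong)
    fix x :: real
    have "exp (- x\<^sup>2 / 2) * exp (t * x) = exp (t\<^sup>2 / 2) * exp (- (x - t)\<^sup>2 / 2)"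
      by (simp add: exp_add[symmetric] power2_eq_square field_simps)
    then have "std_normal_density x * exp (t * x) = exp (t\<^sup>2 / 2) * normal_density t 1 x"
      by (simp add: normal_density_def)
    then show "ennreal (std_normal_density x) * ennreal (exp (t * x))
      = ennreal (exp (t\<^sup>2 / 2)) * ennreal (normal_density t 1 x)"
      by (simp add: ennreal_mult[symmetric])
  qed
  also have "\<dots> = ennreal (exp (t\<^sup>2 / 2))"
    by (subst nn_integral_cmult) (simp_all add: nn_integral_normal_density_eq_1)
  finally show ?thesis .
qed

text \<open>The integrand is a multiple of the centred normal density of variance 1 / (1 - 2
  s).\<close>

lemma std_normal_square_mgf:
  assumes "s < 1 / 2"
  shows "(\<integral>\<^sup>+x. ennreal (exp (s * x\<^sup>2)) \<partial>std_normal) = ennreal (1 / sqrt (1 - 2 * s))"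
proof -
  define r where "r = 1 / sqrt (1 - 2 * s)"
  have r: "r > 0" "r\<^sup>2 = 1 / (1 - 2 * s)"
    using assms by (simp_all add: r_def power_divide)
  have "(\<integral>\<^sup>+x. ennreal (exp (s * x\<^sup>2)) \<partial>std_normal)
      = (\<integral>\<^sup>+x. ennreal r * ennreal (normal_density 0 r x) \<partial>lborel)"
  proof (subst nn_integral_density, simp, simp, intro nn_integral_cong)
    fix x :: real
    have "exp (- x\<^sup>2 / 2) * exp (s * x\<^sup>2) = exp (- x\<^sup>2 / (2 * r\<^sup>2))"
      using assms by (simp add: exp_add[symmetric] r field_simps)
    moreover have "sqrt (2 * pi * r\<^sup>2) = sqrt (2 * pi) * r"
      using r(1) by (simp add: real_sqrt_mult)
    ultimately have "std_normal_density x * exp (s * x\<^sup>2) = r * normal_density 0 r x"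
      using r(1) unfolding normal_density_def by simp
    then show "ennreal (std_normal_density x) * ennreal (exp (s * x\<^sup>2))
      = ennreal r * ennreal (normal_density 0 r x)"
      using r(1) by (simp add: ennreal_mult[symmetric])
  qed
  also have "\<dots> = ennreal r"
    by (subst nn_integral_cmult) (simp_all add: nn_integral_normal_density_eq_1 r)
  finally show ?thesis by (simp add: r_def)
qed

lemma prob_space_std_normal: "prob_space std_normal"
  by (rule prob_space_normal_density) simp

lemma product_sigma_finite_const: "prob_space M \<Longrightarrow> product_sigma_finite (\<lambda>_. M)"
  by (simp add: product_sigma_finite_def prob_space_imp_sigma_finite)

lemma prob_space_gauss: "prob_space (gauss d)"
  by (intro prob_space_PiM prob_space_std_normal)

lemma gauss_mgf:
  "(\<integral>\<^sup>+z. ennreal (exp (\<Sum>k<d. c k * z k)) \<partial>gauss d) = ennreal (exp ((\<Sum>k<d. (c k)\<^sup>2) / 2))"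
proof -
  interpret product_sigma_finite "\<lambda>_::nat. std_normal"
    by (intro product_sigma_finite_const prob_space_std_normal)
  have "(\<integral>\<^sup>+z. ennreal (exp (\<Sum>k<d. c k * z k)) \<partial>gauss d)
      = (\<integral>\<^sup>+z. (\<Prod>k<d. ennreal (exp (c k * z k))) \<partial>gauss d)"
    by (simp add: exp_sum prod_ennreal)
  also have "\<dots> = (\<Prod>k<d. ennreal (exp ((c k)\<^sup>2 / 2)))"
    by (subst product_nn_integral_prod) (simp_all only: std_normal_mgf, simp_all)
  finally show ?thesis by (simp add: prod_ennreal exp_sum sum_divide_distrib)
qed

lemma gauss_norm_mgf:
  assumes "s < 1 / 2"
  shows "(\<integral>\<^sup>+z. ennreal (exp (s * (\<Sum>k<d. (z k)\<^sup>2))) \<partial>gauss d)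
    = ennreal ((1 / sqrt (1 - 2 * s)) ^ d)"
proof -
  interpret product_sigma_finite "\<lambda>_::nat. std_normal"
    by (intro product_sigma_finite_const prob_space_std_normal)
  have "(\<integral>\<^sup>+z. ennreal (exp (s * (\<Sum>k<d. (z k)\<^sup>2))) \<partial>gauss d)
      = (\<integral>\<^sup>+z. (\<Prod>k<d. ennreal (exp (s * (z k)\<^sup>2))) \<partial>gauss d)"
    by (simp add: exp_sum prod_ennreal sum_distrib_left)
  also have "\<dots> = (\<Prod>k<d. ennreal (1 / sqrt (1 - 2 * s)))"
    by (subst product_nn_integral_prod) (simp_all only: std_normal_square_mgf[OF assms], simp_all)
  finally show ?thesis using assms by (simp add: prod_ennreal ennreal_power)
qed

text \<open>A second-order bound for -ln (1 - 2 s) / 2, needed for both signs: s is positive for the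
  upper and negative for the lower chi-square tail. The constant 4 is what ln (1 - x) >= -x - 2 x^2
  gives at x = 2 s.\<close>

lemma inverse_sqrt_le_exp:
  fixes s :: real
  assumes "\<bar>s\<bar> \<le> 1 / 4"
  shows "1 / sqrt (1 - 2 * s) \<le> exp (s + 4 * s\<^sup>2)"
proof -
  have "- (2 * s) - 8 * s\<^sup>2 \<le> ln (1 - 2 * s)"
  proof (cases "s \<ge> 0")
    case True
    then show ?thesis using ln_one_minus_pos_lower_bound[of "2 * s"] assms
      by (simp add: power2_eq_square)
  next
    case False
    then have "- 2 * s - (- 2 * s)\<^sup>2 \<le> ln (1 + - 2 * s)"
      using assms by (intro ln_one_plus_pos_lower_bound) auto
    then have "- (2 * s) - 4 * s\<^sup>2 \<le> ln (1 - 2 * s)"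
      by (simp add: power_mult_distrib)
    then show ?thesis using zero_le_power2[of s] by linarith
  qed
  moreover have "1 / sqrt (1 - 2 * s) = exp (- ln (1 - 2 * s) / 2)"
    using assms by (simp add: powr_half_sqrt[symmetric] powr_def exp_minus field_simps)
  ultimately show ?thesis by (simp only: exp_le_cancel_iff)
qed

lemma gauss_norm_mgf_le:
  assumes "\<bar>s\<bar> \<le> 1 / 4"
  shows "(\<integral>\<^sup>+z. ennreal (exp (s * (\<Sum>k<d. (z k)\<^sup>2))) \<partial>gauss d)
    \<le> ennreal (exp (real d * (s + 4 * s\<^sup>2)))"
proof -
  have "(1 / sqrt (1 - 2 * s)) ^ d \<le> exp (s + 4 * s\<^sup>2) ^ d"
    using assms by (intro power_mono inverse_sqrt_le_exp) auto
  then show ?thesis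
    using assms by (subst gauss_norm_mgf) (auto simp: exp_of_nat_mult[symmetric] intro!: ennreal_leI)
qed

text \<open>Linearising the square, \<open>exp (x\<^sup>2 / 4) = E (exp (x h / sqrt 2))\<close> for a standard normal
  \<open>h\<close>, avoids identifying the law of the linear form.\<close>

lemma gauss_linear_square_mgf:
  assumes "(\<Sum>k<d. (c k)\<^sup>2) = 1"
  shows "(\<integral>\<^sup>+z. ennreal (exp ((\<Sum>k<d. c k * z k)\<^sup>2 / 4)) \<partial>gauss d) = ennreal (sqrt 2)"
proof -
  interpret G: prob_space "gauss d" by (rule prob_space_gauss)
  interpret N: prob_space std_normal by (rule prob_space_std_normal)
  interpret P: pair_sigma_finite "gauss d" std_normal ..
  have "(\<integral>\<^sup>+z. ennreal (exp ((\<Sum>k<d. c k * z k)\<^sup>2 / 4)) \<partial>gauss d)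
    = (\<integral>\<^sup>+z. \<integral>\<^sup>+h. ennreal (exp (((\<Sum>k<d. c k * z k) / sqrt 2) * h)) \<partial>std_normal \<partial>gauss d)"
    by (subst std_normal_mgf) (simp add: power_divide)
  also have "\<dots> = (\<integral>\<^sup>+h. \<integral>\<^sup>+z. ennreal (exp (((\<Sum>k<d. c k * z k) / sqrt 2) * h)) \<partial>gauss d \<partial>std_normal)"
    by (rule P.Fubini'[symmetric]) measurable
  also have "\<dots> = (\<integral>\<^sup>+h. ennreal (exp ((1 / 4) * h\<^sup>2)) \<partial>std_normal)"
  proof (intro nn_integral_cong)
    fix h :: real
    have "((\<Sum>k<d. c k * z k) / sqrt 2) * h = (\<Sum>k<d. (c k * h / sqrt 2) * z k)" for z :: "nat \<Rightarrow> real"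
      by (simp add: sum_divide_distrib sum_distrib_left mult_ac)
    moreover have "(\<Sum>k<d. (c k * h / sqrt 2)\<^sup>2) = h\<^sup>2 / 2"
      using assms by (simp add: power_divide power_mult_distrib sum_divide_distrib[symmetric]
          sum_distrib_right[symmetric])
    ultimately show "(\<integral>\<^sup>+z. ennreal (exp (((\<Sum>k<d. c k * z k) / sqrt 2) * h)) \<partial>gauss d)
        = ennreal (exp ((1 / 4) * h\<^sup>2))"
      by (simp only: gauss_mgf) simp
  qed
  also have "\<dots> = ennreal (sqrt 2)"
    by (subst std_normal_square_mgf) (simp_all add: real_sqrt_divide)
  finally show ?thesis .
qed

text \<open>Jensen replaces diagonalisation: the form is a convex combination, with weights |row
  k|^2 / 4, of terms 4 (c_k . z)^2 with unit vectors c_k. Dividing by 16 leaves (c_k . z)^2 / 4, the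
  case of \<open>gauss_linear_square_mgf\<close>. The normalisation 4 is the squared Frobenius norm
  of a projection of rank 4.\<close>

lemma gauss_quadratic_form_mgf:
  fixes M :: "nat \<Rightarrow> nat \<Rightarrow> real"
  assumes M: "(\<Sum>k<d. \<Sum>j<d. (M k j)\<^sup>2) = 4"
  shows "(\<integral>\<^sup>+z. ennreal (exp ((\<Sum>k<d. (\<Sum>j<d. M k j * z j)\<^sup>2) / 16)) \<partial>gauss d) \<le> ennreal (sqrt 2)"
proof -
  define p where "p k = (\<Sum>j<d. (M k j)\<^sup>2) / 4" for k
  define c where "c k j = M k j / sqrt (4 * p k)" for k j
  have p: "p k \<ge> 0" for k by (simp add: p_def sum_nonneg)
  have p1: "(\<Sum>k<d. p k) = 1" using M by (simp add: p_def sum_divide_distrib[symmetric])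
  have Mc: "M k j = sqrt (4 * p k) * c k j" if "j < d" for k j
  \<comment> \<open>On a zero row \<open>c\<close> is 0 by division by zero, and the identity
    survives because a vanishing sum of squares makes every \<open>M k j\<close> vanish.\<close>
  proof (cases "p k = 0")
    case True
    then have "\<forall>j\<in>{..<d}. (M k j)\<^sup>2 = 0"
      by (subst sum_nonneg_eq_0_iff[symmetric]) (simp_all add: p_def)
    then show ?thesis using True that by simp
  next
    case False
    then show ?thesis by (simp add: c_def)
  qed
  have c1: "(\<Sum>j<d. (c k j)\<^sup>2) = 1" if "p k \<noteq> 0" for k
  proof -
    have "(\<Sum>j<d. (c k j)\<^sup>2) = (\<Sum>j<d. (M k j)\<^sup>2) / (4 * p k)"
      using p[of k] by (simp add: c_def power_divide sum_divide_distrib)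
    then show ?thesis using that by (simp add: p_def)
  qed
  have jensen: "exp ((\<Sum>k<d. (\<Sum>j<d. M k j * z j)\<^sup>2) / 16)
      \<le> (\<Sum>k<d. p k * exp ((\<Sum>j<d. c k j * z j)\<^sup>2 / 4))" for z
  proof -
    have "(\<Sum>j<d. M k j * z j) = sqrt (4 * p k) * (\<Sum>j<d. c k j * z j)" for k
      by (simp add: Mc sum_distrib_left mult_ac)
    then have "(\<Sum>k<d. (\<Sum>j<d. M k j * z j)\<^sup>2) / 16 = (\<Sum>k<d. p k *\<^sub>R ((\<Sum>j<d. c k j * z j)\<^sup>2 / 4))"
      using p by (simp add: power_mult_distrib sum_divide_distrib)
    also have "exp \<dots> \<le> (\<Sum>k<d. p k * exp ((\<Sum>j<d. c k j * z j)\<^sup>2 / 4))"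
      using p p1 by (intro convex_on_sum[OF _ _ exp_convex]) auto
    finally show ?thesis .
  qed
  have "(\<integral>\<^sup>+z. ennreal (exp ((\<Sum>k<d. (\<Sum>j<d. M k j * z j)\<^sup>2) / 16)) \<partial>gauss d)
    \<le> (\<integral>\<^sup>+z. (\<Sum>k<d. ennreal (p k) * ennreal (exp ((\<Sum>j<d. c k j * z j)\<^sup>2 / 4))) \<partial>gauss d)"
  proof (intro nn_integral_mono)
    fix z
    have "(\<Sum>k<d. ennreal (p k) * ennreal (exp ((\<Sum>j<d. c k j * z j)\<^sup>2 / 4)))
        = (\<Sum>k<d. ennreal (p k * exp ((\<Sum>j<d. c k j * z j)\<^sup>2 / 4)))"
      using p by (intro sum.cong refl ennreal_mult[symmetric]) auto
    also have "\<dots> = ennreal (\<Sum>k<d. p k * exp ((\<Sum>j<d. c k j * z j)\<^sup>2 / 4))"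
      using p by (intro sum_ennreal) simp
    finally show "ennreal (exp ((\<Sum>k<d. (\<Sum>j<d. M k j * z j)\<^sup>2) / 16))
        \<le> (\<Sum>k<d. ennreal (p k) * ennreal (exp ((\<Sum>j<d. c k j * z j)\<^sup>2 / 4)))"
      using jensen[of z] by (simp only: ennreal_leI)
  qed
  also have "\<dots> = (\<Sum>k<d. ennreal (p k) * (\<integral>\<^sup>+z. ennreal (exp ((\<Sum>j<d. c k j * z j)\<^sup>2 / 4)) \<partial>gauss d))"
    by (subst nn_integral_sum) (simp_all add: nn_integral_cmult)
  also have "\<dots> = (\<Sum>k<d. ennreal (p k) * ennreal (sqrt 2))"
  proof (intro sum.cong refl)
    fix k
    show "ennreal (p k) * (\<integral>\<^sup>+z. ennreal (exp ((\<Sum>j<d. c k j * z j)\<^sup>2 / 4)) \<partial>gauss d)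
        = ennreal (p k) * ennreal (sqrt 2)"
    proof (cases "p k = 0")
      case False
      then show ?thesis by (simp only: gauss_linear_square_mgf[OF c1[OF False]])
    qed simp
  qed
  also have "\<dots> = ennreal (sqrt 2)"
    using p p1 by (simp add: ennreal_mult[symmetric] sum_ennreal sum_distrib_right[symmetric])
  finally show ?thesis .
qed

section \<open>Chernoff bounds and chi-square tails\<close>

lemma chernoff:
  assumes [measurable]: "h \<in> borel_measurable M"
    and "(\<integral>\<^sup>+x. ennreal (exp (h x)) \<partial>M) \<le> ennreal B"
  shows "emeasure M {x \<in> space M. h x \<ge> c} \<le> ennreal (B * exp (- c))"
proof -
  have "emeasure M {x \<in> space M. h x \<ge> c}
      \<le> emeasure M ({x \<in> space M. 1 \<le> ennreal (exp (- c)) * ennreal (exp (h x))})"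
    by (intro emeasure_mono) (auto simp: ennreal_mult[symmetric] exp_add[symmetric] simp flip: ennreal_1 intro!: ennreal_leI)
  also have "\<dots> \<le> ennreal (exp (- c)) * (\<integral>\<^sup>+x. ennreal (exp (h x)) * indicator (space M) x \<partial>M)"
    using nn_integral_Markov_inequality[of "\<lambda>x. ennreal (exp (h x))" "space M" M "ennreal (exp (- c))"]
    by simp
  also have "\<dots> \<le> ennreal (exp (- c)) * ennreal B"
  proof (intro mult_left_mono)
    show "(\<integral>\<^sup>+x. ennreal (exp (h x)) * indicator (space M) x \<partial>M) \<le> ennreal B"
      by (rule order_trans[OF nn_integral_mono assms(2)]) (simp add: indicator_def)
  qed simp
  finally show ?thesis by (simp add: ennreal_mult'' mult.commute)
qed

lemma gauss_norm_upper_tail: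
  assumes "0 \<le> u" "u \<le> real d" "0 < d"
  shows "emeasure (gauss d) {z \<in> space (gauss d). (\<Sum>k<d. (z k)\<^sup>2) \<ge> real d + u}
    \<le> ennreal (exp (- u\<^sup>2 / (16 * real d)))"
proof -
  define s where "s = u / (8 * real d)"
  have "emeasure (gauss d) {z \<in> space (gauss d). s * (\<Sum>k<d. (z k)\<^sup>2) \<ge> s * (real d + u)}
      \<le> ennreal (exp (real d * (s + 4 * s\<^sup>2)) * exp (- (s * (real d + u))))"
    using assms by (intro chernoff gauss_norm_mgf_le) (auto simp: s_def field_simps)
  also have "exp (real d * (s + 4 * s\<^sup>2)) * exp (- (s * (real d + u))) = exp (- u\<^sup>2 / (16 * real d))"
    using assms by (simp add: exp_add[symmetric] s_def field_simps power2_eq_square)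
  finally show ?thesis
    using assms by (elim order_trans[rotated], intro emeasure_mono)
      (auto simp: s_def intro!: divide_right_mono mult_left_mono)
qed

lemma gauss_norm_lower_tail:
  assumes "0 \<le> u" "u \<le> real d" "0 < d"
  shows "emeasure (gauss d) {z \<in> space (gauss d). (\<Sum>k<d. (z k)\<^sup>2) \<le> real d - u}
    \<le> ennreal (exp (- u\<^sup>2 / (16 * real d)))"
proof -
  define s where "s = - u / (8 * real d)"
  have "emeasure (gauss d) {z \<in> space (gauss d). s * (\<Sum>k<d. (z k)\<^sup>2) \<ge> s * (real d - u)}
      \<le> ennreal (exp (real d * (s + 4 * s\<^sup>2)) * exp (- (s * (real d - u))))"
    using assms by (intro chernoff gauss_norm_mgf_le) (auto simp: s_def field_simps)
  also have "exp (real d * (s + 4 * s\<^sup>2)) * exp (- (s * (real d - u))) = exp (- u\<^sup>2 / (16 * real d))"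
    using assms by (simp add: exp_add[symmetric] s_def field_simps power2_eq_square)
  finally show ?thesis
    using assms by (elim order_trans[rotated], intro emeasure_mono)
      (auto simp: s_def intro!: divide_right_mono mult_left_mono)
qed

subsection \<open>Signal coordinates and the orthogonal noise component\<close>

lemma inner_d_commute: "inner_d d u v = inner_d d v u"
  by (simp add: inner_d_def mult.commute)

lemma inner_d_linear [simp]:
  "inner_d d u (\<lambda>i. v i + w i) = inner_d d u v + inner_d d u w"
  "inner_d d u (\<lambda>i. v i - w i) = inner_d d u v - inner_d d u w"
  "inner_d d u (\<lambda>i. c * w i) = c * inner_d d u w"
  "inner_d d (\<lambda>i. v i + w i) u = inner_d d v u + inner_d d w u"
  "inner_d d (\<lambda>i. v i - w i) u = inner_d d v u - inner_d d w u"
  "inner_d d (\<lambda>i. c * w i) u = c * inner_d d w u"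
  "inner_d d u (- v) = - inner_d d u v"
  "inner_d d u (\<lambda>i. 0) = 0"
  by (simp_all add: inner_d_def algebra_simps sum.distrib sum_subtractf sum_distrib_left sum_negf)

lemma inner_d_sum:
  "inner_d d u (\<lambda>i. \<Sum>j\<in>J. f j i) = (\<Sum>j\<in>J. inner_d d u (f j))"
  "inner_d d (\<lambda>i. \<Sum>j\<in>J. f j i) u = (\<Sum>j\<in>J. inner_d d (f j) u)"
  unfolding inner_d_def sum_distrib_left sum_distrib_right by (rule sum.swap)+

lemma inner_d_self_nonneg [simp]: "0 \<le> inner_d d u u"
  by (simp add: inner_d_def sum_nonneg)

lemma inner_d_cong: "(\<And>i. i < d \<Longrightarrow> v i = w i) \<Longrightarrow> inner_d d u v = inner_d d u w"
  by (simp add: inner_d_def)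

lemma L2_set_power2: "(L2_set f {..<d})\<^sup>2 = inner_d d f f"
  by (simp add: L2_set_def sum_nonneg inner_d_def power2_eq_square)

lemma inner_d_measurable [measurable (raw)]:
  assumes [measurable]: "f \<in> borel_measurable M" "g \<in> borel_measurable M"
  shows "(\<lambda>x. inner_d d (f x) (g x)) \<in> borel_measurable M"
  using assms[THEN measurable_product_then_coordinatewise] unfolding inner_d_def by measurable

locale weak_model =
  fixes Q :: params
  assumes params_ok: "params_ok Q"
begin

abbreviation "inn \<equiv> inner_d (dimn Q)"
abbreviation "\<sigma> \<equiv> sigma_p Q"

definition al :: "real \<Rightarrow> vec \<Rightarrow> real" where
  "al s w = inn (mu Q s) w / (norm_mu Q)\<^sup>2"

definition be :: "real \<Rightarrow> vec \<Rightarrow> real" where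
  "be s w = inn (nu Q s) w / (norm_nu Q)\<^sup>2"

text \<open>Multiplication by \<open>Lambda Q\<close> in closed form (\<open>Lambda_apply\<close>):
  the orthogonal projection that removes the four signal directions.\<close>

definition proj :: "vec \<Rightarrow> vec" where
  "proj w = (\<lambda>i. w i - al 1 w * mu Q 1 i - al (-1) w * mu Q (-1) i
     - be 1 w * nu Q 1 i - be (-1) w * nu Q (-1) i)"

lemma sigma_pos: "0 < \<sigma>" and norm_mu_pos: "0 < norm_mu Q" and norm_nu_pos: "0 < norm_nu Q"
  using params_ok by (auto simp: params_ok_def signals_ok_def)

lemma signal_inner:
  "inn (mu Q 1) (mu Q 1) = (norm_mu Q)\<^sup>2" "inn (mu Q (-1)) (mu Q (-1)) = (norm_mu Q)\<^sup>2"
  "inn (nu Q 1) (nu Q 1) = (norm_nu Q)\<^sup>2" "inn (nu Q (-1)) (nu Q (-1)) = (norm_nu Q)\<^sup>2"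
  "inn (mu Q 1) (mu Q (-1)) = 0" "inn (mu Q (-1)) (mu Q 1) = 0"
  "inn (nu Q 1) (nu Q (-1)) = 0" "inn (nu Q (-1)) (nu Q 1) = 0"
  "s \<in> {1, -1} \<Longrightarrow> s' \<in> {1, -1} \<Longrightarrow> inn (mu Q s) (nu Q s') = 0"
  "s \<in> {1, -1} \<Longrightarrow> s' \<in> {1, -1} \<Longrightarrow> inn (nu Q s) (mu Q s') = 0"
proof -
  have ok: "signals_ok Q" using params_ok by (simp add: params_ok_def)
  then have eqs: "L2_set (mu Q (-1)) {..<dimn Q} = norm_mu Q" "L2_set (nu Q (-1)) {..<dimn Q} = norm_nu Q"
    "inn (mu Q 1) (mu Q (-1)) = 0" "inn (nu Q 1) (nu Q (-1)) = 0"
    unfolding signals_ok_def by blast+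
  show "inn (mu Q 1) (mu Q 1) = (norm_mu Q)\<^sup>2" "inn (nu Q 1) (nu Q 1) = (norm_nu Q)\<^sup>2"
    unfolding norm_mu_def norm_nu_def L2_set_power2 by (rule refl)+
  show "inn (mu Q (-1)) (mu Q (-1)) = (norm_mu Q)\<^sup>2" "inn (nu Q (-1)) (nu Q (-1)) = (norm_nu Q)\<^sup>2"
    unfolding eqs(1,2)[symmetric] L2_set_power2 by (rule refl)+
  show "inn (mu Q 1) (mu Q (-1)) = 0" "inn (nu Q 1) (nu Q (-1)) = 0" by fact+
  then show "inn (mu Q (-1)) (mu Q 1) = 0" "inn (nu Q (-1)) (nu Q 1) = 0"
    by (simp_all only: inner_d_commute)
  have cross: "inn (mu Q r) (nu Q r') = 0" if "r \<in> {1, -1}" "r' \<in> {1, -1}" for r r'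
    using ok that unfolding signals_ok_def by blast
  show "inn (mu Q s) (nu Q s') = 0" if "s \<in> {1, -1}" "s' \<in> {1, -1}" by (rule cross[OF that])
  show "inn (nu Q s) (mu Q s') = 0" if "s \<in> {1, -1}" "s' \<in> {1, -1}"
    by (rule trans[OF inner_d_commute cross[OF that(2,1)]])
qed

lemma al_be_mu_nu:
  assumes "s \<in> {1, -1}" "s' \<in> {1, -1}"
  shows "al s (mu Q s') = (if s = s' then 1 else 0)" "be s (nu Q s') = (if s = s' then 1 else 0)"
    "al s (nu Q s') = 0" "be s (mu Q s') = 0"
  using assms norm_mu_pos norm_nu_pos by (auto simp: al_def be_def signal_inner)

lemma al_linear [simp]:
  "al s (\<lambda>i. v i + w i) = al s v + al s w" "al s (\<lambda>i. v i - w i) = al s v - al s w"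
  "al s (\<lambda>i. c * w i) = c * al s w" "al s (- w) = - al s w"
  by (simp_all add: al_def add_divide_distrib diff_divide_distrib)

lemma be_linear [simp]:
  "be s (\<lambda>i. v i + w i) = be s v + be s w" "be s (\<lambda>i. v i - w i) = be s v - be s w"
  "be s (\<lambda>i. c * w i) = c * be s w" "be s (- w) = - be s w"
  by (simp_all add: be_def add_divide_distrib diff_divide_distrib)

lemma al_sum: "al s (\<lambda>i. \<Sum>j\<in>J. f j i) = (\<Sum>j\<in>J. al s (f j))"
  and be_sum: "be s (\<lambda>i. \<Sum>j\<in>J. f j i) = (\<Sum>j\<in>J. be s (f j))"
  by (simp_all add: al_def be_def inner_d_sum sum_divide_distrib)

lemma proj_sum: "proj (\<lambda>i. \<Sum>j\<in>J. c j * f j i) = (\<lambda>i. \<Sum>j\<in>J. c j * proj (f j) i)"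
  by (simp add: proj_def al_sum be_sum sum_subtractf right_diff_distrib sum_distrib_left
      sum_distrib_right mult_ac)

lemma inner_proj_right: "inn u (proj w) = inn u w - al 1 w * inn u (mu Q 1)
    - al (-1) w * inn u (mu Q (-1)) - be 1 w * inn u (nu Q 1) - be (-1) w * inn u (nu Q (-1))"
  by (simp add: proj_def)

lemma proj_orthogonal:
  assumes "s \<in> {1, -1}"
  shows "inn (mu Q s) (proj w) = 0" "inn (nu Q s) (proj w) = 0"
  using assms norm_mu_pos norm_nu_pos
  by (auto simp: inner_proj_right signal_inner) (simp_all add: al_def be_def)

lemma proj_eq_self:
  assumes "\<And>s. s \<in> {1, -1} \<Longrightarrow> inn (mu Q s) w = 0 \<and> inn (nu Q s) w = 0"
  shows "proj w = w"
  using assms by (simp add: proj_def al_def be_def)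

lemma proj_proj [simp]: "proj (proj w) = proj w"
  by (rule proj_eq_self) (use proj_orthogonal in blast)

lemma inner_proj: "inn (proj u) (proj w) = inn u (proj w)"
proof -
  have "inn (proj w) (proj u) = inn (proj w) u"
    unfolding inner_proj_right[of "proj w" u] inner_d_commute[of _ "proj w" "mu Q _"]
      inner_d_commute[of _ "proj w" "nu Q _"] by (simp add: proj_orthogonal)
  then show ?thesis by (simp only: inner_d_commute[of _ "proj u"] inner_d_commute[of _ u])
qed

text \<open>Pythagoras for the four signals and their complement. The Gram entries of the samples
  are bounded summand by summand from here.\<close>

lemma inner_decomp:
  "inn u w = (norm_mu Q)\<^sup>2 * (al 1 u * al 1 w + al (-1) u * al (-1) w)
    + (norm_nu Q)\<^sup>2 * (be 1 u * be 1 w + be (-1) u * be (-1) w) + inn (proj u) (proj w)"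
proof -
  have "inn u (mu Q s) = (norm_mu Q)\<^sup>2 * al s u" "inn u (nu Q s) = (norm_nu Q)\<^sup>2 * be s u" for s
    using norm_mu_pos norm_nu_pos by (simp_all add: al_def be_def inner_d_commute)
  then have "inn u (proj w) = inn u w - (norm_mu Q)\<^sup>2 * (al 1 u * al 1 w + al (-1) u * al (-1) w)
    - (norm_nu Q)\<^sup>2 * (be 1 u * be 1 w + be (-1) u * be (-1) w)"
    by (simp add: inner_proj_right algebra_simps)
  then show ?thesis by (simp add: inner_proj)
qed

lemma inner_proj_le: "inn (proj w) (proj w) \<le> inn w w"
  using inner_decomp[of w w] by (simp add: power2_eq_square[symmetric])

lemma Lambda_apply:
  assumes "i < dimn Q"
  shows "(\<Sum>j<dimn Q. Lambda Q i j * w j) = proj w i"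
proof -
  have "(\<Sum>j<dimn Q. Lambda Q i j * w j)
    = (\<Sum>j<dimn Q. (if i = j then w j else 0) - (mu Q 1 j * w j) * (mu Q 1 i / (norm_mu Q)\<^sup>2)
        - (mu Q (-1) j * w j) * (mu Q (-1) i / (norm_mu Q)\<^sup>2)
        - (nu Q 1 j * w j) * (nu Q 1 i / (norm_nu Q)\<^sup>2)
        - (nu Q (-1) j * w j) * (nu Q (-1) i / (norm_nu Q)\<^sup>2))"
    by (intro sum.cong refl) (simp add: Lambda_def algebra_simps)
  also have "\<dots> = proj w i"
    unfolding sum_subtractf sum_distrib_right[symmetric] using assms
    by (simp add: proj_def al_def be_def inner_d_def)
  finally show ?thesis .
qed

lemma Lambda_sym: "Lambda Q i j = Lambda Q j i"
  by (simp add: Lambda_def mult.commute)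

lemma Lambda_quadratic: "(\<Sum>i<dimn Q. \<Sum>j<dimn Q. u i * Lambda Q i j * w j) = inn (proj u) (proj w)"
proof -
  have "(\<Sum>i<dimn Q. \<Sum>j<dimn Q. u i * Lambda Q i j * w j) = inn u (proj w)"
    unfolding inner_d_def
    by (intro sum.cong refl) (simp add: Lambda_apply[symmetric] sum_distrib_left mult_ac)
  then show ?thesis by (simp add: inner_proj)
qed

text \<open>A row of the matrix is the projection of a basis vector, so this is idempotence of
  \<open>proj\<close>, obtained without multiplying out the rank-one terms.\<close>

lemma Lambda_idem:
  assumes "i < dimn Q" "j < dimn Q"
  shows "(\<Sum>k<dimn Q. Lambda Q i k * Lambda Q j k) = Lambda Q i j"
proof -
  define e where "e = (\<lambda>k. if k = j then 1 else 0 :: real)"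
  have row: "proj e k = Lambda Q k j" if "k < dimn Q" for k
    using assms by (subst Lambda_apply[OF that, symmetric]) (simp add: e_def if_distrib cong: if_cong)
  have "(\<Sum>k<dimn Q. Lambda Q i k * Lambda Q j k) = (\<Sum>k<dimn Q. Lambda Q i k * proj e k)"
    using row by (intro sum.cong refl) (auto simp: Lambda_sym[of j])
  also have "\<dots> = proj e i"
    using assms(1) by (simp add: Lambda_apply)
  finally show ?thesis using row assms by simp
qed

lemma Lambda_trace: "(\<Sum>i<dimn Q. Lambda Q i i) = real (dimn Q) - 4"
proof -
  have "(\<Sum>i<dimn Q. Lambda Q i i) = real (dimn Q)
    - inn (mu Q 1) (mu Q 1) / (norm_mu Q)\<^sup>2 - inn (mu Q (-1)) (mu Q (-1)) / (norm_mu Q)\<^sup>2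
    - inn (nu Q 1) (nu Q 1) / (norm_nu Q)\<^sup>2 - inn (nu Q (-1)) (nu Q (-1)) / (norm_nu Q)\<^sup>2"
    by (simp add: Lambda_def sum_subtractf sum_divide_distrib inner_d_def)
  then show ?thesis using norm_mu_pos norm_nu_pos by (simp add: signal_inner)
qed

subsection \<open>The noise vector\<close>

definition fac :: "nat \<Rightarrow> nat \<Rightarrow> real" where
  "fac = cov_factor (dimn Q) (\<lambda>i j. \<sigma>\<^sup>2 * Lambda Q i j)"

definition noise_map :: "vec \<Rightarrow> vec" where
  "noise_map z = (\<lambda>i. if i < dimn Q then \<Sum>k<dimn Q. fac i k * z k else 0)"

lemma noise_eq: "noise Q = distr (gauss (dimn Q)) borel noise_map"
  unfolding noise_def gaussian_def noise_map_def[abs_def] fac_def ..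

text \<open>The choice in \<open>cov_factor\<close> is usable once some factor exists; sigma times
  \<open>Lambda\<close> is one, being symmetric and idempotent up to scale. This identity is all
  that is known about \<open>fac\<close>.\<close>

lemma fac_cov:
  assumes "i < dimn Q" "j < dimn Q"
  shows "(\<Sum>k<dimn Q. fac i k * fac j k) = \<sigma>\<^sup>2 * Lambda Q i j"
proof -
  have "\<exists>A. \<forall>i<dimn Q. \<forall>j<dimn Q. (\<Sum>k<dimn Q. A i k * A j k) = \<sigma>\<^sup>2 * Lambda Q i j"
  proof (intro exI[of _ "\<lambda>i k. \<sigma> * Lambda Q i k"] allI impI)
    fix i j assume "i < dimn Q" "j < dimn Q"
    then show "(\<Sum>k<dimn Q. \<sigma> * Lambda Q i k * (\<sigma> * Lambda Q j k)) = \<sigma>\<^sup>2 * Lambda Q i j"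
      by (simp only: Lambda_idem[symmetric]) (simp add: sum_distrib_left power2_eq_square mult_ac)
  qed
  then have "\<forall>i<dimn Q. \<forall>j<dimn Q. (\<Sum>k<dimn Q. fac i k * fac j k) = \<sigma>\<^sup>2 * Lambda Q i j"
    unfolding fac_def cov_factor_def by (rule someI_ex)
  then show ?thesis using assms by blast
qed

text \<open>For the factor A this is |A^T u|^2 = u^T A A^T u, the variance of the linear form u
  under the noise.\<close>

lemma fac_transpose_norm:
  "(\<Sum>k<dimn Q. (inn u (\<lambda>i. fac i k))\<^sup>2) = \<sigma>\<^sup>2 * inn (proj u) (proj u)"
proof -
  have "(\<Sum>k<dimn Q. (inn u (\<lambda>i. fac i k))\<^sup>2)
      = (\<Sum>k<dimn Q. \<Sum>i<dimn Q. \<Sum>j<dimn Q. u i * u j * (fac i k * fac j k))"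
    by (simp add: inner_d_def power2_eq_square sum_product mult_ac)
  also have "\<dots> = (\<Sum>i<dimn Q. \<Sum>j<dimn Q. \<Sum>k<dimn Q. u i * u j * (fac i k * fac j k))"
    by (rule trans[OF sum.swap]) (intro sum.cong refl sum.swap)
  also have "\<dots> = (\<Sum>i<dimn Q. \<Sum>j<dimn Q. \<sigma>\<^sup>2 * (u i * Lambda Q i j * u j))"
    by (intro sum.cong refl) (simp only: sum_distrib_left[symmetric] fac_cov lessThan_iff, simp)
  finally show ?thesis by (simp add: sum_distrib_left[symmetric] Lambda_quadratic)
qed

lemma inner_noise_map: "inn u (noise_map z) = (\<Sum>k<dimn Q. inn u (\<lambda>i. fac i k) * z k)"
proof -
  have "inn u (noise_map z) = inn u (\<lambda>i. \<Sum>k<dimn Q. z k * fac i k)"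
    by (intro inner_d_cong) (simp add: noise_map_def mult.commute)
  then show ?thesis by (simp add: inner_d_sum mult.commute)
qed

text \<open>The noise has variance zero along a signal, and a vanishing sum of squares makes each
  column orthogonal to it. Hence \<open>noise_map\<close> is orthogonal to the signals
  pointwise.\<close>

lemma fac_column_orthogonal:
  assumes "s \<in> {1, -1}" "k < dimn Q"
  shows "inn (mu Q s) (\<lambda>i. fac i k) = 0" "inn (nu Q s) (\<lambda>i. fac i k) = 0"
proof -
  have *: "inn u (\<lambda>i. fac i k) = 0" if "proj u = (\<lambda>_. 0)" for u
    using fac_transpose_norm[of u] that assms(2) by (simp add: sum_nonneg_eq_0_iff)
  show "inn (mu Q s) (\<lambda>i. fac i k) = 0" "inn (nu Q s) (\<lambda>i. fac i k) = 0"
    using assms(1) by (auto intro!: * simp: proj_def al_be_mu_nu)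
qed

lemma noise_map_orthogonal:
  assumes "s \<in> {1, -1}"
  shows "inn (mu Q s) (noise_map z) = 0" "inn (nu Q s) (noise_map z) = 0"
  using fac_column_orthogonal[OF assms] by (simp_all add: inner_noise_map)

lemma noise_map_measurable [measurable]: "noise_map \<in> borel_measurable (gauss (dimn Q))"
  unfolding noise_map_def by (intro measurable_coordinatewise_then_product) measurable

lemma prob_space_noise: "prob_space (noise Q)"
  unfolding noise_eq by (intro prob_space.prob_space_distr prob_space_gauss noise_map_measurable)

lemma sets_noise [simp, measurable_cong]: "sets (noise Q) = sets borel"
  and space_noise [simp]: "space (noise Q) = UNIV"
  by (simp_all add: noise_eq)

lemma noise_mgf:
  "(\<integral>\<^sup>+\<xi>. ennreal (exp (inn u \<xi>)) \<partial>noise Q) = ennreal (exp (\<sigma>\<^sup>2 * inn (proj u) (proj u) / 2))"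
  unfolding noise_eq
  by (subst nn_integral_distr) (simp_all add: inner_noise_map gauss_mgf fac_transpose_norm)

text \<open>Since \<open>fac\<close> times its transpose is \<open>\<sigma>\<^sup>2\<close> times a projection of rank \<open>d - 4\<close>, this matrix is a projection of
  rank 4, and the chi-square \<open>|z|\<^sup>2\<close> differs from \<open>|noise_map z|\<^sup>2 / \<sigma>\<^sup>2\<close> only by its quadratic form.\<close>

definition ker_proj :: "nat \<Rightarrow> nat \<Rightarrow> real" where
  "ker_proj k l = (if k = l then 1 else 0) - inn (\<lambda>i. fac i k) (\<lambda>i. fac i l) / \<sigma>\<^sup>2"

lemma proj_fac_column: "k < dimn Q \<Longrightarrow> proj (\<lambda>i. fac i k) = (\<lambda>i. fac i k)"
  by (rule proj_eq_self) (use fac_column_orthogonal in blast)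

text \<open>A^T A / sigma^2 is idempotent because A^T (A A^T) A = sigma^2 A^T Lambda A and Lambda
  fixes the columns of A.\<close>

lemma ker_proj_idem:
  assumes "k < dimn Q" "l < dimn Q"
  shows "(\<Sum>m<dimn Q. ker_proj m k * ker_proj m l) = ker_proj k l"
proof -
  let ?P = "\<lambda>k l. inn (\<lambda>i. fac i k) (\<lambda>i. fac i l) / \<sigma>\<^sup>2"
  have "(\<Sum>m<dimn Q. inn (\<lambda>i. fac i k) (\<lambda>i. fac i m) * inn (\<lambda>i. fac i l) (\<lambda>i. fac i m))
    = (\<Sum>m<dimn Q. \<Sum>i<dimn Q. \<Sum>j<dimn Q. fac i k * fac j l * (fac i m * fac j m))"
    by (simp add: inner_d_def sum_product mult_ac)
  also have "\<dots> = (\<Sum>i<dimn Q. \<Sum>j<dimn Q. \<Sum>m<dimn Q. fac i k * fac j l * (fac i m * fac j m))"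
    by (rule trans[OF sum.swap]) (intro sum.cong refl sum.swap)
  also have "\<dots> = (\<Sum>i<dimn Q. \<Sum>j<dimn Q. \<sigma>\<^sup>2 * (fac i k * Lambda Q i j * fac j l))"
    by (intro sum.cong refl) (simp only: sum_distrib_left[symmetric] fac_cov lessThan_iff, simp)
  also have "\<dots> = \<sigma>\<^sup>2 * inn (\<lambda>i. fac i k) (\<lambda>i. fac i l)"
    using assms by (simp add: sum_distrib_left[symmetric] Lambda_quadratic proj_fac_column)
  finally have "(\<Sum>m<dimn Q. ?P k m * ?P l m) = ?P k l"
    using sigma_pos by (simp add: sum_divide_distrib[symmetric] power2_eq_square)
  moreover have "ker_proj m k * ker_proj m l = (if m = k then if k = l then 1 else 0 else 0)
      - (if m = k then ?P l m else 0) - (if m = l then ?P k m else 0) + ?P k m * ?P l m" for m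
    by (simp add: ker_proj_def inner_d_commute algebra_simps)
  ultimately show ?thesis
    using assms by (simp add: sum.distrib sum_subtractf ker_proj_def inner_d_commute)
qed

lemma ker_proj_trace: "(\<Sum>k<dimn Q. ker_proj k k) = 4"
proof -
  have "(\<Sum>k<dimn Q. inn (\<lambda>i. fac i k) (\<lambda>i. fac i k))
      = (\<Sum>i<dimn Q. \<Sum>k<dimn Q. fac i k * fac i k)"
    unfolding inner_d_def by (rule sum.swap)
  also have "\<dots> = \<sigma>\<^sup>2 * (real (dimn Q) - 4)"
    by (simp add: fac_cov sum_distrib_left[symmetric] Lambda_trace)
  finally show ?thesis
    using sigma_pos by (simp add: ker_proj_def sum_subtractf sum_divide_distrib[symmetric])
qed

text \<open>The squared Frobenius norm of an orthogonal projection is its trace. This is the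
  normalisation that \<open>gauss_quadratic_form_mgf\<close> asks for.\<close>

lemma ker_proj_square_sum: "(\<Sum>k<dimn Q. \<Sum>j<dimn Q. (ker_proj k j)\<^sup>2) = 4"
  by (subst sum.swap) (simp add: power2_eq_square ker_proj_idem ker_proj_trace)

lemma noise_map_norm:
  "(\<Sum>k<dimn Q. (z k)\<^sup>2) = inn (noise_map z) (noise_map z) / \<sigma>\<^sup>2
    + (\<Sum>k<dimn Q. (\<Sum>j<dimn Q. ker_proj k j * z j)\<^sup>2)"
proof -
  have "(\<Sum>k<dimn Q. (\<Sum>j<dimn Q. ker_proj k j * z j)\<^sup>2)
      = (\<Sum>k<dimn Q. \<Sum>j<dimn Q. \<Sum>l<dimn Q. z j * z l * (ker_proj k j * ker_proj k l))"
    by (simp add: power2_eq_square sum_product mult_ac)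
  also have "\<dots> = (\<Sum>j<dimn Q. \<Sum>l<dimn Q. \<Sum>k<dimn Q. z j * z l * (ker_proj k j * ker_proj k l))"
    by (rule trans[OF sum.swap]) (intro sum.cong refl sum.swap)
  also have "\<dots> = (\<Sum>j<dimn Q. \<Sum>l<dimn Q. z j * z l * ker_proj j l)"
    by (intro sum.cong refl) (simp add: sum_distrib_left[symmetric] ker_proj_idem)
  also have "\<dots> = (\<Sum>j<dimn Q. \<Sum>l<dimn Q. (if j = l then z j * z l else 0)
      - z j * z l * inn (\<lambda>i. fac i j) (\<lambda>i. fac i l) / \<sigma>\<^sup>2)"
    by (intro sum.cong refl) (simp add: ker_proj_def algebra_simps)
  also have "\<dots> = (\<Sum>j<dimn Q. (z j)\<^sup>2)
      - (\<Sum>j<dimn Q. \<Sum>l<dimn Q. z j * z l * inn (\<lambda>i. fac i j) (\<lambda>i. fac i l)) / \<sigma>\<^sup>2"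
    by (simp add: sum_subtractf power2_eq_square sum_divide_distrib)
  also have "(\<Sum>j<dimn Q. \<Sum>l<dimn Q. z j * z l * inn (\<lambda>i. fac i j) (\<lambda>i. fac i l))
      = inn (noise_map z) (noise_map z)"
  proof -
    have "inn (noise_map z) (noise_map z)
      = (\<Sum>l<dimn Q. inn (noise_map z) (\<lambda>i. fac i l) * z l)"
      by (rule inner_noise_map)
    also have "\<dots> = (\<Sum>l<dimn Q. (\<Sum>j<dimn Q. inn (\<lambda>i. fac i l) (\<lambda>i. fac i j) * z j) * z l)"
      by (simp add: inner_d_commute[of _ "noise_map z"] inner_noise_map)
    also have "\<dots> = (\<Sum>l<dimn Q. \<Sum>j<dimn Q. z j * z l * inn (\<lambda>i. fac i j) (\<lambda>i. fac i l))"
      by (simp add: sum_distrib_right sum_distrib_left mult_ac inner_d_commute)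
    finally show ?thesis by (subst sum.swap) simp
  qed
  finally show ?thesis by simp
qed

lemma noise_map_norm_le: "inn (noise_map z) (noise_map z) \<le> \<sigma>\<^sup>2 * (\<Sum>k<dimn Q. (z k)\<^sup>2)"
  using sigma_pos noise_map_norm[of z] by (simp add: field_simps sum_nonneg)

text \<open>Dropping the kernel part of z leaves |xi|^2 <= sigma^2 |z|^2, usable for s >= 0. For s
  sigma^2 <= 1/4 the quadratic term of the chi-square bound is at most the linear one, hence the
  factor 2.\<close>

lemma noise_norm_mgf:
  assumes "0 \<le> s" "s * \<sigma>\<^sup>2 \<le> 1 / 4"
  shows "(\<integral>\<^sup>+\<xi>. ennreal (exp (s * inn \<xi> \<xi>)) \<partial>noise Q) \<le> ennreal (exp (2 * real (dimn Q) * s * \<sigma>\<^sup>2))"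
proof -
  have "(\<integral>\<^sup>+\<xi>. ennreal (exp (s * inn \<xi> \<xi>)) \<partial>noise Q)
      = (\<integral>\<^sup>+z. ennreal (exp (s * inn (noise_map z) (noise_map z))) \<partial>gauss (dimn Q))"
    unfolding noise_eq by (subst nn_integral_distr) simp_all
  also have "\<dots> \<le> (\<integral>\<^sup>+z. ennreal (exp (s * \<sigma>\<^sup>2 * (\<Sum>k<dimn Q. (z k)\<^sup>2))) \<partial>gauss (dimn Q))"
    using mult_left_mono[OF noise_map_norm_le assms(1)]
    by (intro nn_integral_mono ennreal_leI) (simp add: mult.assoc)
  also have "\<dots> \<le> ennreal (exp (real (dimn Q) * (s * \<sigma>\<^sup>2 + 4 * (s * \<sigma>\<^sup>2)\<^sup>2)))"
    using assms by (intro gauss_norm_mgf_le) simp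
  also have "\<dots> \<le> ennreal (exp (2 * real (dimn Q) * s * \<sigma>\<^sup>2))"
  proof (intro ennreal_leI, subst exp_le_cancel_iff)
    have "(s * \<sigma>\<^sup>2) * (4 * (s * \<sigma>\<^sup>2)) \<le> (s * \<sigma>\<^sup>2) * 1"
      using assms by (intro mult_left_mono) auto
    then have "s * \<sigma>\<^sup>2 + 4 * (s * \<sigma>\<^sup>2)\<^sup>2 \<le> 2 * (s * \<sigma>\<^sup>2)"
      by (simp add: power2_eq_square[of "s * \<sigma>\<^sup>2"])
    from mult_left_mono[OF this, of "real (dimn Q)"]
    show "real (dimn Q) * (s * \<sigma>\<^sup>2 + 4 * (s * \<sigma>\<^sup>2)\<^sup>2) \<le> 2 * real (dimn Q) * s * \<sigma>\<^sup>2"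
      by (simp add: mult_ac)
  qed
  finally show ?thesis .
qed

text \<open>The deviation 2 u is shared: if |xi|^2 / sigma^2 < d - 2 u, then |z|^2 <= d - u or the
  rank 4 form is at least u. An upper deviation already shows in |z|^2.\<close>

lemma noise_norm_tail:
  assumes u: "0 \<le> u" "2 * u \<le> real (dimn Q)" and d: "0 < dimn Q"
  shows "emeasure (noise Q) {\<xi>. \<bar>inn \<xi> \<xi> - \<sigma>\<^sup>2 * real (dimn Q)\<bar> > \<sigma>\<^sup>2 * (2 * u)}
    \<le> ennreal (2 * exp (- u\<^sup>2 / (16 * real (dimn Q))) + 2 * exp (- u / 16))"
proof -
  let ?d = "dimn Q" and ?G = "gauss (dimn Q)" and ?n = "\<lambda>z. \<Sum>k<dimn Q. (z k)\<^sup>2"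
    and ?r = "\<lambda>z. \<Sum>k<dimn Q. (\<Sum>j<dimn Q. ker_proj k j * z j)\<^sup>2"
  let ?U = "{z \<in> space ?G. ?n z \<ge> real ?d + u}" and ?L = "{z \<in> space ?G. ?n z \<le> real ?d - u}"
    and ?R = "{z \<in> space ?G. ?r z / 16 \<ge> u / 16}"
  have "emeasure (noise Q) {\<xi>. \<bar>inn \<xi> \<xi> - \<sigma>\<^sup>2 * real ?d\<bar> > \<sigma>\<^sup>2 * (2 * u)}
    = emeasure ?G (noise_map -` {\<xi>. \<bar>inn \<xi> \<xi> - \<sigma>\<^sup>2 * real ?d\<bar> > \<sigma>\<^sup>2 * (2 * u)} \<inter> space ?G)"
    unfolding noise_eq by (intro emeasure_distr) simp_all
  also have "\<dots> \<le> emeasure ?G (?U \<union> ?L \<union> ?R)"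
  proof (intro emeasure_mono subsetI)
    fix z assume z: "z \<in> noise_map -` {\<xi>. \<bar>inn \<xi> \<xi> - \<sigma>\<^sup>2 * real ?d\<bar> > \<sigma>\<^sup>2 * (2 * u)} \<inter> space ?G"
    define q where "q = inn (noise_map z) (noise_map z) / \<sigma>\<^sup>2"
    have q: "inn (noise_map z) (noise_map z) = \<sigma>\<^sup>2 * q" using sigma_pos by (simp add: q_def)
    have "\<sigma>\<^sup>2 * \<bar>q - real ?d\<bar> > \<sigma>\<^sup>2 * (2 * u)"
      using z by (simp add: q abs_mult right_diff_distrib[symmetric] del: mult_less_cancel_left)
    then have "\<bar>q - real ?d\<bar> > 2 * u" using sigma_pos by simp
    moreover have "?n z = q + ?r z" unfolding q_def by (rule noise_map_norm)
    moreover have "?r z \<ge> 0" by (simp add: sum_nonneg)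
    ultimately show "z \<in> ?U \<union> ?L \<union> ?R" using z u by auto
  qed measurable
  also have "\<dots> \<le> emeasure ?G ?U + emeasure ?G ?L + emeasure ?G ?R"
    by (intro order_trans[OF emeasure_subadditive] add_mono order_refl emeasure_subadditive) measurable
  also have "\<dots> \<le> ennreal (exp (- u\<^sup>2 / (16 * real ?d))) + ennreal (exp (- u\<^sup>2 / (16 * real ?d)))
      + ennreal (sqrt 2 * exp (- (u / 16)))"
    using u d by (intro add_mono gauss_norm_upper_tail gauss_norm_lower_tail chernoff
      gauss_quadratic_form_mgf ker_proj_square_sum) auto
  also have "\<dots> \<le> ennreal (2 * exp (- u\<^sup>2 / (16 * real ?d)) + 2 * exp (- u / 16))"
    using sqrt2_less_2 by (simp add: ennreal_plus[symmetric] del: ennreal_plus)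
  finally show ?thesis .
qed

end

subsection \<open>Integration against the data distribution\<close>

definition data_map :: "(real \<times> (vec \<times> vec) \<times> (nat \<Rightarrow> nat)) \<times> vec \<Rightarrow> data_point" where
  "data_map = (\<lambda>((y, (v1, v2), \<pi>), \<xi>). ((\<lambda>p. unshuffled v1 v2 \<xi> (\<pi> p)), y))"

text \<open>The weak model sees a data point only through the label times the sum of its patches.\<close>

definition labelled_sum :: "data_point \<Rightarrow> vec" where
  "labelled_sum Z = (\<lambda>i. snd Z * (\<Sum>p\<in>{1, 2, 3}. fst Z p i))"

lemma f_wk_labelled_sum: "snd Z * f_wk d w (fst Z) = inner_d d w (labelled_sum Z)"
  by (simp add: f_wk_def labelled_sum_def)

text \<open>The shuffle only permutes the three summands, so it disappears from all later
  estimates.\<close>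

lemma labelled_sum_data_map:
  assumes "\<pi> permutes {1, 2, 3}"
  shows "labelled_sum (data_map ((y, v, \<pi>), \<xi>)) = (\<lambda>i. y * (fst v i + snd v i + \<xi> i))"
proof
  fix i
  have "(\<Sum>p\<in>{1, 2, 3}. unshuffled (fst v) (snd v) \<xi> (\<pi> p) i) = (\<Sum>p\<in>{1, 2, 3}. unshuffled (fst v) (snd v) \<xi> p i)"
    using sum.permute[OF assms, of "\<lambda>p. unshuffled (fst v) (snd v) \<xi> p i"] by (simp add: o_def)
  then show "labelled_sum (data_map ((y, v, \<pi>), \<xi>)) i = y * (fst v i + snd v i + \<xi> i)"
    by (cases v) (simp add: labelled_sum_def data_map_def unshuffled_def)
qed

lemma measurable_fst_pmf: "(\<lambda>x. f (fst x)) \<in> measurable (measure_pmf D \<Otimes>\<^sub>M N) (count_space UNIV)"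
  by (rule measurable_compose[OF measurable_fst]) simp

lemma measurable_fst_pmf_borel: "(\<lambda>x. f (fst x)) \<in> borel_measurable (measure_pmf D \<Otimes>\<^sub>M N)"
  by (rule measurable_compose[OF measurable_fst]) simp

text \<open>Every function of the discrete factor is measurable; in the noise, each coordinate is a
  case distinction on the value of the permutation.\<close>

lemma data_map_measurable [measurable]:
  assumes "sets N = sets borel"
  shows "data_map \<in> borel_measurable (measure_pmf D \<Otimes>\<^sub>M N)"
proof -
  have [measurable_cong]: "sets N = sets borel" by fact
  have [measurable]: "Measurable.pred (measure_pmf D \<Otimes>\<^sub>M N) (\<lambda>x. snd (snd (fst x)) p = (c :: nat))" for p c
    using measurable_fst_pmf[of "\<lambda>x. snd (snd x) p = c" D N] by (simp add: pred_def)
  have [measurable]: "(\<lambda>x. fst (fst (snd (fst x))) i) \<in> borel_measurable (measure_pmf D \<Otimes>\<^sub>M N)"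
     "(\<lambda>x. snd (fst (snd (fst x))) i) \<in> borel_measurable (measure_pmf D \<Otimes>\<^sub>M N)"
     "(\<lambda>x. fst (fst x)) \<in> borel_measurable (measure_pmf D \<Otimes>\<^sub>M N)" for i
    by (rule measurable_fst_pmf_borel)+
  have [measurable]: "(\<lambda>x. snd x i) \<in> borel_measurable (measure_pmf D \<Otimes>\<^sub>M N)" for i
    by (rule measurable_product_then_coordinatewise) measurable
  have coord [measurable]: "(\<lambda>x. fst (data_map x) p i) \<in> borel_measurable (measure_pmf D \<Otimes>\<^sub>M N)" for p i
  proof -
    have "(\<lambda>x. fst (data_map x) p i) = (\<lambda>x. if snd (snd (fst x)) p = 1 then fst (fst (snd (fst x))) i
      else if snd (snd (fst x)) p = 2 then snd (fst (snd (fst x))) i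
      else if snd (snd (fst x)) p = 3 then snd x i else 0)"
      by (auto simp: data_map_def unshuffled_def fun_eq_iff split: prod.splits)
    then show ?thesis by (simp only:) measurable
  qed
  have snd_eq: "(\<lambda>x. snd (data_map x)) = (\<lambda>x. fst (fst x))"
    by (auto simp: data_map_def fun_eq_iff split: prod.splits)
  have "(\<lambda>x. (fst (data_map x), snd (data_map x))) \<in> borel_measurable (measure_pmf D \<Otimes>\<^sub>M N)"
    by (intro borel_measurable_Pair measurable_coordinatewise_then_product coord) (simp add: snd_eq)
  then show ?thesis by simp
qed

text \<open>Continuity, beyond measurability, is wanted because supports are compared through closed
  sets, see \<open>closed_easy_score\<close>.\<close>

lemma labelled_sum_continuous: "continuous_on UNIV (\<lambda>Z. labelled_sum Z i)"
proof -
  have "continuous_on UNIV (\<lambda>Z :: data_point. fst Z p i)" for p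
    using continuous_on_fst[OF continuous_on_id] continuous_on_product_then_coordinatewise by metis
  then show ?thesis
    unfolding labelled_sum_def
    by (intro continuous_on_mult continuous_on_sum continuous_on_snd continuous_on_id)
qed

lemma labelled_sum_measurable [measurable]: "labelled_sum \<in> borel_measurable borel"
  by (intro measurable_coordinatewise_then_product borel_measurable_continuous_onI labelled_sum_continuous)

context weak_model
begin

lemma data_law_eq: "data_law Q K = distr (measure_pmf (discrete_pmf Q K) \<Otimes>\<^sub>M noise Q) borel data_map"
  by (simp add: data_law_def data_map_def)

lemma sets_data_law [simp, measurable_cong]: "sets (data_law Q K) = sets borel"
  and space_data_law [simp]: "space (data_law Q K) = UNIV"
  and sets_data_dist [simp, measurable_cong]: "sets (data_dist Q) = sets borel"
  and space_data_dist [simp]: "space (data_dist Q) = UNIV"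
  by (simp_all add: data_law_eq data_dist_def)

lemma pair_prob_noise: "pair_prob_space (measure_pmf D) (noise Q)"
  by (simp add: pair_prob_space_def pair_sigma_finite_def prob_space_noise prob_space_measure_pmf
      prob_space_imp_sigma_finite)

lemma prob_space_data_law: "prob_space (data_law Q K)"
proof -
  interpret pair_prob_space "measure_pmf (discrete_pmf Q K)" "noise Q" by (rule pair_prob_noise)
  show ?thesis unfolding data_law_eq by (intro prob_space_distr data_map_measurable) simp
qed

lemma prob_space_data_dist: "prob_space (data_dist Q)"
  unfolding data_dist_def by (rule prob_space_data_law)

lemma data_law_nn_integral:
  assumes [measurable]: "f \<in> borel_measurable borel"
  shows "(\<integral>\<^sup>+Z. f Z \<partial>data_law Q K) = (\<integral>\<^sup>+k. \<integral>\<^sup>+y. \<integral>\<^sup>+v. \<integral>\<^sup>+\<pi>. \<integral>\<^sup>+\<xi>. f (data_map ((y, v, \<pi>), \<xi>)) \<partial>noise Q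
     \<partial>pmf_of_set {\<pi>. \<pi> permutes {1, 2, 3 :: nat}} \<partial>signal_pmf Q y k \<partial>pmf_of_set {1, -1} \<partial>K)"
proof -
  interpret N: prob_space "noise Q" by (rule prob_space_noise)
  have [measurable]: "data_map \<in> borel_measurable (measure_pmf D \<Otimes>\<^sub>M noise Q)" for D
    by (rule data_map_measurable) simp
  have "(\<integral>\<^sup>+Z. f Z \<partial>data_law Q K)
     = (\<integral>\<^sup>+x. f (data_map x) \<partial>(measure_pmf (discrete_pmf Q K) \<Otimes>\<^sub>M noise Q))"
    unfolding data_law_eq by (intro nn_integral_distr) simp_all
  also have "\<dots> = (\<integral>\<^sup>+c. \<integral>\<^sup>+\<xi>. f (data_map (c, \<xi>)) \<partial>noise Q \<partial>measure_pmf (discrete_pmf Q K))"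
    by (rule N.nn_integral_fst[symmetric]) measurable
  finally show ?thesis by (simp add: discrete_pmf_def)
qed

lemma finite_permutes: "finite {\<pi>. \<pi> permutes {1, 2, 3 :: nat}}" "{\<pi>. \<pi> permutes {1, 2, 3 :: nat}} \<noteq> {}"
  using finite_permutations[of "{1, 2, 3 :: nat}"] permutes_id[of "{1, 2, 3 :: nat}"] by blast+

text \<open>The bound is uniform in the signs and places of the signals and in the shuffle, but
  keeps kind and label, because the signal statistics respond to one label only.\<close>

lemma data_law_nn_integral_le:
  assumes [measurable]: "f \<in> borel_measurable borel"
    and le: "\<And>k y v \<pi>. k \<in> set_pmf K \<Longrightarrow> y \<in> {1, -1} \<Longrightarrow> v \<in> set_pmf (signal_pmf Q y k) \<Longrightarrow>
      \<pi> permutes {1, 2, 3} \<Longrightarrow> (\<integral>\<^sup>+\<xi>. f (data_map ((y, v, \<pi>), \<xi>)) \<partial>noise Q) \<le> B k y"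
  shows "(\<integral>\<^sup>+Z. f Z \<partial>data_law Q K) \<le> (\<integral>\<^sup>+k. (B k 1 + B k (-1)) / 2 \<partial>K)"
proof -
  have const: "(\<integral>\<^sup>+x. g x \<partial>measure_pmf p) \<le> c" if "\<And>x. x \<in> set_pmf p \<Longrightarrow> g x \<le> c" for g :: "'b \<Rightarrow> ennreal" and p c
  proof -
    have "(\<integral>\<^sup>+x. g x \<partial>measure_pmf p) \<le> (\<integral>\<^sup>+x. c \<partial>measure_pmf p)"
      using that by (intro nn_integral_mono_AE) (simp add: AE_measure_pmf_iff)
    then show ?thesis by simp
  qed
  have "(\<integral>\<^sup>+Z. f Z \<partial>data_law Q K) \<le> (\<integral>\<^sup>+k. \<integral>\<^sup>+y. B k y \<partial>pmf_of_set {1, -1} \<partial>K)"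
    unfolding data_law_nn_integral[OF assms(1)]
  proof (intro nn_integral_mono_AE, unfold AE_measure_pmf_iff, intro ballI)
    fix k assume k: "k \<in> set_pmf K"
    show "(\<integral>\<^sup>+y. \<integral>\<^sup>+v. \<integral>\<^sup>+\<pi>. \<integral>\<^sup>+\<xi>. f (data_map ((y, v, \<pi>), \<xi>)) \<partial>noise Q
       \<partial>pmf_of_set {\<pi>. \<pi> permutes {1, 2, 3 :: nat}} \<partial>signal_pmf Q y k \<partial>pmf_of_set {1, -1})
      \<le> (\<integral>\<^sup>+y. B k y \<partial>pmf_of_set {1, -1})"
    proof (intro nn_integral_mono_AE, unfold AE_measure_pmf_iff, intro ballI)
      fix y :: real assume "y \<in> set_pmf (pmf_of_set {1, -1})"
      then have y: "y \<in> {1, -1}" by (subst (asm) set_pmf_of_set) auto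
      show "(\<integral>\<^sup>+v. \<integral>\<^sup>+\<pi>. \<integral>\<^sup>+\<xi>. f (data_map ((y, v, \<pi>), \<xi>)) \<partial>noise Q
       \<partial>pmf_of_set {\<pi>. \<pi> permutes {1, 2, 3 :: nat}} \<partial>signal_pmf Q y k) \<le> B k y"
        using k y set_pmf_of_set[OF finite_permutes(2,1)] by (intro const le) blast+
    qed
  qed
  also have "\<dots> = (\<integral>\<^sup>+k. (B k 1 + B k (-1)) / 2 \<partial>K)"
    by (intro nn_integral_cong) (subst nn_integral_pmf_of_set, auto simp: add.commute)
  finally show ?thesis .
qed

lemma kind_UNIV: "(UNIV :: kind set) = {Easy, Hard, Both}"
  using kind.exhaust by auto

lemma kind_pmf_nn_integral:
  "(\<integral>\<^sup>+k. g k \<partial>kind_pmf Q)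
    = ennreal (p_e Q) * g Easy + ennreal (p_h Q) * g Hard + ennreal (p_b Q) * g Both"
proof -
  have p: "p_e Q > 0" "p_h Q > 0" "p_b Q > 0" "p_e Q + p_h Q + p_b Q = 1"
    using params_ok by (auto simp: params_ok_def)
  have "pmf (kind_pmf Q) k = (case k of Easy \<Rightarrow> p_e Q | Hard \<Rightarrow> p_h Q | Both \<Rightarrow> p_b Q)" for k
    unfolding kind_pmf_def
  proof (rule pmf_embed_pmf)
    show "(\<integral>\<^sup>+k. ennreal (case k of Easy \<Rightarrow> p_e Q | Hard \<Rightarrow> p_h Q | Both \<Rightarrow> p_b Q) \<partial>count_space UNIV) = 1"
      using p by (subst nn_integral_count_space_finite)
        (auto simp: kind_UNIV ennreal_plus[symmetric] add.assoc simp del: ennreal_plus)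
  qed (use p in \<open>auto split: kind.split\<close>)
  then show ?thesis
    by (subst nn_integral_measure_pmf, subst nn_integral_count_space_finite)
      (simp_all add: kind_UNIV add_ac)
qed

lemma data_dist_nn_integral:
  assumes "f \<in> borel_measurable borel"
  shows "(\<integral>\<^sup>+Z. f Z \<partial>data_dist Q) = ennreal (p_e Q) * (\<integral>\<^sup>+Z. f Z \<partial>data_law Q (return_pmf Easy))
    + ennreal (p_h Q) * (\<integral>\<^sup>+Z. f Z \<partial>data_law Q (return_pmf Hard))
    + ennreal (p_b Q) * (\<integral>\<^sup>+Z. f Z \<partial>data_law Q (return_pmf Both))"
  unfolding data_dist_def data_law_nn_integral[OF assms] by (simp add: kind_pmf_nn_integral)

lemma AE_noise_orthogonal: "AE \<xi> in noise Q. \<forall>s\<in>{1, -1}. inn (mu Q s) \<xi> = 0 \<and> inn (nu Q s) \<xi> = 0"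
proof -
  have "AE z in gauss (dimn Q). \<forall>s\<in>{1, -1}. inn (mu Q s) (noise_map z) = 0 \<and> inn (nu Q s) (noise_map z) = 0"
    using noise_map_orthogonal by blast
  then show ?thesis unfolding noise_eq by (subst AE_distr_iff) simp_all
qed

text \<open>Noise is orthogonal to the signals off a null set, so the property need only be checked
  for exactly orthogonal noise, uniformly in the discrete part.\<close>

lemma AE_data_law:
  assumes "{Z. P Z} \<in> sets borel"
    and P: "\<And>k y v \<pi> \<xi>. k \<in> set_pmf K \<Longrightarrow> y \<in> {1, -1} \<Longrightarrow> v \<in> set_pmf (signal_pmf Q y k) \<Longrightarrow>
      \<pi> permutes {1, 2, 3} \<Longrightarrow> (\<And>s. s \<in> {1, -1} \<Longrightarrow> inn (mu Q s) \<xi> = 0 \<and> inn (nu Q s) \<xi> = 0) \<Longrightarrow>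
      P (data_map ((y, v, \<pi>), \<xi>))"
  shows "AE Z in data_law Q K. P Z"
proof (rule AE_I')
  show "{Z. \<not> P Z} \<in> null_sets (data_law Q K)"
  proof (rule null_setsI)
    have m [measurable]: "Measurable.pred borel P" using assms(1) by (simp add: pred_def)
    have "emeasure (data_law Q K) {Z. \<not> P Z} = (\<integral>\<^sup>+Z. indicator {Z. \<not> P Z} Z \<partial>data_law Q K)"
      by (subst nn_integral_indicator) simp_all
    also have "\<dots> \<le> (\<integral>\<^sup>+k. (0 + 0) / 2 \<partial>K)"
    proof (rule data_law_nn_integral_le)
      fix k y v and \<pi> :: "nat \<Rightarrow> nat"
      assume *: "k \<in> set_pmf K" "y \<in> {1, -1}" "v \<in> set_pmf (signal_pmf Q y k)" "\<pi> permutes {1, 2, 3}"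
      have "AE \<xi> in noise Q. indicator {Z. \<not> P Z} (data_map ((y, v, \<pi>), \<xi>)) = (0 :: ennreal)"
        using AE_noise_orthogonal
      proof eventually_elim
        case (elim \<xi>)
        then have "P (data_map ((y, v, \<pi>), \<xi>))" by (intro P[OF *]) blast
        then show ?case by simp
      qed
      then show "(\<integral>\<^sup>+\<xi>. indicator {Z. \<not> P Z} (data_map ((y, v, \<pi>), \<xi>)) \<partial>noise Q) \<le> 0"
        by (simp add: nn_integral_cong_AE)
    qed measurable
    finally show "emeasure (data_law Q K) {Z. \<not> P Z} = 0" by simp
    show "{Z. \<not> P Z} \<in> sets (data_law Q K)" by simp
  qed
qed simp

end

text \<open>For x = -t < 0 it follows from (1 + t) (1 - t + t^2) = 1 + t^3 >= 1 and 1 + t <= exp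
  t.\<close>

lemma exp_le_quadratic:
  fixes x :: real
  assumes "\<bar>x\<bar> \<le> 1"
  shows "exp x \<le> 1 + x + x\<^sup>2"
proof (cases "0 \<le> x")
  case True
  then show ?thesis using assms by (intro exp_bound) auto
next
  case False
  define t where "t = - x"
  have t: "0 < t" using False by (simp add: t_def)
  have "(1 + t) * (1 - t + t\<^sup>2) = 1 + t ^ 3"
    by (simp add: power2_eq_square power3_eq_cube algebra_simps)
  then have "1 \<le> (1 + t) * (1 - t + t\<^sup>2)" using t by simp
  also have "\<dots> \<le> exp t * (1 - t + t\<^sup>2)"
  proof (rule mult_right_mono)
    have "0 \<le> (1 - t)\<^sup>2 + t" using t by simp
    then show "0 \<le> 1 - t + t\<^sup>2" by (simp add: power2_eq_square algebra_simps)
  qed simp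
  finally have "exp (- t) * 1 \<le> exp (- t) * (exp t * (1 - t + t\<^sup>2))"
    by (intro mult_left_mono) auto
  then show ?thesis by (simp add: t_def mult.assoc[symmetric] exp_add[symmetric])
qed

section \<open>Signal coordinates of a sample and exponential moments of the sample
  statistics\<close>

context weak_model
begin

abbreviation "qe \<equiv> 2 * p_e Q + p_b Q"

lemma p_pos: "0 < p_e Q" "0 < p_h Q" "0 < p_b Q" "p_e Q + p_h Q + p_b Q = 1"
  using params_ok by (auto simp: params_ok_def)

lemma signal_pmf_cases:
  assumes "v \<in> set_pmf (signal_pmf Q y k)"
  obtains (Easy) "k = Easy" "fst v = mu Q y" "snd v = mu Q y"
    | (Hard) "k = Hard" "fst v = nu Q y \<or> fst v = - nu Q y" "snd v = nu Q y \<or> snd v = - nu Q y"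
    | (Both_left) "k = Both" "fst v = mu Q y" "snd v = nu Q y \<or> snd v = - nu Q y"
    | (Both_right) "k = Both" "fst v = nu Q y \<or> fst v = - nu Q y" "snd v = mu Q y"
  using assms by (cases k) (auto simp: set_pmf_of_set)

text \<open>The factor s cancels the label when s = y, so the first quantity counts the patches
  equal to the easy signal of label s. The second is only bounded, since the two signs of the hard
  signal may cancel.\<close>

lemma signal_pmf_coords:
  assumes "v \<in> set_pmf (signal_pmf Q y k)" "y \<in> {1, -1}" "s \<in> {1, -1}"
  shows "s * (y * (al s (fst v) + al s (snd v)))
      = (if s = y then case k of Easy \<Rightarrow> 2 | Hard \<Rightarrow> 0 | Both \<Rightarrow> 1 else 0)"
    and "\<bar>y * (be s (fst v) + be s (snd v))\<bar>
      \<le> (if s = y then case k of Easy \<Rightarrow> 0 | Hard \<Rightarrow> 2 | Both \<Rightarrow> 1 else 0)"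
proof -
  note c = al_be_mu_nu[OF assms(3,2)] al_be_mu_nu[OF assms(2,2)]
  have y: "y * (y * x) = x" "y * y = 1" "\<bar>y\<bar> = 1" for x using assms(2) by auto
  show "s * (y * (al s (fst v) + al s (snd v)))
      = (if s = y then case k of Easy \<Rightarrow> 2 | Hard \<Rightarrow> 0 | Both \<Rightarrow> 1 else 0)"
    using assms(1) by (cases rule: signal_pmf_cases) (auto simp: c y)
  show "\<bar>y * (be s (fst v) + be s (snd v))\<bar>
      \<le> (if s = y then case k of Easy \<Rightarrow> 0 | Hard \<Rightarrow> 2 | Both \<Rightarrow> 1 else 0)"
    using assms(1) by (cases rule: signal_pmf_cases) (auto simp: c y abs_mult)
qed

lemma al_data_map:
  assumes "v \<in> set_pmf (signal_pmf Q y k)" "y \<in> {1, -1}" "\<pi> permutes {1, 2, 3}" "s \<in> {1, -1}"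
    and "\<And>s. s \<in> {1, -1} \<Longrightarrow> inn (mu Q s) \<xi> = 0 \<and> inn (nu Q s) \<xi> = 0"
  shows "s * al s (labelled_sum (data_map ((y, v, \<pi>), \<xi>)))
      = (if s = y then case k of Easy \<Rightarrow> 2 | Hard \<Rightarrow> 0 | Both \<Rightarrow> 1 else 0)"
    and "\<bar>be s (labelled_sum (data_map ((y, v, \<pi>), \<xi>)))\<bar>
      \<le> (if s = y then case k of Easy \<Rightarrow> 0 | Hard \<Rightarrow> 2 | Both \<Rightarrow> 1 else 0)"
proof -
  have "al s \<xi> = 0" "be s \<xi> = 0" using assms(4,5) by (simp_all add: al_def be_def)
  then have eq: "al s (labelled_sum (data_map ((y, v, \<pi>), \<xi>))) = y * (al s (fst v) + al s (snd v))"
    "be s (labelled_sum (data_map ((y, v, \<pi>), \<xi>))) = y * (be s (fst v) + be s (snd v))"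
    by (simp_all add: labelled_sum_data_map[OF assms(3)])
  show "s * al s (labelled_sum (data_map ((y, v, \<pi>), \<xi>)))
      = (if s = y then case k of Easy \<Rightarrow> 2 | Hard \<Rightarrow> 0 | Both \<Rightarrow> 1 else 0)"
    "\<bar>be s (labelled_sum (data_map ((y, v, \<pi>), \<xi>)))\<bar>
      \<le> (if s = y then case k of Easy \<Rightarrow> 0 | Hard \<Rightarrow> 2 | Both \<Rightarrow> 1 else 0)"
    unfolding eq by (rule signal_pmf_coords[OF assms(1,2,4)])+
qed

lemma proj_signal:
  assumes "v \<in> set_pmf (signal_pmf Q y k)" "y \<in> {1, -1}"
  shows "proj (fst v) = (\<lambda>_. 0)" "proj (snd v) = (\<lambda>_. 0)"
proof -
  have z: "proj (mu Q y) = (\<lambda>_. 0)" "proj (nu Q y) = (\<lambda>_. 0)" "proj (- nu Q y) = (\<lambda>_. 0)"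
    using assms(2) by (auto simp: proj_def al_be_mu_nu)
  show "proj (fst v) = (\<lambda>_. 0)" "proj (snd v) = (\<lambda>_. 0)"
    using assms(1) by (cases rule: signal_pmf_cases; auto simp: z)+
qed

lemma proj_data_map:
  assumes "v \<in> set_pmf (signal_pmf Q y k)" "y \<in> {1, -1}" "\<pi> permutes {1, 2, 3}"
    and "\<And>s. s \<in> {1, -1} \<Longrightarrow> inn (mu Q s) \<xi> = 0 \<and> inn (nu Q s) \<xi> = 0"
  shows "proj (labelled_sum (data_map ((y, v, \<pi>), \<xi>))) = (\<lambda>i. y * \<xi> i)"
proof -
  have "proj (labelled_sum (data_map ((y, v, \<pi>), \<xi>)))
      = (\<lambda>i. y * (proj (fst v) i + proj (snd v) i + proj \<xi> i))"
    unfolding labelled_sum_data_map[OF assms(3)]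
    by (simp add: proj_def algebra_simps)
  then show ?thesis
    using proj_signal[OF assms(1,2)] proj_eq_self[OF assms(4)] by simp
qed

lemma al_measurable [measurable]: "al s \<in> borel_measurable borel"
  and be_measurable [measurable]: "be s \<in> borel_measurable borel"
  unfolding al_def be_def by measurable

lemma proj_measurable [measurable]: "proj \<in> borel_measurable borel"
  unfolding proj_def by (intro measurable_coordinatewise_then_product) measurable

lemma AE_coords:
  "AE Z in data_law Q K. \<forall>s\<in>{1, -1}. 0 \<le> s * al s (labelled_sum Z) \<and> s * al s (labelled_sum Z) \<le> 2
     \<and> \<bar>be s (labelled_sum Z)\<bar> \<le> 2"
proof (rule AE_data_law)
  fix k y v and \<pi> :: "nat \<Rightarrow> nat" and \<xi>
  assume *: "y \<in> {1, -1}" "v \<in> set_pmf (signal_pmf Q y k)" "\<pi> permutes {1, 2, 3}"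
    "\<And>s. s \<in> {1, -1} \<Longrightarrow> inn (mu Q s) \<xi> = 0 \<and> inn (nu Q s) \<xi> = 0"
  show "\<forall>s\<in>{1, -1}. 0 \<le> s * al s (labelled_sum (data_map ((y, v, \<pi>), \<xi>)))
     \<and> s * al s (labelled_sum (data_map ((y, v, \<pi>), \<xi>))) \<le> 2
     \<and> \<bar>be s (labelled_sum (data_map ((y, v, \<pi>), \<xi>)))\<bar> \<le> 2"
  proof
    fix s :: real assume "s \<in> {1, -1}"
    note al_data_map(1)[OF *(2,1,3) this *(4)] al_data_map(2)[OF *(2,1,3) this *(4)]
    then show "0 \<le> s * al s (labelled_sum (data_map ((y, v, \<pi>), \<xi>)))
     \<and> s * al s (labelled_sum (data_map ((y, v, \<pi>), \<xi>))) \<le> 2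
     \<and> \<bar>be s (labelled_sum (data_map ((y, v, \<pi>), \<xi>)))\<bar> \<le> 2"
      by (cases k) (auto split: if_splits)
  qed
qed measurable

text \<open>Only one of the two equally likely labels contributes, hence the factor 2 in the hypothesis.\<close>

lemma kind_statistic_mgf:
  fixes h :: "data_point \<Rightarrow> real" and c :: "kind \<Rightarrow> real"
  assumes [measurable]: "h \<in> borel_measurable borel"
    and h: "\<And>k y v \<pi> \<xi>. y \<in> {1, -1} \<Longrightarrow> v \<in> set_pmf (signal_pmf Q y k) \<Longrightarrow> \<pi> permutes {1, 2, 3} \<Longrightarrow>
      (\<And>s. s \<in> {1, -1} \<Longrightarrow> inn (mu Q s) \<xi> = 0 \<and> inn (nu Q s) \<xi> = 0) \<Longrightarrow>
      h (data_map ((y, v, \<pi>), \<xi>)) \<le> (if s = y then c k else 0)"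
    and s: "s \<in> {1, -1}" and c: "\<And>k. \<bar>c k\<bar> \<le> 1"
    and E: "p_e Q * (c Easy + (c Easy)\<^sup>2) + p_h Q * (c Hard + (c Hard)\<^sup>2) + p_b Q * (c Both + (c Both)\<^sup>2) \<le> 2 * B"
  shows "(\<integral>\<^sup>+Z. ennreal (exp (h Z)) \<partial>data_dist Q) \<le> ennreal (exp B)"
proof -
  interpret N: prob_space "noise Q" by (rule prob_space_noise)
  let ?B = "\<lambda>k y. ennreal (exp (if s = y then c k else 0))"
  have half: "(?B k 1 + ?B k (-1)) / 2 = ennreal ((1 + exp (c k)) / 2)" for k
    using s by (auto simp: ennreal_plus[symmetric] ennreal_numeral[symmetric] divide_ennreal
        simp del: ennreal_plus ennreal_numeral)
  have le: "(1 + exp (c k)) / 2 \<le> 1 + (c k + (c k)\<^sup>2) / 2" for k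
    using exp_le_quadratic[OF c[of k]] by (simp add: field_simps)
  have "(\<integral>\<^sup>+Z. ennreal (exp (h Z)) \<partial>data_dist Q) \<le> (\<integral>\<^sup>+k. (?B k 1 + ?B k (-1)) / 2 \<partial>kind_pmf Q)"
    unfolding data_dist_def
  proof (rule data_law_nn_integral_le)
    fix k y v and \<pi> :: "nat \<Rightarrow> nat"
    assume *: "y \<in> {1, -1}" "v \<in> set_pmf (signal_pmf Q y k)" "\<pi> permutes {1, 2, 3}"
    have "(\<integral>\<^sup>+\<xi>. ennreal (exp (h (data_map ((y, v, \<pi>), \<xi>)))) \<partial>noise Q) \<le> (\<integral>\<^sup>+\<xi>. ?B k y \<partial>noise Q)"
    proof (rule nn_integral_mono_AE)
      show "AE \<xi> in noise Q. ennreal (exp (h (data_map ((y, v, \<pi>), \<xi>)))) \<le> ?B k y"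
        using AE_noise_orthogonal
      proof eventually_elim
        case (elim \<xi>)
        then have "h (data_map ((y, v, \<pi>), \<xi>)) \<le> (if s = y then c k else 0)" by (intro h[OF *]) blast
        then show ?case by (intro ennreal_leI) simp
      qed
    qed
    then show "(\<integral>\<^sup>+\<xi>. ennreal (exp (h (data_map ((y, v, \<pi>), \<xi>)))) \<partial>noise Q) \<le> ?B k y"
      using N.emeasure_space_1 by simp
  qed measurable
  also have "\<dots> = ennreal (p_e Q * ((1 + exp (c Easy)) / 2) + p_h Q * ((1 + exp (c Hard)) / 2)
      + p_b Q * ((1 + exp (c Both)) / 2))"
    unfolding half kind_pmf_nn_integral using p_pos
    by (simp add: ennreal_mult[symmetric] ennreal_plus[symmetric] add_nonneg_nonneg del: ennreal_plus)
  also have "\<dots> \<le> ennreal (exp B)"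
  proof (rule ennreal_leI)
    have "p_e Q * ((1 + exp (c Easy)) / 2) + p_h Q * ((1 + exp (c Hard)) / 2) + p_b Q * ((1 + exp (c Both)) / 2)
      \<le> p_e Q * (1 + (c Easy + (c Easy)\<^sup>2) / 2) + p_h Q * (1 + (c Hard + (c Hard)\<^sup>2) / 2)
        + p_b Q * (1 + (c Both + (c Both)\<^sup>2) / 2)"
      using p_pos by (intro add_mono mult_left_mono le) auto
    also have "\<dots> = (p_e Q + p_h Q + p_b Q) + (p_e Q * (c Easy + (c Easy)\<^sup>2) + p_h Q * (c Hard + (c Hard)\<^sup>2) + p_b Q * (c Both + (c Both)\<^sup>2)) / 2"
      by (simp add: field_simps)
    also have "\<dots> \<le> 1 + B" using E p_pos(4) by simp
    also have "\<dots> \<le> exp B" by (rule exp_ge_add_one_self)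
    finally show "p_e Q * ((1 + exp (c Easy)) / 2) + p_h Q * ((1 + exp (c Hard)) / 2)
      + p_b Q * ((1 + exp (c Both)) / 2) \<le> exp B" .
  qed
  finally show ?thesis .
qed

text \<open>The exponent is l times the mean qe / 2 plus l^2 times a bound for the second moment (4
  p_e + p_b) / 2 <= qe. The statistic is at most 2, so |l| <= 1/2 stays in the range of
  \<open>exp_le_quadratic\<close>.\<close>

lemma al_mgf:
  assumes "s \<in> {1, -1}" "\<bar>l\<bar> \<le> 1 / 2"
  shows "(\<integral>\<^sup>+Z. ennreal (exp (l * (s * al s (labelled_sum Z)))) \<partial>data_dist Q) \<le> ennreal (exp (l * qe / 2 + l\<^sup>2 * qe))"
proof (rule kind_statistic_mgf[where c = "\<lambda>k. l * (case k of Easy \<Rightarrow> 2 | Hard \<Rightarrow> 0 | Both \<Rightarrow> 1)"])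
  show "l * (s * al s (labelled_sum (data_map ((y, v, \<pi>), \<xi>))))
    \<le> (if s = y then l * (case k of Easy \<Rightarrow> 2 | Hard \<Rightarrow> 0 | Both \<Rightarrow> 1) else 0)"
    if "y \<in> {1, -1}" "v \<in> set_pmf (signal_pmf Q y k)" "\<pi> permutes {1, 2, 3}"
      "\<And>s. s \<in> {1, -1} \<Longrightarrow> inn (mu Q s) \<xi> = 0 \<and> inn (nu Q s) \<xi> = 0" for k y v \<pi> \<xi>
    using al_data_map(1)[OF that(2,1,3) assms(1) that(4)] by simp
  show "\<bar>l * (case k of Easy \<Rightarrow> 2 | Hard \<Rightarrow> 0 | Both \<Rightarrow> 1)\<bar> \<le> 1" for k
    using assms(2) by (cases k) auto
  show "p_e Q * (l * (case Easy of Easy \<Rightarrow> 2 | Hard \<Rightarrow> 0 | Both \<Rightarrow> 1) + (l * (case Easy of Easy \<Rightarrow> 2 | Hard \<Rightarrow> 0 | Both \<Rightarrow> 1))\<^sup>2)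
    + p_h Q * (l * (case Hard of Easy \<Rightarrow> 2 | Hard \<Rightarrow> 0 | Both \<Rightarrow> 1) + (l * (case Hard of Easy \<Rightarrow> 2 | Hard \<Rightarrow> 0 | Both \<Rightarrow> 1))\<^sup>2)
    + p_b Q * (l * (case Both of Easy \<Rightarrow> 2 | Hard \<Rightarrow> 0 | Both \<Rightarrow> 1) + (l * (case Both of Easy \<Rightarrow> 2 | Hard \<Rightarrow> 0 | Both \<Rightarrow> 1))\<^sup>2)
    \<le> 2 * (l * qe / 2 + l\<^sup>2 * qe)"
    using mult_nonneg_nonneg[OF zero_le_power2 less_imp_le[OF p_pos(3)], of l]
    by (simp add: power2_eq_square field_simps)
qed (use assms(1) in \<open>simp_all\<close>)

text \<open>Hard data may carry the hard signal twice; p_h <= p_b / 8 lets the term of the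
  both-signal data absorb this.\<close>

lemma be_mgf:
  assumes "s \<in> {1, -1}" "0 \<le> l" "l \<le> 1 / 2" "8 * p_h Q \<le> p_b Q"
  shows "(\<integral>\<^sup>+Z. ennreal (exp (l * \<bar>be s (labelled_sum Z)\<bar>)) \<partial>data_dist Q) \<le> ennreal (exp ((l + l\<^sup>2) * p_b Q))"
proof (rule kind_statistic_mgf[where c = "\<lambda>k. l * (case k of Easy \<Rightarrow> 0 | Hard \<Rightarrow> 2 | Both \<Rightarrow> 1)"])
  show "l * \<bar>be s (labelled_sum (data_map ((y, v, \<pi>), \<xi>)))\<bar>
    \<le> (if s = y then l * (case k of Easy \<Rightarrow> 0 | Hard \<Rightarrow> 2 | Both \<Rightarrow> 1) else 0)"
    if "y \<in> {1, -1}" "v \<in> set_pmf (signal_pmf Q y k)" "\<pi> permutes {1, 2, 3}"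
      "\<And>s. s \<in> {1, -1} \<Longrightarrow> inn (mu Q s) \<xi> = 0 \<and> inn (nu Q s) \<xi> = 0" for k y v \<pi> \<xi>
    using mult_left_mono[OF al_data_map(2)[OF that(2,1,3) assms(1) that(4)] assms(2)]
    by (simp split: if_splits)
  show "\<bar>l * (case k of Easy \<Rightarrow> 0 | Hard \<Rightarrow> 2 | Both \<Rightarrow> 1)\<bar> \<le> 1" for k
    using assms(2,3) by (cases k) auto
  have "l * p_h Q * 8 \<le> l * p_b Q" "l\<^sup>2 * p_h Q * 8 \<le> l\<^sup>2 * p_b Q"
    using assms by (simp_all add: mult.assoc mult_left_mono)
  moreover have "0 \<le> l * p_b Q" "0 \<le> l\<^sup>2 * p_b Q" using assms p_pos by simp_all
  ultimately show "p_e Q * (l * (case Easy of Easy \<Rightarrow> 0 | Hard \<Rightarrow> 2 | Both \<Rightarrow> 1) + (l * (case Easy of Easy \<Rightarrow> 0 | Hard \<Rightarrow> 2 | Both \<Rightarrow> 1))\<^sup>2)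
    + p_h Q * (l * (case Hard of Easy \<Rightarrow> 0 | Hard \<Rightarrow> 2 | Both \<Rightarrow> 1) + (l * (case Hard of Easy \<Rightarrow> 0 | Hard \<Rightarrow> 2 | Both \<Rightarrow> 1))\<^sup>2)
    + p_b Q * (l * (case Both of Easy \<Rightarrow> 0 | Hard \<Rightarrow> 2 | Both \<Rightarrow> 1) + (l * (case Both of Easy \<Rightarrow> 0 | Hard \<Rightarrow> 2 | Both \<Rightarrow> 1))\<^sup>2)
    \<le> 2 * ((l + l\<^sup>2) * p_b Q)"
    by (simp add: power_mult_distrib algebra_simps)
qed (use assms(1) in \<open>simp_all\<close>)

text \<open>\<open>proj\<close> removes the signals and leaves the noise up to the sign of the
  label. Asking for the bound with either sign spares a proof that the noise law is
  symmetric.\<close>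

lemma data_law_noise_bound:
  assumes [measurable]: "f \<in> borel_measurable borel"
    and le: "\<And>y. y \<in> {1, -1} \<Longrightarrow> (\<integral>\<^sup>+\<xi>. f (\<lambda>i. y * \<xi> i) \<partial>noise Q) \<le> B"
  shows "(\<integral>\<^sup>+Z. f (proj (labelled_sum Z)) \<partial>data_dist Q) \<le> B"
proof -
  have "(\<integral>\<^sup>+Z. f (proj (labelled_sum Z)) \<partial>data_dist Q) \<le> (\<integral>\<^sup>+k. (B + B) / 2 \<partial>kind_pmf Q)"
    unfolding data_dist_def
  proof (rule data_law_nn_integral_le)
    fix k y v and \<pi> :: "nat \<Rightarrow> nat"
    assume *: "y \<in> {1, -1}" "v \<in> set_pmf (signal_pmf Q y k)" "\<pi> permutes {1, 2, 3}"
    have "(\<integral>\<^sup>+\<xi>. f (proj (labelled_sum (data_map ((y, v, \<pi>), \<xi>)))) \<partial>noise Q)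
      = (\<integral>\<^sup>+\<xi>. f (\<lambda>i. y * \<xi> i) \<partial>noise Q)"
    proof (rule nn_integral_cong_AE)
      show "AE \<xi> in noise Q. f (proj (labelled_sum (data_map ((y, v, \<pi>), \<xi>)))) = f (\<lambda>i. y * \<xi> i)"
        using AE_noise_orthogonal
      proof eventually_elim
        case (elim \<xi>)
        then show ?case by (subst proj_data_map[OF *(2,1,3)]) blast+
      qed
    qed
    then show "(\<integral>\<^sup>+\<xi>. f (proj (labelled_sum (data_map ((y, v, \<pi>), \<xi>)))) \<partial>noise Q) \<le> B"
      using le[OF *(1)] by simp
  qed measurable
  also have "\<dots> = B"
    by (simp add: ennreal_divide_times mult_2[symmetric] mult.commute[of 2] ennreal_mult_divide_eq)
  finally show ?thesis .
qed

lemma inner_sign: "y \<in> {1, -1} \<Longrightarrow> inn (\<lambda>i. y * \<xi> i) (\<lambda>i. y * \<xi> i) = inn \<xi> \<xi>"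
  by auto

lemma sample_norm_tail:
  assumes u: "0 \<le> u" "2 * u \<le> real (dimn Q)" and d: "0 < dimn Q"
  shows "emeasure (data_dist Q) {Z. \<bar>inn (proj (labelled_sum Z)) (proj (labelled_sum Z)) - \<sigma>\<^sup>2 * real (dimn Q)\<bar> > \<sigma>\<^sup>2 * (2 * u)}
    \<le> ennreal (2 * exp (- u\<^sup>2 / (16 * real (dimn Q))) + 2 * exp (- u / 16))"
proof -
  define A where "A = {\<xi>. \<bar>inn \<xi> \<xi> - \<sigma>\<^sup>2 * real (dimn Q)\<bar> > \<sigma>\<^sup>2 * (2 * u)}"
  have A [measurable]: "A \<in> sets borel" unfolding A_def by measurable
  have "emeasure (data_dist Q) {Z. proj (labelled_sum Z) \<in> A}
      = (\<integral>\<^sup>+Z. indicator {Z. proj (labelled_sum Z) \<in> A} Z \<partial>data_dist Q)"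
    by (subst nn_integral_indicator) simp_all
  also have "\<dots> = (\<integral>\<^sup>+Z. indicator A (proj (labelled_sum Z)) \<partial>data_dist Q)"
    by (intro nn_integral_cong) (simp add: indicator_def)
  also have "\<dots> \<le> emeasure (noise Q) A"
  proof (rule data_law_noise_bound)
    fix y :: real assume y: "y \<in> {1, -1}"
    have "(\<integral>\<^sup>+\<xi>. indicator A (\<lambda>i. y * \<xi> i) \<partial>noise Q) = (\<integral>\<^sup>+\<xi>. indicator A \<xi> \<partial>noise Q)"
      using inner_sign[OF y] by (intro nn_integral_cong) (simp only: A_def indicator_def mem_Collect_eq)
    then show "(\<integral>\<^sup>+\<xi>. indicator A (\<lambda>i. y * \<xi> i) \<partial>noise Q) \<le> emeasure (noise Q) A"
      by (simp add: nn_integral_indicator)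
  qed measurable
  also have "\<dots> \<le> ennreal (2 * exp (- u\<^sup>2 / (16 * real (dimn Q))) + 2 * exp (- u / 16))"
    unfolding A_def by (rule noise_norm_tail[OF assms])
  finally show ?thesis by (simp add: A_def)
qed

text \<open>Given the first sample, the inner product is Gaussian with variance at most sigma^2
  times a squared norm. The inner integral is thus the exponential of a squared norm, to which
  \<open>noise_norm_mgf\<close> applies with s = l^2 sigma^2 / 2; the hypothesis is its condition s
  sigma^2 <= 1/4.\<close>

lemma cross_mgf:
  assumes "l\<^sup>2 * \<sigma>^4 \<le> 1 / 2"
  shows "(\<integral>\<^sup>+Z. \<integral>\<^sup>+Z'. ennreal (exp (l * inn (proj (labelled_sum Z)) (proj (labelled_sum Z')))) \<partial>data_dist Q \<partial>data_dist Q)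
    \<le> ennreal (exp (real (dimn Q) * l\<^sup>2 * \<sigma>^4))"
proof -
  have inner: "(\<integral>\<^sup>+Z'. ennreal (exp (l * inn u (proj (labelled_sum Z')))) \<partial>data_dist Q)
      \<le> ennreal (exp (l\<^sup>2 * \<sigma>\<^sup>2 / 2 * inn u u))" for u
  proof (rule data_law_noise_bound[where f = "\<lambda>x. ennreal (exp (l * inn u x))"])
    fix y :: real assume y: "y \<in> {1, -1}"
    have "(\<integral>\<^sup>+\<xi>. ennreal (exp (l * inn u (\<lambda>i. y * \<xi> i))) \<partial>noise Q)
        = (\<integral>\<^sup>+\<xi>. ennreal (exp (inn (\<lambda>i. (l * y) * u i) \<xi>)) \<partial>noise Q)"
      by (intro nn_integral_cong) (simp only: inner_d_linear mult.assoc)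
    also have "\<dots> = ennreal (exp (\<sigma>\<^sup>2 * inn (proj (\<lambda>i. (l * y) * u i)) (proj (\<lambda>i. (l * y) * u i)) / 2))"
      by (rule noise_mgf)
    also have "\<dots> \<le> ennreal (exp (l\<^sup>2 * \<sigma>\<^sup>2 / 2 * inn u u))"
    proof (intro ennreal_leI, subst exp_le_cancel_iff)
      have "inn (\<lambda>i. (l * y) * u i) (\<lambda>i. (l * y) * u i) = l\<^sup>2 * inn u u"
        using y by (auto simp: power2_eq_square simp flip: mult.assoc)
      then have "inn (proj (\<lambda>i. (l * y) * u i)) (proj (\<lambda>i. (l * y) * u i)) \<le> l\<^sup>2 * inn u u"
        using inner_proj_le[of "\<lambda>i. (l * y) * u i"] by (simp only:)
      then have "\<sigma>\<^sup>2 / 2 * inn (proj (\<lambda>i. (l * y) * u i)) (proj (\<lambda>i. (l * y) * u i)) \<le> \<sigma>\<^sup>2 / 2 * (l\<^sup>2 * inn u u)"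
        by (intro mult_left_mono) auto
      then show "\<sigma>\<^sup>2 * inn (proj (\<lambda>i. (l * y) * u i)) (proj (\<lambda>i. (l * y) * u i)) / 2 \<le> l\<^sup>2 * \<sigma>\<^sup>2 / 2 * inn u u"
        by (simp add: mult_ac)
    qed
    finally show "(\<integral>\<^sup>+\<xi>. ennreal (exp (l * inn u (\<lambda>i. y * \<xi> i))) \<partial>noise Q) \<le> ennreal (exp (l\<^sup>2 * \<sigma>\<^sup>2 / 2 * inn u u))" .
  qed measurable
  have "(\<integral>\<^sup>+Z. \<integral>\<^sup>+Z'. ennreal (exp (l * inn (proj (labelled_sum Z)) (proj (labelled_sum Z')))) \<partial>data_dist Q \<partial>data_dist Q)
    \<le> (\<integral>\<^sup>+Z. ennreal (exp (l\<^sup>2 * \<sigma>\<^sup>2 / 2 * inn (proj (labelled_sum Z)) (proj (labelled_sum Z)))) \<partial>data_dist Q)"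
    by (intro nn_integral_mono inner)
  also have "\<dots> \<le> ennreal (exp (2 * real (dimn Q) * (l\<^sup>2 * \<sigma>\<^sup>2 / 2) * \<sigma>\<^sup>2))"
  proof (rule data_law_noise_bound[where f = "\<lambda>x. ennreal (exp (l\<^sup>2 * \<sigma>\<^sup>2 / 2 * inn x x))"])
    fix y :: real assume y: "y \<in> {1, -1}"
    show "(\<integral>\<^sup>+\<xi>. ennreal (exp (l\<^sup>2 * \<sigma>\<^sup>2 / 2 * inn (\<lambda>i. y * \<xi> i) (\<lambda>i. y * \<xi> i))) \<partial>noise Q)
      \<le> ennreal (exp (2 * real (dimn Q) * (l\<^sup>2 * \<sigma>\<^sup>2 / 2) * \<sigma>\<^sup>2))"
      unfolding inner_sign[OF y] using assms
      by (intro noise_norm_mgf) (simp, simp add: power2_eq_square power4_eq_xxxx mult_ac)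
  qed measurable
  finally show ?thesis by (simp add: power2_eq_square power4_eq_xxxx mult_ac)
qed

end

subsection \<open>Concentration over the training set\<close>

lemma emeasure_UN_le_card:
  assumes "finite I" "\<And>i. i \<in> I \<Longrightarrow> A i \<in> sets M" "\<And>i. i \<in> I \<Longrightarrow> emeasure M (A i) \<le> ennreal c" "0 \<le> c"
  shows "emeasure M (\<Union>i\<in>I. A i) \<le> ennreal (real (card I) * c)"
proof -
  have "emeasure M (\<Union>i\<in>I. A i) \<le> (\<Sum>i\<in>I. emeasure M (A i))"
    using assms by (intro emeasure_subadditive_finite) auto
  also have "\<dots> \<le> (\<Sum>i\<in>I. ennreal c)" using assms by (intro sum_mono) auto
  also have "\<dots> = ennreal (real (card I) * c)" using assms(4) by (simp add: ennreal_mult ennreal_of_nat_eq_real_of_nat)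
  finally show ?thesis .
qed

lemma emeasure_Un_le:
  assumes "A \<in> sets M" "B \<in> sets M" "emeasure M A \<le> ennreal a" "emeasure M B \<le> ennreal b" "0 \<le> a" "0 \<le> b"
  shows "emeasure M (A \<union> B) \<le> ennreal (a + b)"
  using order_trans[OF emeasure_subadditive[OF assms(1,2)] add_mono[OF assms(3,4)]] assms(5,6) by simp

lemma iid_sum_chernoff:
  fixes g :: "'a \<Rightarrow> real"
  assumes "prob_space M" and [measurable]: "g \<in> borel_measurable M"
    and mgf: "(\<integral>\<^sup>+x. ennreal (exp (g x)) \<partial>M) \<le> ennreal (exp c)"
  shows "emeasure (\<Pi>\<^sub>M i\<in>{..<n::nat}. M) {S \<in> space (\<Pi>\<^sub>M i\<in>{..<n}. M). (\<Sum>i<n. g (S i)) \<ge> \<tau>}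
    \<le> ennreal (exp (real n * c - \<tau>))"
proof -
  interpret product_sigma_finite "\<lambda>_::nat. M" by (rule product_sigma_finite_const[OF assms(1)])
  have "(\<integral>\<^sup>+S. ennreal (exp (\<Sum>i<n. g (S i))) \<partial>(\<Pi>\<^sub>M i\<in>{..<n}. M))
      = (\<integral>\<^sup>+S. (\<Prod>i<n. ennreal (exp (g (S i)))) \<partial>(\<Pi>\<^sub>M i\<in>{..<n}. M))"
    by (simp add: exp_sum prod_ennreal)
  also have "\<dots> = (\<integral>\<^sup>+x. ennreal (exp (g x)) \<partial>M) ^ n"
    by (subst product_nn_integral_prod) simp_all
  also have "\<dots> \<le> ennreal (exp c) ^ n" by (intro power_mono mgf) simp
  also have "\<dots> = ennreal (exp (real n * c))"
    by (simp add: ennreal_power exp_of_nat_mult)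
  finally have "emeasure (\<Pi>\<^sub>M i\<in>{..<n}. M) {S \<in> space (\<Pi>\<^sub>M i\<in>{..<n}. M). (\<Sum>i<n. g (S i)) \<ge> \<tau>}
      \<le> ennreal (exp (real n * c) * exp (- \<tau>))"
    by (intro chernoff) measurable
  then show ?thesis by (simp add: exp_add[symmetric])
qed

lemma iid_marginal:
  assumes "prob_space M" "i < n" and [measurable]: "Measurable.pred M P"
  shows "emeasure (\<Pi>\<^sub>M i\<in>{..<n::nat}. M) {S \<in> space (\<Pi>\<^sub>M i\<in>{..<n}. M). P (S i)}
    = emeasure M {x \<in> space M. P x}"
proof -
  have "emeasure M {x \<in> space M. P x} = emeasure (distr (\<Pi>\<^sub>M i\<in>{..<n}. M) M (\<lambda>S. S i)) {x \<in> space M. P x}"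
    by (subst distr_PiM_component) (simp_all add: assms(1,2))
  also have "\<dots> = emeasure (\<Pi>\<^sub>M i\<in>{..<n}. M) ((\<lambda>S. S i) -` {x \<in> space M. P x} \<inter> space (\<Pi>\<^sub>M i\<in>{..<n}. M))"
    using assms(2) by (intro emeasure_distr measurable_component_singleton) auto
  also have "(\<lambda>S. S i) -` {x \<in> space M. P x} \<inter> space (\<Pi>\<^sub>M i\<in>{..<n}. M) = {S \<in> space (\<Pi>\<^sub>M i\<in>{..<n}. M). P (S i)}"
    using assms(2) by (auto intro: measurable_space[OF measurable_component_singleton[of i "{..<n}" "\<lambda>_. M"]])
  finally show ?thesis ..
qed

lemma iid_pair_nn_integral:
  assumes "prob_space M" "i < n" "j < n" "i \<noteq> j" and [measurable]: "case_prod f \<in> borel_measurable (M \<Otimes>\<^sub>M M)"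
  shows "(\<integral>\<^sup>+S. f (S i) (S j) \<partial>(\<Pi>\<^sub>M i\<in>{..<n::nat}. M)) = (\<integral>\<^sup>+x. \<integral>\<^sup>+y. f x y \<partial>M \<partial>M)"
proof -
  interpret M: prob_space M by fact
  interpret product_prob_space "\<lambda>_::nat. M" UNIV by unfold_locales
  have "(\<integral>\<^sup>+x. \<integral>\<^sup>+y. f x y \<partial>M \<partial>M) = (\<integral>\<^sup>+z. f (fst z) (snd z) \<partial>(M \<Otimes>\<^sub>M M))"
    using assms(5) by (subst M.nn_integral_fst[symmetric]) (simp_all add: case_prod_beta')
  also have "\<dots> = (\<integral>\<^sup>+S. f (S i) (S j) \<partial>(\<Pi>\<^sub>M k\<in>{i, j}. M))"
    using assms by (intro product_nn_integral_pair[symmetric]) auto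
  also have "\<dots> = (\<integral>\<^sup>+S. f (restrict S {i, j} i) (restrict S {i, j} j) \<partial>(\<Pi>\<^sub>M k\<in>{..<n}. M))"
  proof -
    have ij: "{i, j} \<subseteq> {..<n}" using assms(2,3) by simp
    have meas: "(\<lambda>S. f (S i) (S j)) \<in> borel_measurable (\<Pi>\<^sub>M k\<in>{i, j}. M)"
      by (rule measurable_compose[OF _ assms(5), of "\<lambda>S. (S i, S j)", simplified]) simp
    have "(\<integral>\<^sup>+S. f (S i) (S j) \<partial>distr (\<Pi>\<^sub>M k\<in>{..<n}. M) (\<Pi>\<^sub>M k\<in>{i, j}. M) (\<lambda>S. restrict S {i, j}))
      = (\<integral>\<^sup>+S. f (restrict S {i, j} i) (restrict S {i, j} j) \<partial>(\<Pi>\<^sub>M k\<in>{..<n}. M))"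
      by (intro nn_integral_distr measurable_restrict_subset ij) (simp add: meas)
    then show ?thesis by (simp only: distr_restrict[OF ij finite_lessThan, symmetric])
  qed
  finally show ?thesis by simp
qed

context weak_model
begin

abbreviation "nw \<equiv> real (n_wk Q)"
abbreviation "D \<equiv> \<sigma>\<^sup>2 * real (dimn Q)"

text \<open>The diagonal tolerance D / (8 L) and n off-diagonal ones of D / (8 n L) fill half of the
  row budget in \<open>coupled_descent\<close>. The easy counts have mean n qe / 2, so they are
  controlled up to a factor 2 either way. The last clause holds almost surely and is included to
  make everything after it deterministic.\<close>

definition good :: "real \<Rightarrow> (nat \<Rightarrow> data_point) \<Rightarrow> bool" where
  "good L S \<longleftrightarrow>
    (\<forall>i<n_wk Q. \<bar>inn (proj (labelled_sum (S i))) (proj (labelled_sum (S i))) - D\<bar> \<le> D / (8 * L)) \<and>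
    (\<forall>i<n_wk Q. \<forall>j<n_wk Q. i \<noteq> j \<longrightarrow>
       \<bar>inn (proj (labelled_sum (S i))) (proj (labelled_sum (S j)))\<bar> \<le> D / (8 * nw * L)) \<and>
    (\<forall>s\<in>{1, -1}. nw * qe / 4 \<le> (\<Sum>i<n_wk Q. s * al s (labelled_sum (S i))) \<and>
       (\<Sum>i<n_wk Q. s * al s (labelled_sum (S i))) \<le> nw * qe \<and>
       (\<Sum>i<n_wk Q. \<bar>be s (labelled_sum (S i))\<bar>) \<le> 2 * nw * p_b Q) \<and>
    (\<forall>i<n_wk Q. \<forall>s\<in>{1, -1}. 0 \<le> s * al s (labelled_sum (S i)) \<and> s * al s (labelled_sum (S i)) \<le> 2 \<and>
       \<bar>be s (labelled_sum (S i))\<bar> \<le> 2)"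

lemma prob_space_training: "prob_space (training_sets Q)"
  unfolding training_sets_def by (intro prob_space_PiM prob_space_data_dist)

lemma training_component_measurable:
  "i < n_wk Q \<Longrightarrow> (\<lambda>S. S i) \<in> borel_measurable (training_sets Q)"
  unfolding training_sets_def
  by (subst measurable_cong_sets[OF refl sets_data_dist[symmetric]]) simp

lemma labelled_sum_component_measurable [measurable]:
  "i < n_wk Q \<Longrightarrow> (\<lambda>S. labelled_sum (S i)) \<in> borel_measurable (training_sets Q)"
  by (rule measurable_compose[OF training_component_measurable labelled_sum_measurable])

lemma good_measurable [measurable]: "Measurable.pred (training_sets Q) (good L)"
  unfolding good_def by measurable

schematic_goal training_norm_tail:
  assumes "i < n_wk Q" "1 \<le> L" "0 < dimn Q"
    and X: "X \<le> real (dimn Q) / (4096 * L\<^sup>2)" "X \<le> real (dimn Q) / (256 * L)"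
  shows "emeasure (training_sets Q) {S \<in> space (training_sets Q).
      \<bar>inn (proj (labelled_sum (S i))) (proj (labelled_sum (S i))) - D\<bar> > D / (8 * L)} \<le> ennreal (?c * exp (- X))"
proof -
  \<comment> \<open>Chosen so that 2 u sigma^2 is the tolerance D / (8 L). The resulting exponent
    u^2 / (16 d) = d / (4096 L^2) is the origin of the threshold 4096 for C.\<close>
  define u where "u = real (dimn Q) / (16 * L)"
  have "real (dimn Q) * 1 \<le> real (dimn Q) * (8 * L)" using assms(2) by (intro mult_left_mono) auto
  then have u: "0 \<le> u" "2 * u \<le> real (dimn Q)" using assms(2) by (auto simp: u_def field_simps)
  have Du: "D / (8 * L) = \<sigma>\<^sup>2 * (2 * u)" using assms(2) by (simp add: u_def field_simps)
  have "emeasure (training_sets Q) {S \<in> space (training_sets Q).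
      \<bar>inn (proj (labelled_sum (S i))) (proj (labelled_sum (S i))) - D\<bar> > D / (8 * L)}
    = emeasure (data_dist Q) {Z \<in> space (data_dist Q). \<bar>inn (proj (labelled_sum Z)) (proj (labelled_sum Z)) - D\<bar> > D / (8 * L)}"
    unfolding training_sets_def by (rule iid_marginal[OF prob_space_data_dist assms(1)]) measurable
  also have "\<dots> \<le> ennreal (2 * exp (- u\<^sup>2 / (16 * real (dimn Q))) + 2 * exp (- u / 16))"
    unfolding Du using sample_norm_tail[OF u assms(3)] by simp
  also have "\<dots> \<le> ennreal (4 * exp (- X))"
  proof (rule ennreal_leI)
    have "u\<^sup>2 / (16 * real (dimn Q)) = real (dimn Q) / (4096 * L\<^sup>2)" "u / 16 = real (dimn Q) / (256 * L)"
      using assms(2,3) by (simp_all add: u_def power2_eq_square field_simps)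
    then have "exp (- u\<^sup>2 / (16 * real (dimn Q))) \<le> exp (- X)" "exp (- u / 16) \<le> exp (- X)"
      using X by (simp_all)
    then show "2 * exp (- u\<^sup>2 / (16 * real (dimn Q))) + 2 * exp (- u / 16) \<le> 4 * exp (- X)" by linarith
  qed
  finally show "emeasure (training_sets Q) {S \<in> space (training_sets Q).
      \<bar>inn (proj (labelled_sum (S i))) (proj (labelled_sum (S i))) - D\<bar> > D / (8 * L)} \<le> ennreal (4 * exp (- X))" .
qed

schematic_goal training_cross_tail:
  assumes "i < n_wk Q" "j < n_wk Q" "i \<noteq> j" "1 \<le> L" "0 < dimn Q"
    and X: "X \<le> real (dimn Q) / (256 * nw\<^sup>2 * L\<^sup>2)"
  shows "emeasure (training_sets Q) {S \<in> space (training_sets Q).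
      \<bar>inn (proj (labelled_sum (S i))) (proj (labelled_sum (S j)))\<bar> > D / (8 * nw * L)} \<le> ennreal (?c * exp (- X))"
proof -
  have n: "nw \<ge> 1" using assms(1) by simp
  define s0 where "s0 = D / (8 * nw * L)"
  \<comment> \<open>The minimiser of d l^2 sigma^4 - l s0, with minimum -d / (256 n^2 L^2). This
    exponent is why d must dominate n^2 L^2 log.\<close>
  define l where "l = s0 / (2 * \<sigma>^4 * real (dimn Q))"
  have l: "l = 1 / (16 * nw * L * \<sigma>\<^sup>2)"
    using sigma_pos assms(5) by (simp add: l_def s0_def power4_eq_xxxx power2_eq_square)
  have lpos: "l > 0" using n assms(4) sigma_pos by (simp add: l)
  have one: "emeasure (training_sets Q) {S \<in> space (training_sets Q).
      c * inn (proj (labelled_sum (S i))) (proj (labelled_sum (S j))) \<ge> l * s0} \<le> ennreal (exp (- X))"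
    if c: "c \<in> {l, -l}" for c
  proof -
    have c2: "c\<^sup>2 = l\<^sup>2" using c by auto
    have "(nw * L)\<^sup>2 \<ge> 1" using n assms(4) by (simp add: mult_ge1_I one_le_power)
    then have "c\<^sup>2 * \<sigma>^4 \<le> 1 / 2"
      unfolding c2 l using sigma_pos by (simp add: power_divide power_mult_distrib field_simps power4_eq_xxxx power2_eq_square)
    have "(\<integral>\<^sup>+S. ennreal (exp (c * inn (proj (labelled_sum (S i))) (proj (labelled_sum (S j))))) \<partial>training_sets Q)
        = (\<integral>\<^sup>+Z. \<integral>\<^sup>+Z'. ennreal (exp (c * inn (proj (labelled_sum Z)) (proj (labelled_sum Z')))) \<partial>data_dist Q \<partial>data_dist Q)"
      unfolding training_sets_def by (rule iid_pair_nn_integral[OF prob_space_data_dist assms(1-3)]) measurable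
    also have "\<dots> \<le> ennreal (exp (real (dimn Q) * c\<^sup>2 * \<sigma>^4))"
      by (rule cross_mgf) fact
    finally have "emeasure (training_sets Q) {S \<in> space (training_sets Q).
        c * inn (proj (labelled_sum (S i))) (proj (labelled_sum (S j))) \<ge> l * s0}
      \<le> ennreal (exp (real (dimn Q) * c\<^sup>2 * \<sigma>^4) * exp (- (l * s0)))"
      using assms(1,2) by (intro chernoff) measurable
    also have "\<dots> \<le> ennreal (exp (- X))"
    proof (rule ennreal_leI)
      have "real (dimn Q) * c\<^sup>2 * \<sigma>^4 - l * s0 = - (real (dimn Q) / (256 * nw\<^sup>2 * L\<^sup>2))"
        unfolding c2 l s0_def using n assms(4,5) sigma_pos
        by (simp add: field_simps power4_eq_xxxx power2_eq_square)
      then show "exp (real (dimn Q) * c\<^sup>2 * \<sigma>^4) * exp (- (l * s0)) \<le> exp (- X)"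
        using X by (simp add: exp_add[symmetric])
    qed
    finally show ?thesis .
  qed
  have "emeasure (training_sets Q) {S \<in> space (training_sets Q). \<bar>inn (proj (labelled_sum (S i))) (proj (labelled_sum (S j)))\<bar> > s0}
    \<le> emeasure (training_sets Q) ({S \<in> space (training_sets Q). l * inn (proj (labelled_sum (S i))) (proj (labelled_sum (S j))) \<ge> l * s0}
      \<union> {S \<in> space (training_sets Q). (- l) * inn (proj (labelled_sum (S i))) (proj (labelled_sum (S j))) \<ge> l * s0})"
  proof (rule emeasure_mono)
    show "{S \<in> space (training_sets Q). \<bar>inn (proj (labelled_sum (S i))) (proj (labelled_sum (S j)))\<bar> > s0}
      \<subseteq> {S \<in> space (training_sets Q). l * inn (proj (labelled_sum (S i))) (proj (labelled_sum (S j))) \<ge> l * s0}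
      \<union> {S \<in> space (training_sets Q). (- l) * inn (proj (labelled_sum (S i))) (proj (labelled_sum (S j))) \<ge> l * s0}"
    proof
      fix S assume "S \<in> {S \<in> space (training_sets Q). \<bar>inn (proj (labelled_sum (S i))) (proj (labelled_sum (S j)))\<bar> > s0}"
      then have S: "S \<in> space (training_sets Q)" "inn (proj (labelled_sum (S i))) (proj (labelled_sum (S j))) \<ge> s0
          \<or> - inn (proj (labelled_sum (S i))) (proj (labelled_sum (S j))) \<ge> s0" by auto
      then have "l * inn (proj (labelled_sum (S i))) (proj (labelled_sum (S j))) \<ge> l * s0
          \<or> l * (- inn (proj (labelled_sum (S i))) (proj (labelled_sum (S j)))) \<ge> l * s0"
        using lpos by (meson mult_left_mono less_imp_le)
      then show "S \<in> {S \<in> space (training_sets Q). l * inn (proj (labelled_sum (S i))) (proj (labelled_sum (S j))) \<ge> l * s0}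
      \<union> {S \<in> space (training_sets Q). (- l) * inn (proj (labelled_sum (S i))) (proj (labelled_sum (S j))) \<ge> l * s0}"
        using S(1) by auto
    qed
  qed (use assms(1,2) in measurable)
  also have "\<dots> \<le> ennreal (exp (- X) + exp (- X))"
    using assms(1,2) by (intro emeasure_Un_le one) auto
  finally show "emeasure (training_sets Q) {S \<in> space (training_sets Q).
      \<bar>inn (proj (labelled_sum (S i))) (proj (labelled_sum (S j)))\<bar> > D / (8 * nw * L)} \<le> ennreal (2 * exp (- X))" by (simp add: s0_def)
qed

\<comment> \<open>Three Chernoff bounds, hence the constant 3. The parameters -1/8, 1/4 and 1/2 give
  the exponents -n qe / 64, -n qe / 16 and -n p_b / 4; since qe >= p_b, all are at most -n p_b /
  64.\<close>
schematic_goal training_count_tail: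
  assumes "s \<in> {1, -1}" "8 * p_h Q \<le> p_b Q" and Y: "Y \<le> nw * p_b Q / 64"
  shows "emeasure (training_sets Q) {S \<in> space (training_sets Q).
      \<not> (nw * qe / 4 \<le> (\<Sum>i<n_wk Q. s * al s (labelled_sum (S i))) \<and>
       (\<Sum>i<n_wk Q. s * al s (labelled_sum (S i))) \<le> nw * qe \<and>
       (\<Sum>i<n_wk Q. \<bar>be s (labelled_sum (S i))\<bar>) \<le> 2 * nw * p_b Q)} \<le> ennreal (?c * exp (- Y))"
proof -
  let ?T = "training_sets Q"
  let ?A = "{S \<in> space ?T. (\<Sum>i<n_wk Q. (-1/8) * (s * al s (labelled_sum (S i)))) \<ge> (-1/8) * (nw * qe / 4)}"
  let ?B = "{S \<in> space ?T. (\<Sum>i<n_wk Q. (1/4) * (s * al s (labelled_sum (S i)))) \<ge> (1/4) * (nw * qe)}"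
  let ?C = "{S \<in> space ?T. (\<Sum>i<n_wk Q. (1/2) * \<bar>be s (labelled_sum (S i))\<bar>) \<ge> (1/2) * (2 * nw * p_b Q)}"
  have q: "nw * p_b Q \<le> nw * qe" using p_pos by (intro mult_left_mono) auto
  have m: "(\<lambda>Z. l * (s * al s (labelled_sum Z))) \<in> borel_measurable (data_dist Q)"
    "(\<lambda>Z. l * \<bar>be s (labelled_sum Z)\<bar>) \<in> borel_measurable (data_dist Q)" for l
  proof -
    have "(\<lambda>Z. al s (labelled_sum Z)) \<in> borel_measurable (data_dist Q)"
      "(\<lambda>Z. be s (labelled_sum Z)) \<in> borel_measurable (data_dist Q)" by measurable
    then show "(\<lambda>Z. l * (s * al s (labelled_sum Z))) \<in> borel_measurable (data_dist Q)"
      "(\<lambda>Z. l * \<bar>be s (labelled_sum Z)\<bar>) \<in> borel_measurable (data_dist Q)"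
      by (auto intro!: borel_measurable_times borel_measurable_abs)
  qed
  have "emeasure ?T ?A \<le> ennreal (exp (nw * ((-1/8) * qe / 2 + (-1/8)\<^sup>2 * qe) - (-1/8) * (nw * qe / 4)))"
    unfolding training_sets_def
    by (rule iid_sum_chernoff[OF prob_space_data_dist m(1) al_mgf]) (use assms(1) in auto)
  also have "\<dots> \<le> ennreal (exp (- Y))"
    using q Y by (intro ennreal_leI) (simp add: power2_eq_square field_simps)
  finally have A: "emeasure ?T ?A \<le> ennreal (exp (- Y))" .
  have "emeasure ?T ?B \<le> ennreal (exp (nw * ((1/4) * qe / 2 + (1/4)\<^sup>2 * qe) - (1/4) * (nw * qe)))"
    unfolding training_sets_def
    by (rule iid_sum_chernoff[OF prob_space_data_dist m(1) al_mgf]) (use assms(1) in auto)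
  also have "\<dots> \<le> ennreal (exp (- Y))"
  proof (intro ennreal_leI, subst exp_le_cancel_iff)
    have "nw * ((1/4) * qe / 2 + (1/4)\<^sup>2 * qe) - (1/4) * (nw * qe) = - (nw * qe) / 16"
      by (simp add: power2_eq_square field_simps)
    moreover have "0 \<le> nw * qe" using p_pos by simp
    ultimately show "nw * ((1/4) * qe / 2 + (1/4)\<^sup>2 * qe) - (1/4) * (nw * qe) \<le> - Y"
      using q Y by linarith
  qed
  finally have B: "emeasure ?T ?B \<le> ennreal (exp (- Y))" .
  have "emeasure ?T ?C \<le> ennreal (exp (nw * ((1/2 + (1/2)\<^sup>2) * p_b Q) - (1/2) * (2 * nw * p_b Q)))"
    unfolding training_sets_def
    by (rule iid_sum_chernoff[OF prob_space_data_dist m(2) be_mgf]) (use assms(1,2) in auto)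
  also have "\<dots> \<le> ennreal (exp (- Y))"
  proof (intro ennreal_leI, subst exp_le_cancel_iff)
    have "0 \<le> nw * p_b Q" using p_pos by simp
    then show "nw * ((1/2 + (1/2)\<^sup>2) * p_b Q) - (1/2) * (2 * nw * p_b Q) \<le> - Y"
      using Y by (simp add: power2_eq_square field_simps)
  qed
  finally have C: "emeasure ?T ?C \<le> ennreal (exp (- Y))" .
  have "emeasure ?T {S \<in> space ?T. \<not> (nw * qe / 4 \<le> (\<Sum>i<n_wk Q. s * al s (labelled_sum (S i))) \<and>
       (\<Sum>i<n_wk Q. s * al s (labelled_sum (S i))) \<le> nw * qe \<and>
       (\<Sum>i<n_wk Q. \<bar>be s (labelled_sum (S i))\<bar>) \<le> 2 * nw * p_b Q)} \<le> emeasure ?T (?A \<union> ?B \<union> ?C)"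
    by (intro emeasure_mono) (auto simp: sum_divide_distrib[symmetric] sum_distrib_left[symmetric] sum_negf)
  also have "\<dots> \<le> ennreal (exp (- Y) + exp (- Y) + exp (- Y))"
    by (intro emeasure_Un_le A B C) auto
  finally show "emeasure (training_sets Q) {S \<in> space (training_sets Q).
      \<not> (nw * qe / 4 \<le> (\<Sum>i<n_wk Q. s * al s (labelled_sum (S i))) \<and>
       (\<Sum>i<n_wk Q. s * al s (labelled_sum (S i))) \<le> nw * qe \<and>
       (\<Sum>i<n_wk Q. \<bar>be s (labelled_sum (S i))\<bar>) \<le> 2 * nw * p_b Q)} \<le> ennreal (3 * exp (- Y))" by simp
qed

\<comment> \<open>The failure probability is \<open>delta Q\<close>: with X and Y the logarithms in
  the conditions on d and n, the union bound gives 4 n exp (-X) + 2 n^2 exp (-X) + 6 exp (-Y) <= 12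
  delta / C.\<close>
schematic_goal training_good:
  assumes "1 \<le> L" "0 < dimn Q" "1 \<le> nw" "8 * p_h Q \<le> p_b Q" "4096 \<le> C"
    and d: "real (dimn Q) \<ge> C * (nw\<^sup>2 * ln (C * nw\<^sup>2 / delta Q)) * L\<^sup>2"
    and n: "nw \<ge> C * (1 / (p_b Q)\<^sup>2) * ln (C / delta Q)"
  shows "emeasure (training_sets Q) {S \<in> space (training_sets Q). \<not> good L S} \<le> ennreal ?p"
proof -
  let ?T = "training_sets Q"
  define X where "X = ln (C * nw\<^sup>2 / delta Q)"
  define Y where "Y = ln (C / delta Q)"
  have delta: "0 < delta Q" "delta Q < 1" using params_ok by (auto simp: params_ok_def)
  have n2: "1 \<le> nw\<^sup>2" using assms(3) by simp
  have L2: "1 \<le> L" "L \<le> L\<^sup>2" using assms(1) by (auto simp: power2_eq_square)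
  have "1 * 1 \<le> C * nw\<^sup>2" using assms(5) n2 by (intro mult_mono) auto
  then have X0: "0 \<le> X" unfolding X_def using delta by (intro ln_ge_zero) (simp add: field_simps)
  have Y0: "0 \<le> Y" unfolding Y_def using delta assms(5) by (intro ln_ge_zero) (simp add: field_simps)
  have eX: "exp (- X) = delta Q / (C * nw\<^sup>2)"
  proof -
    have "0 < C * nw\<^sup>2 / delta Q" using delta assms(3,5) by (intro divide_pos_pos mult_pos_pos) auto
    then show ?thesis by (simp add: X_def exp_minus)
  qed
  have eY: "exp (- Y) = delta Q / C" using delta assms(5) by (simp add: Y_def exp_minus)
  have d': "real (dimn Q) \<ge> 4096 * (nw\<^sup>2 * X * L\<^sup>2)"
  proof -
    have "4096 * (nw\<^sup>2 * X * L\<^sup>2) \<le> C * (nw\<^sup>2 * X * L\<^sup>2)" using assms(5) X0 by (intro mult_right_mono) auto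
    then show ?thesis using d by (simp add: X_def mult_ac)
  qed
  have XL: "X * L \<le> X * L\<^sup>2" "X * L\<^sup>2 \<le> nw\<^sup>2 * X * L\<^sup>2" "0 \<le> nw\<^sup>2 * X * L\<^sup>2"
    using X0 L2 n2 by (auto intro!: mult_left_mono mult_right_mono simp: mult_le_cancel_right1)
  have X1: "X \<le> real (dimn Q) / (4096 * L\<^sup>2)" "X \<le> real (dimn Q) / (256 * L)"
    using d' XL L2 by (auto simp: pos_le_divide_eq mult_ac)
  have X2: "X \<le> real (dimn Q) / (256 * nw\<^sup>2 * L\<^sup>2)"
  proof (subst pos_le_divide_eq)
    show "0 < 256 * nw\<^sup>2 * L\<^sup>2" using assms(1,3) by simp
    show "X * (256 * nw\<^sup>2 * L\<^sup>2) \<le> real (dimn Q)" using d' XL(3) by (simp add: mult_ac)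
  qed
  \<comment> \<open>As p_b <= 1, the size condition with 1 / p_b^2 implies the one with 1 / p_b that
    the Chernoff exponent n p_b asks for.\<close>
  have Y1: "Y \<le> nw * p_b Q / 64"
  proof -
    have pb: "0 < p_b Q" "p_b Q \<le> 1" using p_pos by auto
    have "C * Y \<le> nw * (p_b Q)\<^sup>2" using n pb by (simp add: Y_def field_simps)
    also have "\<dots> \<le> nw * p_b Q" using pb by (intro mult_left_mono) (auto simp: power2_eq_square mult_le_cancel_left1)
    finally have "C * Y \<le> nw * p_b Q" .
    moreover have "64 * Y \<le> C * Y" using assms(5) Y0 by (intro mult_right_mono) auto
    ultimately show ?thesis by simp
  qed
  let ?N = "\<lambda>i. {S \<in> space ?T. \<bar>inn (proj (labelled_sum (S i))) (proj (labelled_sum (S i))) - D\<bar> > D / (8 * L)}"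
  let ?X = "\<lambda>(i, j). {S \<in> space ?T. \<bar>inn (proj (labelled_sum (S i))) (proj (labelled_sum (S j)))\<bar> > D / (8 * nw * L)}"
  let ?C = "\<lambda>s. {S \<in> space ?T. \<not> (nw * qe / 4 \<le> (\<Sum>i<n_wk Q. s * al s (labelled_sum (S i))) \<and>
       (\<Sum>i<n_wk Q. s * al s (labelled_sum (S i))) \<le> nw * qe \<and>
       (\<Sum>i<n_wk Q. \<bar>be s (labelled_sum (S i))\<bar>) \<le> 2 * nw * p_b Q)}"
  let ?Z = "{S \<in> space ?T. \<not> (\<forall>i<n_wk Q. \<forall>s\<in>{1, -1}. 0 \<le> s * al s (labelled_sum (S i)) \<and> s * al s (labelled_sum (S i)) \<le> 2 \<and>
       \<bar>be s (labelled_sum (S i))\<bar> \<le> 2)}"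
  define I where "I = {(i, j). i < n_wk Q \<and> j < n_wk Q \<and> i \<noteq> j}"
  have I: "I \<subseteq> {..<n_wk Q} \<times> {..<n_wk Q}" by (auto simp: I_def)
  then have finI: "finite I" and cardI: "card I \<le> n_wk Q * n_wk Q"
    using card_mono[OF _ I] finite_subset[OF I] by (auto simp: card_cartesian_product)
  have N: "emeasure ?T (\<Union>i<n_wk Q. ?N i) \<le> ennreal (real (card {..<n_wk Q}) * (4 * exp (- X)))"
    using assms by (intro emeasure_UN_le_card training_norm_tail X1) auto
  have Xt: "emeasure ?T (\<Union>ij\<in>I. ?X ij) \<le> ennreal (real (card I) * (2 * exp (- X)))"
    using assms(1,2) finI by (intro emeasure_UN_le_card) (auto simp: I_def intro!: training_cross_tail X2)
  have Ct: "emeasure ?T (\<Union>s\<in>{1, -1}. ?C s) \<le> ennreal (real (card {1, -1 :: real}) * (3 * exp (- Y)))"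
    by (intro emeasure_UN_le_card training_count_tail assms Y1) auto
  have Zt: "emeasure ?T ?Z \<le> ennreal 0"
  proof -
    have "AE S in ?T. \<forall>i\<in>{..<n_wk Q}. \<forall>s\<in>{1, -1}. 0 \<le> s * al s (labelled_sum (S i)) \<and> s * al s (labelled_sum (S i)) \<le> 2 \<and>
       \<bar>be s (labelled_sum (S i))\<bar> \<le> 2"
      unfolding training_sets_def
    proof (rule AE_finite_allI)
      fix i assume "i \<in> {..<n_wk Q}"
      then show "AE S in (\<Pi>\<^sub>M i\<in>{..<n_wk Q}. data_dist Q). \<forall>s\<in>{1, -1}. 0 \<le> s * al s (labelled_sum (S i))
         \<and> s * al s (labelled_sum (S i)) \<le> 2 \<and> \<bar>be s (labelled_sum (S i))\<bar> \<le> 2"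
        using AE_coords[of "kind_pmf Q"] unfolding data_dist_def[symmetric]
        by (intro AE_PiM_component[where P = "\<lambda>Z. \<forall>s\<in>{1, -1}. 0 \<le> s * al s (labelled_sum Z) \<and> s * al s (labelled_sum Z) \<le> 2
     \<and> \<bar>be s (labelled_sum Z)\<bar> \<le> 2"] prob_space_data_dist) auto
    qed simp
    then have "emeasure ?T ?Z = 0" by (intro emeasure_eq_0_AE) auto
    then show ?thesis by simp
  qed
  have sub: "{S \<in> space ?T. \<not> good L S} \<subseteq> (\<Union>i<n_wk Q. ?N i) \<union> (\<Union>ij\<in>I. ?X ij) \<union> (\<Union>s\<in>{1, -1}. ?C s) \<union> ?Z"
  proof
    fix S assume S: "S \<in> {S \<in> space ?T. \<not> good L S}"
    show "S \<in> (\<Union>i<n_wk Q. ?N i) \<union> (\<Union>ij\<in>I. ?X ij) \<union> (\<Union>s\<in>{1, -1}. ?C s) \<union> ?Z"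
    proof (rule ccontr)
      assume no: "S \<notin> (\<Union>i<n_wk Q. ?N i) \<union> (\<Union>ij\<in>I. ?X ij) \<union> (\<Union>s\<in>{1, -1}. ?C s) \<union> ?Z"
      have sp: "S \<in> space ?T" using S by simp
      have "good L S"
        unfolding good_def
      proof (intro conjI)
        show "\<forall>i<n_wk Q. \<bar>inn (proj (labelled_sum (S i))) (proj (labelled_sum (S i))) - D\<bar> \<le> D / (8 * L)"
        proof (intro allI impI)
          fix i assume "i < n_wk Q"
          then have "S \<notin> ?N i" using no by blast
          then show "\<bar>inn (proj (labelled_sum (S i))) (proj (labelled_sum (S i))) - D\<bar> \<le> D / (8 * L)"
            using sp by simp
        qed
        show "\<forall>i<n_wk Q. \<forall>j<n_wk Q. i \<noteq> j \<longrightarrow>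
           \<bar>inn (proj (labelled_sum (S i))) (proj (labelled_sum (S j)))\<bar> \<le> D / (8 * nw * L)"
        proof (intro allI impI)
          fix i j assume "i < n_wk Q" "j < n_wk Q" "i \<noteq> j"
          then have "(i, j) \<in> I" by (simp add: I_def)
          then have "S \<notin> ?X (i, j)" using no by blast
          then show "\<bar>inn (proj (labelled_sum (S i))) (proj (labelled_sum (S j)))\<bar> \<le> D / (8 * nw * L)"
            using sp by simp
        qed
        show "\<forall>s\<in>{1, -1}. nw * qe / 4 \<le> (\<Sum>i<n_wk Q. s * al s (labelled_sum (S i))) \<and>
           (\<Sum>i<n_wk Q. s * al s (labelled_sum (S i))) \<le> nw * qe \<and>
           (\<Sum>i<n_wk Q. \<bar>be s (labelled_sum (S i))\<bar>) \<le> 2 * nw * p_b Q"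
          using no sp by blast
        show "\<forall>i<n_wk Q. \<forall>s\<in>{1, -1}. 0 \<le> s * al s (labelled_sum (S i)) \<and> s * al s (labelled_sum (S i)) \<le> 2 \<and>
           \<bar>be s (labelled_sum (S i))\<bar> \<le> 2"
          using no sp by blast
      qed
      then show False using S by simp
    qed
  qed
  have UN_sets: "(\<Union>i<n_wk Q. ?N i) \<union> (\<Union>ij\<in>I. ?X ij) \<union> (\<Union>s\<in>{1, -1}. ?C s) \<union> ?Z \<in> sets ?T"
    using finI by (intro sets.Un sets.finite_UN) (auto simp: I_def)
  have "emeasure ?T {S \<in> space ?T. \<not> good L S}
      \<le> emeasure ?T ((\<Union>i<n_wk Q. ?N i) \<union> (\<Union>ij\<in>I. ?X ij) \<union> (\<Union>s\<in>{1, -1}. ?C s) \<union> ?Z)"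
    by (rule emeasure_mono[OF sub UN_sets])
  also have "\<dots> \<le> ennreal (real (card {..<n_wk Q}) * (4 * exp (- X)) + real (card I) * (2 * exp (- X))
      + real (card {1, -1 :: real}) * (3 * exp (- Y)) + 0)"
    using finI by (intro emeasure_Un_le N Xt Ct Zt sets.Un sets.finite_UN) (auto simp: I_def)
  also have "\<dots> \<le> ennreal (delta Q)"
  proof (rule ennreal_leI)
    have "nw \<le> nw\<^sup>2" using assms(3) by (simp add: power2_eq_square)
    then have "nw * (4 * exp (- X)) \<le> nw\<^sup>2 * (4 * exp (- X))" by (intro mult_right_mono) auto
    moreover have "real (card I) \<le> nw\<^sup>2"
      using cardI by (simp add: power2_eq_square flip: of_nat_mult)
    then have "real (card I) * (2 * exp (- X)) \<le> nw\<^sup>2 * (2 * exp (- X))" by (intro mult_right_mono) auto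
    moreover have "nw\<^sup>2 * exp (- X) = delta Q / C" using assms(3,5) by (simp add: eX)
    moreover have "12 * (delta Q / C) \<le> delta Q" using delta assms(5) by (simp add: field_simps)
    ultimately show "real (card {..<n_wk Q}) * (4 * exp (- X)) + real (card I) * (2 * exp (- X))
      + real (card {1, -1 :: real}) * (3 * exp (- Y)) + 0 \<le> delta Q"
      by (simp add: eY)
  qed
  finally show "emeasure (training_sets Q) {S \<in> space (training_sets Q). \<not> good L S} \<le> ennreal (delta Q)" .
qed

end

subsection \<open>Gradient descent on a nearly orthogonal sample\<close>

lemma exp_one_le_3: "exp 1 \<le> (3 :: real)"
  using exp_le by simp

text \<open>The coefficients of nearly orthogonal samples all follow \<open>b' = b + \<alpha> / (1 + exp b)\<close> up to a
  bounded error in the exponent, so \<open>exp b\<close> grows linearly in time.\<close>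

locale coupled_descent =
  fixes n T :: nat and G :: "nat \<Rightarrow> nat \<Rightarrow> real" and a :: "nat \<Rightarrow> nat \<Rightarrow> real" and h D L :: real
  assumes a_0: "j < n \<Longrightarrow> a 0 j = 0"
    and a_Suc: "j < n \<Longrightarrow> a (Suc t) j = a t j + h / (1 + exp (\<Sum>i<n. a t i * G i j))"
    and h_pos: "0 < h" and D_pos: "0 < D" and L_pos: "0 < L" and step: "h * D \<le> 1 / 3"
    and row: "j < n \<Longrightarrow> (\<Sum>i<n. \<bar>G i j - (if i = j then D else 0)\<bar>) \<le> D / (2 * L)"
    and time: "t \<le> T \<Longrightarrow> ln (1 + 2 * exp 1 * (h * D) * real t) \<le> 2 * L"
begin

abbreviation "margin t j \<equiv> (\<Sum>i<n. a t i * G i j)"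

text \<open>Coefficients of at most 2 L / D times a row error of at most D / (2 L): the two scales
  cancel, leaving an error free of n, T and L.\<close>

lemma margin_close:
  assumes j: "j < n" and a: "\<And>i. i < n \<Longrightarrow> 0 \<le> a t i" "\<And>i. i < n \<Longrightarrow> D * a t i \<le> 2 * L"
  shows "\<bar>margin t j - D * a t j\<bar> \<le> 1"
proof -
  have "D * a t j = (\<Sum>i<n. a t i * (if i = j then D else 0))"
    using j by (simp add: if_distrib cong: if_cong)
  then have "margin t j - D * a t j = (\<Sum>i<n. a t i * (G i j - (if i = j then D else 0)))"
    by (simp add: right_diff_distrib sum_subtractf)
  also have "\<bar>\<dots>\<bar> \<le> (\<Sum>i<n. \<bar>a t i * (G i j - (if i = j then D else 0))\<bar>)"
    by (rule sum_abs)
  also have "\<dots> \<le> (\<Sum>i<n. (2 * L / D) * \<bar>G i j - (if i = j then D else 0)\<bar>)"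
    unfolding abs_mult using a D_pos by (intro sum_mono mult_right_mono) (auto simp: field_simps)
  also have "\<dots> \<le> (2 * L / D) * (D / (2 * L))"
    unfolding sum_distrib_left[symmetric] using row[OF j] D_pos L_pos by (intro mult_left_mono) auto
  finally show ?thesis using D_pos L_pos by simp
qed

text \<open>One induction for all j, as margin j involves every coefficient. With b = D a_j and
  increment x, the margin is within 1 of b, so x exp b lies between h D / (2 e) and h D e; then exp
  b (1 + x) <= exp (b + x) <= exp b (1 + 2 x).\<close>

lemma coefficient_growth:
  assumes "t \<le> T" "j < n"
  shows "0 \<le> a t j" and "1 + h * D * real t / (2 * exp 1) \<le> exp (D * a t j)"
    and "exp (D * a t j) \<le> 1 + 2 * exp 1 * (h * D) * real t"
proof -
  have "\<forall>j<n. 0 \<le> a t j \<and> 1 + h * D * real t / (2 * exp 1) \<le> exp (D * a t j)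
      \<and> exp (D * a t j) \<le> 1 + 2 * exp 1 * (h * D) * real t"
    using assms(1)
  proof (induction t)
    case 0
    then show ?case by (simp add: a_0)
  next
    case (Suc t)
    then have IH: "\<And>j. j < n \<Longrightarrow> 0 \<le> a t j"
      "\<And>j. j < n \<Longrightarrow> 1 + h * D * real t / (2 * exp 1) \<le> exp (D * a t j)"
      "\<And>j. j < n \<Longrightarrow> exp (D * a t j) \<le> 1 + 2 * exp 1 * (h * D) * real t"
      by auto
    have hD: "0 < h * D" using h_pos D_pos by simp
    show ?case
    proof (intro allI impI)
      fix j assume j: "j < n"
      \<comment> \<open>The upper growth bound is fed back here: within the horizon it caps all
        coefficients, which keeps the margins close for one more step.\<close>
      have "D * a t i \<le> 2 * L" if "i < n" for i
      proof -
        have "D * a t i = ln (exp (D * a t i))" by simp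
        also have "\<dots> \<le> ln (1 + 2 * exp 1 * (h * D) * real t)"
          using IH(3)[OF that] by (subst ln_le_cancel_iff) (auto intro: less_le_trans[OF exp_gt_zero])
        also have "\<dots> \<le> 2 * L" using Suc.prems by (intro time) simp
        finally show ?thesis .
      qed
      then have close: "\<bar>margin t j - D * a t j\<bar> \<le> 1" by (intro margin_close j IH(1))
      define b where "b = D * a t j"
      define x where "x = h * D / (1 + exp (margin t j))"
      have b: "0 \<le> b" using IH(1)[OF j] D_pos by (simp add: b_def)
      have eb: "1 \<le> exp b" using b by simp
      have m: "b - 1 \<le> margin t j" "margin t j \<le> b + 1" using close by (auto simp: b_def)
      have bS: "D * a (Suc t) j = b + x" by (simp add: a_Suc[OF j] b_def x_def distrib_left mult.commute)
      have x0: "0 < x" using hD by (simp add: x_def add_pos_pos)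
      have xu: "x * exp b \<le> h * D * exp 1"
      proof -
        have "x \<le> h * D / exp (b - 1)"
          unfolding x_def using hD m(1) by (intro divide_left_mono mult_pos_pos add_pos_pos) (auto simp: add_increasing)
        then show ?thesis by (simp add: exp_diff field_simps)
      qed
      \<comment> \<open>The step size condition caps the increment x at 1, so that exp x <= 1 + 2 x
        applies.\<close>
      have "h * D * exp 1 \<le> 1 / 3 * 3" using step exp_one_le_3 hD by (intro mult_mono) auto
      moreover have "x * 1 \<le> x * exp b" using x0 eb by (intro mult_left_mono) auto
      ultimately have x1: "x \<le> 1" using xu by simp
      have "exp x \<le> 1 + 2 * x"
      proof -
        have "x * x \<le> x * 1" using x0 x1 by (intro mult_left_mono) auto
        moreover have "exp x \<le> 1 + x + x * x"
          using exp_le_quadratic[of x] x0 x1 by (simp add: power2_eq_square)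
        ultimately show ?thesis by linarith
      qed
      then have "exp (b + x) \<le> exp b * (1 + 2 * x)" by (simp add: exp_add)
      also have "\<dots> \<le> exp b + 2 * (h * D * exp 1)" using xu by (simp add: algebra_simps)
      also have "\<dots> \<le> 1 + 2 * exp 1 * (h * D) * real (Suc t)"
        using IH(3)[OF j] by (simp add: b_def algebra_simps)
      finally have up: "exp (D * a (Suc t) j) \<le> 1 + 2 * exp 1 * (h * D) * real (Suc t)" by (simp add: bS)
      have "h * D / (2 * exp 1) \<le> x * exp b"
      proof -
        have "1 + exp (margin t j) \<le> exp (b + 1) + exp (b + 1)" using m(2) b by (intro add_mono) auto
        then have "1 + exp (margin t j) \<le> 2 * exp 1 * exp b" by (simp add: exp_add mult_ac)
        then have "h * D / (2 * exp 1 * exp b) \<le> x"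
          unfolding x_def using hD by (intro divide_left_mono mult_pos_pos add_pos_pos) auto
        then have "h * D / (2 * exp 1 * exp b) * exp b \<le> x * exp b" by (intro mult_right_mono) auto
        then show ?thesis by simp
      qed
      then have "1 + h * D * real (Suc t) / (2 * exp 1) \<le> exp b * (1 + x)"
        using IH(2)[OF j] by (simp add: b_def algebra_simps add_divide_distrib)
      also have "\<dots> \<le> exp b * exp x" by (intro mult_left_mono exp_ge_add_one_self) auto
      finally have low: "1 + h * D * real (Suc t) / (2 * exp 1) \<le> exp (D * a (Suc t) j)" by (simp add: bS exp_add)
      have "0 \<le> a (Suc t) j" using IH(1)[OF j] h_pos by (simp add: a_Suc[OF j] add_nonneg_nonneg)
      with up low show "0 \<le> a (Suc t) j \<and> 1 + h * D * real (Suc t) / (2 * exp 1) \<le> exp (D * a (Suc t) j)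
        \<and> exp (D * a (Suc t) j) \<le> 1 + 2 * exp 1 * (h * D) * real (Suc t)" by simp
    qed
  qed
  then show "0 \<le> a t j" "1 + h * D * real t / (2 * exp 1) \<le> exp (D * a t j)"
    "exp (D * a t j) \<le> 1 + 2 * exp 1 * (h * D) * real t"
    using assms(2) by auto
qed

lemma trajectory_margin_close:
  assumes "t \<le> T" "j < n"
  shows "\<bar>margin t j - D * a t j\<bar> \<le> 1"
proof (rule margin_close[OF assms(2)])
  fix i assume i: "i < n"
  show "0 \<le> a t i" by (rule coefficient_growth(1)[OF assms(1) i])
  have "D * a t i = ln (exp (D * a t i))" by simp
  also have "\<dots> \<le> ln (1 + 2 * exp 1 * (h * D) * real t)"
    using coefficient_growth(3)[OF assms(1) i]
    by (subst ln_le_cancel_iff) (auto intro: less_le_trans[OF exp_gt_zero])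
  also have "\<dots> \<le> 2 * L" by (rule time[OF assms(1)])
  finally show "D * a t i \<le> 2 * L" .
qed

lemma coefficient_pos:
  assumes "t \<le> T" "j < n" "0 < t"
  shows "0 < a t j"
proof -
  have "0 < h * D * real t / (2 * exp 1)" using h_pos D_pos assms(3) by simp
  then have "1 < exp (D * a t j)" using coefficient_growth(2)[OF assms(1,2)] by linarith
  then show ?thesis using D_pos by (simp add: zero_less_mult_iff)
qed

text \<open>Bernoulli's inequality turns the linear growth of all \<open>exp (D a)\<close> into comparability of the
  coefficients themselves; the constant is \<open>4 e\<^sup>2 \<le> 36\<close>.\<close>

schematic_goal coefficient_ratio:
  assumes "t \<le> T" "i < n" "j < n"
  shows "a t i \<le> ?c * a t j"
proof -
  define y where "y = h * D * real t / (2 * exp 1)"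
  have y: "0 \<le> y" using h_pos D_pos by (simp add: y_def)
  have "exp 1 * exp 1 \<le> 3 * (3 :: real)" using exp_one_le_3 by (intro mult_mono) auto
  then have e2: "4 * (exp 1 * exp 1) \<le> (36 :: real)" by simp
  have "2 * exp 1 * (h * D) * real t = 4 * (exp 1 * exp 1) * y" by (simp add: y_def)
  also have "\<dots> \<le> 36 * y" using e2 y by (rule mult_right_mono)
  finally have "exp (D * a t i) \<le> 1 + real 36 * y"
    using coefficient_growth(3)[OF assms(1,2)] by linarith
  also have "\<dots> \<le> (1 + y) ^ 36" using y by (intro Bernoulli_inequality) simp
  also have "\<dots> \<le> exp (D * a t j) ^ 36"
    using coefficient_growth(2)[OF assms(1,3)] y by (intro power_mono) (auto simp: y_def)
  also have "\<dots> = exp (D * (36 * a t j))" by (simp add: exp_of_nat_mult[symmetric] mult_ac)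
  finally show "a t i \<le> 36 * a t j" using D_pos by simp
qed

\<comment> \<open>The constant is 18 >= 2 e^2: the loss is at most exp (-margin), replacing the
  margin by D a_j costs a factor e, and the lower growth bound another 2 e.\<close>
schematic_goal loss_bound:
  assumes "t \<le> T" "j < n" "0 < t"
  shows "logistic_loss (margin t j) \<le> ?c / (h * D * real t)"
proof -
  have pos: "0 < h * D * real t" using h_pos D_pos assms(3) by simp
  have "logistic_loss (margin t j) \<le> exp (- margin t j)"
    unfolding logistic_loss_def by (rule ln_add_one_self_le_self) simp
  also have "\<dots> \<le> exp (1 - D * a t j)"
    using trajectory_margin_close[OF assms(1,2)] by simp
  also have "\<dots> = exp 1 / exp (D * a t j)" by (simp add: exp_diff)
  also have "\<dots> \<le> exp 1 / (h * D * real t / (2 * exp 1))"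
    using coefficient_growth(2)[OF assms(1,2)] pos by (intro divide_left_mono) (auto intro!: mult_pos_pos divide_pos_pos)
  also have "\<dots> = 2 * (exp 1 * exp 1) / (h * D * real t)" by simp
  also have "\<dots> \<le> 18 / (h * D * real t)"
  proof (rule divide_right_mono)
    have "exp 1 * exp 1 \<le> 3 * (3 :: real)" using exp_one_le_3 by (intro mult_mono) auto
    then show "2 * (exp 1 * exp 1) \<le> (18 :: real)" by simp
  qed (use pos in simp)
  finally show "logistic_loss (margin t j) \<le> 18 / (h * D * real t)" .
qed

end

subsection \<open>The gradient of the training loss\<close>

lemma L_wk_labelled_sum:
  "L_wk Q S w = (1 / real (n_wk Q)) * (\<Sum>j<n_wk Q. logistic_loss (inner_d (dimn Q) w (labelled_sum (S j))))"
  by (simp add: L_wk_def f_wk_labelled_sum)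

lemma inner_d_update:
  assumes "i < d"
  shows "inner_d d (w(i := h)) z = inner_d d w z + (h - w i) * z i"
proof -
  have "inner_d d (w(i := h)) z = (\<Sum>k<d. w k * z k + (if k = i then (h - w i) * z i else 0))"
    unfolding inner_d_def by (intro sum.cong refl) (auto simp: algebra_simps)
  then show ?thesis using assms by (simp add: sum.distrib inner_d_def)
qed

lemma gradient_L_wk:
  "gradient_d (dimn Q) (L_wk Q S) w i = (if i < dimn Q then - (1 / real (n_wk Q)) *
     (\<Sum>j<n_wk Q. labelled_sum (S j) i / (1 + exp (inner_d (dimn Q) w (labelled_sum (S j))))) else 0)"
proof (cases "i < dimn Q")
  case True
  have der: "((\<lambda>h. logistic_loss (A + (h - w i) * c)) has_real_derivative - (c / (1 + exp A))) (at (w i))" for A c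
  proof -
    have "((\<lambda>h. ln (1 + exp (- (A + (h - w i) * c)))) has_real_derivative
        (1 / (1 + exp (- (A + (w i - w i) * c)))) * (exp (- (A + (w i - w i) * c)) * (- c))) (at (w i))"
      by (auto intro!: derivative_eq_intros add_pos_pos)
    moreover have "(1 / (1 + exp (- A))) * (exp (- A) * (- c)) = - (c / (1 + exp A))"
    proof -
      have "1 + exp A \<noteq> 0" "1 + exp (- A) \<noteq> 0" using exp_gt_zero[of A] exp_gt_zero[of "- A"] by linarith+
      then show ?thesis by (simp add: exp_minus field_simps)
    qed
    ultimately show ?thesis by (simp add: logistic_loss_def)
  qed
  have "((\<lambda>h. L_wk Q S (w(i := h))) has_real_derivative (1 / real (n_wk Q)) *
     (\<Sum>j<n_wk Q. - (labelled_sum (S j) i / (1 + exp (inner_d (dimn Q) w (labelled_sum (S j))))))) (at (w i))"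
    unfolding L_wk_labelled_sum inner_d_update[OF True]
    by (intro DERIV_cmult DERIV_sum der)
  then show ?thesis
    using True by (simp add: gradient_d_def DERIV_imp_deriv sum_negf)
qed (simp add: gradient_d_def)

text \<open>The accumulated gradient weight of sample j, read off the trajectory itself; that it
  obeys a recursion of its own is \<open>coef_Suc\<close>.\<close>

definition coef :: "params \<Rightarrow> (nat \<Rightarrow> data_point) \<Rightarrow> nat \<Rightarrow> nat \<Rightarrow> real" where
  "coef Q S t j = (\<Sum>s<t. (lr Q / real (n_wk Q)) /
     (1 + exp (inner_d (dimn Q) (w_iter Q S s) (labelled_sum (S j)))))"

lemma w_iter_Suc_coord:
  "w_iter Q S (Suc t) i = w_iter Q S t i + (if i < dimn Q then (lr Q / real (n_wk Q)) *
     (\<Sum>j<n_wk Q. labelled_sum (S j) i / (1 + exp (inner_d (dimn Q) (w_iter Q S t) (labelled_sum (S j))))) else 0)"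
  by (simp add: gradient_L_wk)

text \<open>Restricted to coordinates below d: beyond them the iterate is 0, whereas the patches of
  an arbitrary \<open>S\<close> may be anything.\<close>

lemma w_iter_coef:
  "i < dimn Q \<Longrightarrow> w_iter Q S t i = (\<Sum>j<n_wk Q. coef Q S t j * labelled_sum (S j) i)"
proof (induction t)
  case (Suc t)
  then show ?case
    unfolding w_iter_Suc_coord
    by (simp add: coef_def algebra_simps sum.distrib sum_distrib_left)
qed (simp add: coef_def)

lemma inner_w_iter:
  "inner_d (dimn Q) (w_iter Q S t) u = (\<Sum>j<n_wk Q. coef Q S t j * inner_d (dimn Q) (labelled_sum (S j)) u)"
proof -
  have "inner_d (dimn Q) (w_iter Q S t) u
      = inner_d (dimn Q) (\<lambda>i. \<Sum>j<n_wk Q. coef Q S t j * labelled_sum (S j) i) u"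
    by (subst (1 2) inner_d_commute) (intro inner_d_cong w_iter_coef)
  then show ?thesis by (simp add: inner_d_sum)
qed

text \<open>The recursion closes: only coefficients and Gram entries occur, which is the form of
  \<open>coupled_descent\<close>.\<close>

lemma coef_Suc:
  "coef Q S (Suc t) j = coef Q S t j + (lr Q / real (n_wk Q)) /
     (1 + exp (\<Sum>i<n_wk Q. coef Q S t i * inner_d (dimn Q) (labelled_sum (S i)) (labelled_sum (S j))))"
  unfolding inner_w_iter[symmetric] by (simp add: coef_def)

subsection \<open>Supports of laws\<close>

lemma law_support_compl:
  assumes "space M = UNIV"
  shows "- law_support M = \<Union>{U. open U \<and> emeasure M U = 0}"
  using assms by (auto simp: law_support_def not_less)

lemma closed_law_support: "space M = UNIV \<Longrightarrow> closed (law_support M)"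
  unfolding closed_def law_support_compl by (intro open_Union) auto

text \<open>The complement of the support is a union of possibly uncountably many null open sets; by
  Lindelof a countable subfamily has the same union.\<close>

lemma AE_law_support:
  fixes M :: "'a::second_countable_topology measure"
  assumes sets: "sets M = sets borel"
  shows "AE x in M. x \<in> law_support M"
proof -
  have sp: "space M = UNIV" using sets_eq_imp_space_eq[OF sets] by simp
  obtain F where F: "F \<subseteq> {U. open U \<and> emeasure M U = 0}" "countable F"
    "\<Union>F = \<Union>{U. open U \<and> emeasure M U = 0}"
    by (rule Lindelof[of "{U. open U \<and> emeasure M U = 0}"]) auto
  have "\<Union>F \<in> null_sets M"
    using F(1,2) sets by (intro null_sets_UN'[of F "\<lambda>x. x", simplified]) (auto simp: null_sets_def)
  then show ?thesis
    using F(3) law_support_compl[OF sp] by (intro AE_I'[of "\<Union>F"]) auto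
qed

lemma law_support_subset_closed:
  assumes "sets M = sets borel" "closed C" "AE x in M. x \<in> C"
  shows "law_support M \<subseteq> C"
proof -
  have "space M = UNIV" using sets_eq_imp_space_eq[OF assms(1)] by simp
  moreover have "emeasure M (- C) = 0"
  proof -
    have "{x \<in> space M. \<not> x \<in> C} \<in> sets M" using assms(1,2) \<open>space M = UNIV\<close> by (simp flip: Compl_eq)
    then have "emeasure M {x \<in> space M. \<not> x \<in> C} = 0" using assms(3) by (subst AE_iff_measurable[symmetric]) auto
    then show ?thesis using \<open>space M = UNIV\<close> by (simp add: Compl_eq)
  qed
  ultimately have "- C \<subseteq> - law_support M"
    unfolding law_support_compl[OF \<open>space M = UNIV\<close>] using assms(2) by auto
  then show ?thesis by blast
qed

context weak_model
begin

subsection \<open>The test error\<close>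

lemma proj_scale: "proj (\<lambda>i. c * w i) = (\<lambda>i. c * proj w i)"
  by (simp add: proj_def algebra_simps)

\<comment> \<open>Constant 2. Given the signals, the margin is Gaussian with mean at least
  \<open>S0\<close> and variance at most \<open>V\<close>, and r = S0 / V minimises the Chernoff
  exponent -r S0 + r^2 V / 2.\<close>
schematic_goal data_law_margin_tail:
  assumes S0: "0 \<le> S0" and V: "\<sigma>\<^sup>2 * inn (proj w) (proj w) \<le> V" "0 < V"
    and margin: "\<And>y v. y \<in> {1, -1} \<Longrightarrow> v \<in> set_pmf (signal_pmf Q y k) \<Longrightarrow> S0 \<le> inn w (\<lambda>i. y * (fst v i + snd v i))"
  shows "emeasure (data_law Q (return_pmf k)) {Z. inn w (labelled_sum Z) < 0} \<le> ennreal (exp (- (S0\<^sup>2 / (?c * V))))"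
proof -
  define r where "r = S0 / V"
  have r: "0 \<le> r" using S0 V by (simp add: r_def)
  let ?h = "\<lambda>Z. - r * inn w (labelled_sum Z)"
  have "(\<integral>\<^sup>+Z. ennreal (exp (?h Z)) \<partial>data_law Q (return_pmf k))
      \<le> (\<integral>\<^sup>+k. (ennreal (exp (- (S0\<^sup>2 / (2 * V)))) + ennreal (exp (- (S0\<^sup>2 / (2 * V))))) / 2 \<partial>return_pmf k)"
  proof (rule data_law_nn_integral_le)
    fix k' y v and \<pi> :: "nat \<Rightarrow> nat"
    assume *: "k' \<in> set_pmf (return_pmf k)" "y \<in> {1, -1}" "v \<in> set_pmf (signal_pmf Q y k')" "\<pi> permutes {1, 2, 3}"
    let ?m = "inn w (\<lambda>i. y * (fst v i + snd v i))"
    have m: "S0 \<le> ?m" using * by (intro margin) auto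
    have "?h (data_map ((y, v, \<pi>), \<xi>)) = - r * ?m + inn (\<lambda>i. (- r * y) * w i) \<xi>" for \<xi>
      unfolding labelled_sum_data_map[OF *(4)] inner_d_linear(6) by (simp add: algebra_simps)
    then have "(\<integral>\<^sup>+\<xi>. ennreal (exp (?h (data_map ((y, v, \<pi>), \<xi>)))) \<partial>noise Q)
        = (\<integral>\<^sup>+\<xi>. ennreal (exp (- r * ?m)) * ennreal (exp (inn (\<lambda>i. (- r * y) * w i) \<xi>)) \<partial>noise Q)"
      by (simp only: exp_add ennreal_mult exp_ge_zero)
    also have "\<dots> = ennreal (exp (- r * ?m)) * ennreal (exp (\<sigma>\<^sup>2 * (r\<^sup>2 * inn (proj w) (proj w)) / 2))"
    proof (subst nn_integral_cmult)
      have "inn (\<lambda>i. (- r * y) * proj w i) (\<lambda>i. (- r * y) * proj w i) = r\<^sup>2 * inn (proj w) (proj w)"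
        unfolding inner_d_linear(3,6) using *(2) by (auto simp: power2_eq_square)
      then show "ennreal (exp (- r * ?m)) * (\<integral>\<^sup>+\<xi>. ennreal (exp (inn (\<lambda>i. (- r * y) * w i) \<xi>)) \<partial>noise Q)
          = ennreal (exp (- r * ?m)) * ennreal (exp (\<sigma>\<^sup>2 * (r\<^sup>2 * inn (proj w) (proj w)) / 2))"
        by (simp only: noise_mgf proj_scale)
    qed measurable
    also have "\<dots> = ennreal (exp (- r * ?m + \<sigma>\<^sup>2 * (r\<^sup>2 * inn (proj w) (proj w)) / 2))"
      by (simp only: exp_add ennreal_mult exp_ge_zero)
    also have "\<dots> \<le> ennreal (exp (- (S0\<^sup>2 / (2 * V))))"
    proof (intro ennreal_leI, subst exp_le_cancel_iff)
      have "r * S0 \<le> r * ?m" using m r by (rule mult_left_mono)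
      moreover have "r\<^sup>2 * (\<sigma>\<^sup>2 * inn (proj w) (proj w)) \<le> r\<^sup>2 * V" using V by (intro mult_left_mono) auto
      moreover have "- (r * S0) + r\<^sup>2 * V / 2 = - (S0\<^sup>2 / (2 * V))"
        using V by (simp add: r_def power2_eq_square field_simps)
      ultimately show "- r * ?m + \<sigma>\<^sup>2 * (r\<^sup>2 * inn (proj w) (proj w)) / 2 \<le> - (S0\<^sup>2 / (2 * V))"
        by (simp add: mult_ac)
    qed
    finally show "(\<integral>\<^sup>+\<xi>. ennreal (exp (?h (data_map ((y, v, \<pi>), \<xi>)))) \<partial>noise Q) \<le> ennreal (exp (- (S0\<^sup>2 / (2 * V))))" .
  qed measurable
  also have "\<dots> = ennreal (exp (- (S0\<^sup>2 / (2 * V))))"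
    by (simp add: mult_2[symmetric] mult.commute[of 2] ennreal_mult_divide_eq del: ennreal_plus)
  finally have "emeasure (data_law Q (return_pmf k)) {Z \<in> space (data_law Q (return_pmf k)). ?h Z \<ge> 0}
      \<le> ennreal (exp (- (S0\<^sup>2 / (2 * V))) * exp (- 0))"
    by (intro chernoff) measurable
  then have tail: "emeasure (data_law Q (return_pmf k)) {Z \<in> space (data_law Q (return_pmf k)). ?h Z \<ge> 0}
      \<le> ennreal (exp (- (S0\<^sup>2 / (2 * V))))" by simp
  have "{Z. inn w (labelled_sum Z) < 0} \<subseteq> {Z \<in> space (data_law Q (return_pmf k)). ?h Z \<ge> 0}"
    using r by (auto simp: mult_nonneg_nonpos)
  then show "emeasure (data_law Q (return_pmf k)) {Z. inn w (labelled_sum Z) < 0} \<le> ennreal (exp (- (S0\<^sup>2 / (2 * V))))" by (rule order_trans[OF emeasure_mono tail]) measurable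
qed

text \<open>A continuous statistic that is almost surely at least 1 on easy-only and both-signal data and 0 on
  hard-only data, so hard-only data almost surely avoids the two supports in the test error.\<close>

definition easy_score :: "data_point \<Rightarrow> real" where
  "easy_score Z = al 1 (labelled_sum Z) - al (-1) (labelled_sum Z)"

lemma easy_score_measurable [measurable]: "easy_score \<in> borel_measurable borel"
  unfolding easy_score_def by measurable

lemma closed_easy_score: "closed {Z. 1 \<le> easy_score Z}"
  unfolding easy_score_def al_def inner_d_def
  by (intro closed_Collect_le continuous_on_const continuous_on_diff continuous_on_divide
      continuous_on_sum continuous_on_mult labelled_sum_continuous) (use norm_mu_pos in auto)

lemma AE_easy_score:
  "AE Z in data_law Q (return_pmf k). easy_score Z = (case k of Easy \<Rightarrow> 2 | Hard \<Rightarrow> 0 | Both \<Rightarrow> 1)"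
proof (rule AE_data_law)
  fix k' y v and \<pi> :: "nat \<Rightarrow> nat" and \<xi>
  assume *: "k' \<in> set_pmf (return_pmf k)" "y \<in> {1, -1}" "v \<in> set_pmf (signal_pmf Q y k')" "\<pi> permutes {1, 2, 3}"
    "\<And>s. s \<in> {1, -1} \<Longrightarrow> inn (mu Q s) \<xi> = 0 \<and> inn (nu Q s) \<xi> = 0"
  have "s * al s (labelled_sum (data_map ((y, v, \<pi>), \<xi>)))
      = (if s = y then case k of Easy \<Rightarrow> 2 | Hard \<Rightarrow> 0 | Both \<Rightarrow> 1 else 0)" if "s \<in> {1, -1}" for s
    using al_data_map(1)[OF *(3,2,4) that *(5)] *(1) by simp
  from this[of 1] this[of "-1"] *(2)
  show "easy_score (data_map ((y, v, \<pi>), \<xi>)) = (case k of Easy \<Rightarrow> 2 | Hard \<Rightarrow> 0 | Both \<Rightarrow> 1)"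
    by (auto simp: easy_score_def)
qed measurable

abbreviation "easy_support \<equiv> kind_support Q Easy \<union> kind_support Q Both"

lemma closed_kind_support: "closed (kind_support Q k)"
  unfolding kind_support_def by (rule closed_law_support) simp

lemma easy_support_measurable [measurable]: "easy_support \<in> sets borel"
  by (intro sets.Un borel_closed closed_kind_support)

lemma easy_support_subset: "easy_support \<subseteq> {Z. 1 \<le> easy_score Z}"
proof -
  have "kind_support Q k \<subseteq> {Z. 1 \<le> easy_score Z}" if "k \<noteq> Hard" for k
    unfolding kind_support_def
  proof (rule law_support_subset_closed)
    show "AE Z in data_law Q (return_pmf k). Z \<in> {Z. 1 \<le> easy_score Z}"
      using AE_easy_score[of k] by eventually_elim (use that in \<open>cases k; simp\<close>)
  qed (simp_all add: closed_easy_score)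
  then show ?thesis by blast
qed

lemma data_dist_emeasure:
  assumes "A \<in> sets borel"
  shows "emeasure (data_dist Q) A = ennreal (p_e Q) * emeasure (data_law Q (return_pmf Easy)) A
    + ennreal (p_h Q) * emeasure (data_law Q (return_pmf Hard)) A
    + ennreal (p_b Q) * emeasure (data_law Q (return_pmf Both)) A"
  using data_dist_nn_integral[of "indicator A"] assms by simp

text \<open>Each of the two kinds has full mass on its own support; the nonnegative share of hard
  data is dropped.\<close>

lemma emeasure_easy_support:
  "ennreal (p_e Q + p_b Q) \<le> emeasure (data_dist Q) easy_support"
proof -
  have 1: "emeasure (data_law Q (return_pmf k)) easy_support = 1" if "k \<noteq> Hard" for k
  proof -
    interpret P: prob_space "data_law Q (return_pmf k)" by (rule prob_space_data_law)
    have "AE Z in data_law Q (return_pmf k). Z \<in> easy_support"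
      using AE_law_support[OF sets_data_law] unfolding kind_support_def
      by eventually_elim (use that in \<open>cases k; simp\<close>)
    then show ?thesis by (intro P.emeasure_eq_1_AE) simp
  qed
  have "ennreal (p_e Q + p_b Q) = ennreal (p_e Q) * emeasure (data_law Q (return_pmf Easy)) easy_support
      + ennreal (p_b Q) * emeasure (data_law Q (return_pmf Both)) easy_support"
    using p_pos by (simp only: 1[OF kind.distinct(1)] 1[OF kind.distinct(6)]) (simp add: ennreal_plus)
  also have "\<dots> \<le> emeasure (data_dist Q) easy_support"
    by (subst data_dist_emeasure) (auto intro!: add_mono simp: easy_support_measurable)
  finally show ?thesis .
qed

lemma test_error_eq: "test_error Q w
    = measure (data_dist Q) {Z. inn w (labelled_sum Z) < 0 \<and> Z \<in> easy_support} / measure (data_dist Q) easy_support"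
  by (simp add: test_error_def cond_prob_def f_wk_labelled_sum del: Un_iff)

text \<open>Hard data almost surely misses the conditioning event, so the numerator is at most (p_e
  + p_b) \<tau>, while the denominator is at least p_e + p_b.\<close>

lemma test_error_le:
  assumes tau: "0 \<le> \<tau>"
    and easy: "emeasure (data_law Q (return_pmf Easy)) {Z. inn w (labelled_sum Z) < 0} \<le> ennreal \<tau>"
    and both: "emeasure (data_law Q (return_pmf Both)) {Z. inn w (labelled_sum Z) < 0} \<le> ennreal \<tau>"
  shows "test_error Q w \<le> \<tau>"
proof -
  interpret P: prob_space "data_dist Q" by (rule prob_space_data_dist)
  let ?A = "{Z. inn w (labelled_sum Z) < 0 \<and> Z \<in> easy_support}"
  have A [measurable]: "?A \<in> sets borel" by measurable
  have hard: "emeasure (data_law Q (return_pmf Hard)) ?A = 0"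
  proof -
    have "AE Z in data_law Q (return_pmf Hard). \<not> (inn w (labelled_sum Z) < 0 \<and> Z \<in> easy_support)"
      using AE_easy_score[of Hard] by eventually_elim (use easy_support_subset in auto)
    then have "emeasure (data_law Q (return_pmf Hard)) {Z \<in> space (data_law Q (return_pmf Hard)).
        inn w (labelled_sum Z) < 0 \<and> Z \<in> easy_support} = 0"
      by (rule emeasure_eq_0_AE)
    then show ?thesis by (simp del: Un_iff)
  qed
  have le: "emeasure (data_law Q (return_pmf k)) ?A \<le> emeasure (data_law Q (return_pmf k)) {Z. inn w (labelled_sum Z) < 0}" for k
    by (intro emeasure_mono) auto
  have "emeasure (data_dist Q) ?A \<le> ennreal (p_e Q) * ennreal \<tau> + ennreal (p_h Q) * 0 + ennreal (p_b Q) * ennreal \<tau>"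
    unfolding data_dist_emeasure[OF A]
    by (intro add_mono mult_left_mono order_trans[OF le easy] order_trans[OF le both]) (simp_all add: hard del: Un_iff)
  also have "\<dots> = ennreal ((p_e Q + p_b Q) * \<tau>)"
    using p_pos tau by (simp add: ennreal_mult[symmetric] ennreal_plus[symmetric] distrib_right del: ennreal_plus)
  finally have num: "measure (data_dist Q) ?A \<le> (p_e Q + p_b Q) * \<tau>"
    using p_pos tau by (simp add: P.emeasure_eq_measure)
  have den: "p_e Q + p_b Q \<le> measure (data_dist Q) easy_support"
    using emeasure_easy_support p_pos by (simp add: P.emeasure_eq_measure del: ennreal_plus)
  have "test_error Q w = measure (data_dist Q) ?A / measure (data_dist Q) easy_support"
    by (rule test_error_eq)
  also have "\<dots> \<le> \<tau>"
  proof -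
    have "measure (data_dist Q) ?A \<le> measure (data_dist Q) easy_support * \<tau>"
      using num mult_right_mono[OF den tau] by linarith
    moreover have "0 < measure (data_dist Q) easy_support" using den p_pos by linarith
    ultimately show ?thesis by (simp add: divide_le_eq mult.commute)
  qed
  finally show ?thesis .
qed

subsection \<open>Measurability of the training trajectory\<close>

lemma w_iter_measurable [measurable]: "(\<lambda>S. w_iter Q S t) \<in> borel_measurable (training_sets Q)"
proof (induction t)
  case (Suc t)
  note [measurable] = Suc
  have [measurable]: "(\<lambda>S. w_iter Q S t i) \<in> borel_measurable (training_sets Q)" for i
    by (rule measurable_product_then_coordinatewise) measurable
  have [measurable]: "(\<lambda>S. labelled_sum (S j) i) \<in> borel_measurable (training_sets Q)" if "j < n_wk Q" for i j
    by (rule measurable_product_then_coordinatewise) (use that in measurable)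
  show ?case
    by (intro measurable_coordinatewise_then_product, unfold w_iter_Suc_coord) measurable
qed simp

lemma L_wk_measurable [measurable]: "(\<lambda>S. L_wk Q S (w_iter Q S t)) \<in> borel_measurable (training_sets Q)"
  unfolding L_wk_labelled_sum logistic_loss_def by measurable

text \<open>The numerator is the mass of a section of a jointly measurable set. The success event
  contains the test error, and it must be measurable for its probability to be bounded below through
  \<open>good\<close>.\<close>

lemma test_error_measurable [measurable]: "(\<lambda>S. test_error Q (w_iter Q S t)) \<in> borel_measurable (training_sets Q)"
proof -
  interpret P: prob_space "data_dist Q" by (rule prob_space_data_dist)
  let ?B = "{x \<in> space (training_sets Q \<Otimes>\<^sub>M data_dist Q). inn (w_iter Q (fst x) t) (labelled_sum (snd x)) < 0 \<and> snd x \<in> easy_support}"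
  have [measurable]: "(\<lambda>x. w_iter Q (fst x) t) \<in> borel_measurable (training_sets Q \<Otimes>\<^sub>M data_dist Q)"
    by (rule measurable_compose[OF measurable_fst w_iter_measurable])
  have "?B \<in> sets (training_sets Q \<Otimes>\<^sub>M data_dist Q)" by measurable
  then have "(\<lambda>S. emeasure (data_dist Q) (Pair S -` ?B)) \<in> borel_measurable (training_sets Q)"
    by (rule P.measurable_emeasure_Pair)
  then have "(\<lambda>S. enn2real (emeasure (data_dist Q) (Pair S -` ?B)) / measure (data_dist Q) easy_support) \<in> borel_measurable (training_sets Q)"
    by measurable
  also have "?this \<longleftrightarrow> ?thesis"
    by (intro measurable_cong) (simp add: test_error_eq measure_def space_pair_measure vimage_def del: Un_iff)
  finally show ?thesis .
qed

subsection \<open>The trajectory on a good training set\<close>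

abbreviation "smp S i \<equiv> labelled_sum (S i)"
abbreviation "rate \<equiv> lr Q / nw"

lemma abs_sum3_le:
  fixes x :: real
  shows "x = p + r + n \<Longrightarrow> \<bar>p\<bar> \<le> p' \<Longrightarrow> \<bar>r\<bar> \<le> r' \<Longrightarrow> \<bar>x\<bar> \<le> p' + r' + \<bar>n\<bar>"
  by linarith

\<comment> \<open>Constant 2. The noise takes D / (8 L) for the diagonal entry and as much for the
  rest of the row. In each signal product one factor is at most 2 and the other is summed over i,
  giving 4 n qe |mu|^2 + 8 n p_b |nu|^2; \<open>mu_nu\<close> and \<open>scarce\<close> turn this
  into 5 n qe |mu|^2 <= D / (4 L).\<close>
schematic_goal good_row:
  assumes good: "good L S" and L: "1 \<le> L" and n: "1 \<le> nw" and C: "4096 \<le> C"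
    and mu_nu: "C * p_b Q * (norm_nu Q)\<^sup>2 \<le> qe * (norm_mu Q)\<^sup>2"
    and scarce: "C * L * (nw * qe * (norm_mu Q)\<^sup>2) \<le> D"
    and j: "j < n_wk Q"
  shows "(\<Sum>i<n_wk Q. \<bar>inn (smp S i) (smp S j) - (if i = j then D else 0)\<bar>) \<le> D / (?c * L)"
proof -
  let ?a = "(norm_mu Q)\<^sup>2" and ?b = "(norm_nu Q)\<^sup>2"
  let ?A = "\<lambda>s i. s * al s (smp S i)" and ?B = "\<lambda>s i. \<bar>be s (smp S i)\<bar>"
  let ?N = "\<lambda>i. inn (proj (smp S i)) (proj (smp S j)) - (if i = j then D else 0)"
  have D0: "0 \<le> D" by simp
  have A: "0 \<le> ?A s i" "?A s i \<le> 2" "?B s i \<le> 2" if "s \<in> {1, -1}" "i < n_wk Q" for s i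
    using good that unfolding good_def by blast+
  have sums: "(\<Sum>i<n_wk Q. ?A s i) \<le> nw * qe" "(\<Sum>i<n_wk Q. ?B s i) \<le> 2 * nw * p_b Q" if "s \<in> {1, -1}" for s
    using good that unfolding good_def by blast+
  have point: "\<bar>inn (smp S i) (smp S j) - (if i = j then D else 0)\<bar>
      \<le> 2 * ?a * (?A 1 i + ?A (-1) i) + 2 * ?b * (?B 1 i + ?B (-1) i) + \<bar>?N i\<bar>" if i: "i < n_wk Q" for i
  proof -
    have al: "\<bar>al s (smp S i) * al s (smp S j)\<bar> \<le> 2 * ?A s i" if s: "s \<in> {1, -1}" for s
    proof -
      have "\<bar>al s (smp S i)\<bar> = ?A s i" "\<bar>al s (smp S j)\<bar> = ?A s j" using A(1)[OF s i] A(1)[OF s j] s by auto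
      then have "\<bar>al s (smp S i) * al s (smp S j)\<bar> = ?A s i * ?A s j" by (simp only: abs_mult)
      also have "\<dots> \<le> ?A s i * 2" using A[OF s i] A[OF s j] by (intro mult_left_mono)
      finally show ?thesis by simp
    qed
    have be: "\<bar>be s (smp S i) * be s (smp S j)\<bar> \<le> 2 * ?B s i" if s: "s \<in> {1, -1}" for s
    proof -
      have "?B s i * ?B s j \<le> ?B s i * 2" using A[OF s j] by (intro mult_left_mono) auto
      then show ?thesis by (simp add: abs_mult)
    qed
    let ?p = "al 1 (smp S i) * al 1 (smp S j) + al (-1) (smp S i) * al (-1) (smp S j)"
      and ?r = "be 1 (smp S i) * be 1 (smp S j) + be (-1) (smp S i) * be (-1) (smp S j)"
    have "inn (smp S i) (smp S j) - (if i = j then D else 0) = ?a * ?p + ?b * ?r + ?N i"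
      by (simp add: inner_decomp[of "smp S i"])
    moreover have "\<bar>?a * ?p\<bar> \<le> ?a * (2 * ?A 1 i + 2 * ?A (-1) i)"
      unfolding abs_mult[of ?a] abs_power2
      by (intro mult_left_mono order_trans[OF abs_triangle_ineq] add_mono al) auto
    moreover have "\<bar>?b * ?r\<bar> \<le> ?b * (2 * ?B 1 i + 2 * ?B (-1) i)"
      unfolding abs_mult[of ?b] abs_power2
      by (intro mult_left_mono order_trans[OF abs_triangle_ineq] add_mono be) auto
    ultimately have "\<bar>inn (smp S i) (smp S j) - (if i = j then D else 0)\<bar>
      \<le> ?a * (2 * ?A 1 i + 2 * ?A (-1) i) + ?b * (2 * ?B 1 i + 2 * ?B (-1) i) + \<bar>?N i\<bar>"
      by (rule abs_sum3_le)
    then show ?thesis by (simp add: algebra_simps)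
  qed
  have "(\<Sum>i<n_wk Q. \<bar>?N i\<bar>) = \<bar>?N j\<bar> + (\<Sum>i\<in>{..<n_wk Q} - {j}. \<bar>?N i\<bar>)"
    using j by (intro sum.remove) auto
  also have "\<dots> \<le> D / (8 * L) + (\<Sum>i\<in>{..<n_wk Q} - {j}. D / (8 * nw * L))"
  proof (intro add_mono sum_mono)
    have "\<bar>inn (proj (smp S j)) (proj (smp S j)) - D\<bar> \<le> D / (8 * L)"
      using good j unfolding good_def by blast
    then show "\<bar>?N j\<bar> \<le> D / (8 * L)" by simp
    fix i assume i: "i \<in> {..<n_wk Q} - {j}"
    then have "\<bar>inn (proj (smp S i)) (proj (smp S j))\<bar> \<le> D / (8 * nw * L)"
      using good j unfolding good_def by blast
    then show "\<bar>?N i\<bar> \<le> D / (8 * nw * L)" using i by simp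
  qed
  also have "(\<Sum>i\<in>{..<n_wk Q} - {j}. D / (8 * nw * L)) \<le> (\<Sum>i\<in>{..<n_wk Q}. D / (8 * nw * L))"
    using D0 L by (intro sum_mono2) auto
  also have "\<dots> = D / (8 * L)" using n by simp
  also have "D / (8 * L) + D / (8 * L) = D / (4 * L)" by (simp add: field_simps)
  finally have N: "(\<Sum>i<n_wk Q. \<bar>?N i\<bar>) \<le> D / (4 * L)" by simp
  have "(\<Sum>i<n_wk Q. \<bar>inn (smp S i) (smp S j) - (if i = j then D else 0)\<bar>)
      \<le> (\<Sum>i<n_wk Q. 2 * ?a * (?A 1 i + ?A (-1) i) + 2 * ?b * (?B 1 i + ?B (-1) i) + \<bar>?N i\<bar>)"
    by (intro sum_mono point) auto
  also have "\<dots> = 2 * ?a * ((\<Sum>i<n_wk Q. ?A 1 i) + (\<Sum>i<n_wk Q. ?A (-1) i))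
      + 2 * ?b * ((\<Sum>i<n_wk Q. ?B 1 i) + (\<Sum>i<n_wk Q. ?B (-1) i)) + (\<Sum>i<n_wk Q. \<bar>?N i\<bar>)"
    by (simp only: sum.distrib sum_distrib_left[symmetric])
  also have "\<dots> \<le> 2 * ?a * (nw * qe + nw * qe) + 2 * ?b * (2 * nw * p_b Q + 2 * nw * p_b Q) + D / (4 * L)"
    by (intro add_mono mult_left_mono sums N) auto
  also have "\<dots> = 4 * (nw * qe * ?a) + 8 * (nw * (p_b Q * ?b)) + D / (4 * L)" by (simp add: algebra_simps)
  also have "\<dots> \<le> 4 * (nw * qe * ?a) + 1 * (nw * qe * ?a) + D / (4 * L)"
  proof -
    have "8 * (p_b Q * ?b) \<le> C * (p_b Q * ?b)" using C p_pos by (intro mult_right_mono) auto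
    also have "\<dots> \<le> qe * ?a" using mu_nu by (simp add: mult.assoc)
    finally have "nw * (8 * (p_b Q * ?b)) \<le> nw * (qe * ?a)" by (intro mult_left_mono) auto
    then show ?thesis by (simp add: mult_ac)
  qed
  also have "\<dots> \<le> D / (2 * L)"
  proof -
    have "0 \<le> nw * qe * ?a" using p_pos by simp
    then have "20 * (L * (nw * qe * ?a)) \<le> C * (L * (nw * qe * ?a))" using C L by (intro mult_right_mono) auto
    also have "\<dots> \<le> D" using scarce by (simp add: mult_ac)
    finally have "5 * (nw * qe * ?a) \<le> D / (4 * L)" using L by (simp add: pos_le_divide_eq mult_ac)
    moreover have "D / (2 * L) = D / (4 * L) + D / (4 * L)" by simp
    ultimately show ?thesis by linarith
  qed
  finally show "(\<Sum>i<n_wk Q. \<bar>inn (smp S i) (smp S j) - (if i = j then D else 0)\<bar>) \<le> D / (2 * L)" .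
qed

text \<open>With L = ln T* the horizon \<open>nat \<lfloor>exp L\<rfloor>\<close> covers exactly the
  admissible times.\<close>

lemma good_descent:
  assumes "good L S" "1 \<le> L" "1 \<le> nw" "4096 \<le> C" "0 < dimn Q"
    and "C * p_b Q * (norm_nu Q)\<^sup>2 \<le> qe * (norm_mu Q)\<^sup>2"
    and "C * L * (nw * qe * (norm_mu Q)\<^sup>2) \<le> D"
    and step: "lr Q * D \<le> 1 / 6"
  shows "coupled_descent (n_wk Q) (nat \<lfloor>exp L\<rfloor>) (\<lambda>i j. inn (smp S i) (smp S j)) (coef Q S) rate D L"
proof
  have lr: "0 < lr Q" using params_ok by (simp add: params_ok_def)
  have D: "0 < D" using sigma_pos assms(5) by simp
  have hD: "0 < rate * D" "rate * D \<le> 1 / 6"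
  proof -
    show "0 < rate * D" using lr D assms(3) by simp
    have "lr Q * D / nw \<le> lr Q * D / 1" using assms(3) lr D by (intro divide_left_mono) auto
    then have "lr Q * D / nw \<le> 1 / 6" using step by linarith
    then show "rate * D \<le> 1 / 6" by simp
  qed
  show "coef Q S 0 j = 0" for j by (simp add: coef_def)
  show "coef Q S (Suc t) j = coef Q S t j + rate / (1 + exp (\<Sum>i<n_wk Q. coef Q S t i * inn (smp S i) (smp S j)))" for t j
    by (rule coef_Suc)
  show "0 < rate" using lr assms(3) by simp
  show "0 < D" by fact
  show "0 < L" using assms(2) by simp
  show "rate * D \<le> 1 / 3" by (rule order_trans[OF hD(2)]) simp
  show "(\<Sum>i<n_wk Q. \<bar>inn (smp S i) (smp S j) - (if i = j then D else 0)\<bar>) \<le> D / (2 * L)" if "j < n_wk Q" for j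
    by (rule good_row[OF assms(1-4,6,7) that])
  show "ln (1 + 2 * exp 1 * (rate * D) * real t) \<le> 2 * L" if "t \<le> nat \<lfloor>exp L\<rfloor>" for t
  proof -
    have t: "real t \<le> exp L" using that exp_gt_zero[of L] by linarith
    have "2 \<le> exp L" using exp_ge_add_one_self[of L] assms(2) by linarith
    \<comment> \<open>The 1/6 in the step bound makes this product 1, so the growth up to time exp L
      is at most 1 + exp L <= exp (2 L).\<close>
    have "2 * exp 1 * (rate * D) \<le> 2 * 3 * (1 / 6)"
      by (intro mult_mono hD(2) less_imp_le[OF hD(1)] exp_one_le_3) auto
    then have "2 * exp 1 * (rate * D) * real t \<le> 1 * exp L"
      using t by (intro mult_mono) auto
    then have "1 + 2 * exp 1 * (rate * D) * real t \<le> exp L + exp L" using \<open>2 \<le> exp L\<close> by linarith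
    also have "\<dots> \<le> exp L * exp L" using \<open>2 \<le> exp L\<close> by (simp flip: mult_2)
    also have "\<dots> = exp (2 * L)" by (simp flip: exp_add)
    finally have "1 + 2 * exp 1 * (rate * D) * real t \<le> exp (2 * L)" .
    moreover have "0 < 1 + 2 * exp 1 * (rate * D) * real t"
      by (intro add_pos_nonneg mult_nonneg_nonneg less_imp_le[OF hD(1)]) auto
    ultimately show ?thesis by (metis ln_exp ln_le_cancel_iff exp_gt_zero)
  qed
qed

schematic_goal good_loss:
  assumes "coupled_descent (n_wk Q) T (\<lambda>i j. inn (smp S i) (smp S j)) (coef Q S) rate D L"
    and t: "t \<le> T" "0 < t" and n: "1 \<le> nw"
  shows "L_wk Q S (w_iter Q S t) \<le> ?c / (rate * D * real t)"
proof -
  interpret coupled_descent "n_wk Q" T "\<lambda>i j. inn (smp S i) (smp S j)" "coef Q S" rate D L by fact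
  have "L_wk Q S (w_iter Q S t) \<le> (1 / nw) * (\<Sum>j<n_wk Q. 18 / (rate * D * real t))"
    unfolding L_wk_labelled_sum inner_w_iter using t by (intro mult_left_mono sum_mono loss_bound) auto
  then show "L_wk Q S (w_iter Q S t) \<le> 18 / (rate * D * real t)" using n by simp
qed

lemma inner_signal: "inn w (mu Q s) = (norm_mu Q)\<^sup>2 * al s w" "inn w (nu Q s) = (norm_nu Q)\<^sup>2 * be s w"
  using norm_mu_pos norm_nu_pos by (simp_all add: al_def be_def inner_d_commute)

text \<open>Easy data has the main term twice; both-signal data has it once, less a hard component
  of at most half its size.\<close>

lemma inner_test_signal:
  assumes v: "v \<in> set_pmf (signal_pmf Q y k)" and y: "y \<in> {1, -1}" and k: "k \<noteq> Hard"
    and M: "M \<le> (norm_mu Q)\<^sup>2 * (y * al y w)" "(norm_nu Q)\<^sup>2 * \<bar>be y w\<bar> \<le> M / 2" and M0: "0 \<le> M"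
  shows "M / 2 \<le> inn w (\<lambda>i. y * (fst v i + snd v i))"
proof -
  have eq: "inn w (\<lambda>i. y * (fst v i + snd v i)) = y * inn w (fst v) + y * inn w (snd v)"
    by (simp add: algebra_simps)
  have nu: "\<bar>y * inn w (nu Q y)\<bar> \<le> M / 2" using M(2) y by (auto simp: inner_signal abs_mult)
  have mu: "M \<le> y * inn w (mu Q y)" using M(1) by (simp add: inner_signal mult_ac)
  from v show ?thesis
    by (cases rule: signal_pmf_cases) (use k M0 eq nu mu in \<open>auto simp: abs_le_iff\<close>)
qed

\<comment> \<open>The constant is 331776 = 64 * 2 * 2592, from the margin M / 2 = c n qe |mu|^2 / 8
  and the variance bound V = 2592 c^2 n sigma^2 D. The unknown scale c of the coefficients
  cancels.\<close>
schematic_goal good_test_error: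
  assumes good: "good L S" and L: "1 \<le> L" and n: "1 \<le> nw" and C: "4096 \<le> C" and d: "0 < dimn Q"
    and mu_nu: "C * p_b Q * (norm_nu Q)\<^sup>2 \<le> qe * (norm_mu Q)\<^sup>2"
    and desc: "coupled_descent (n_wk Q) T (\<lambda>i j. inn (smp S i) (smp S j)) (coef Q S) rate D L"
    and t: "t \<le> T" "0 < t"
  shows "test_error Q (w_iter Q S t) \<le> test_bound ?C1 Q"
proof -
  interpret coupled_descent "n_wk Q" T "\<lambda>i j. inn (smp S i) (smp S j)" "coef Q S" rate D L by fact
  let ?a = "(norm_mu Q)\<^sup>2" and ?b = "(norm_nu Q)\<^sup>2" and ?w = "w_iter Q S t" and ?z = "coef Q S t"
  have ne: "{..<n_wk Q} \<noteq> {}" using n by (auto simp: lessThan_empty_iff)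
  \<comment> \<open>The smallest coefficient serves as common scale: all coefficients lie between c
    and 36 c.\<close>
  define c where "c = Min (?z ` {..<n_wk Q})"
  have "c \<in> ?z ` {..<n_wk Q}" unfolding c_def using ne by (intro Min_in) auto
  then obtain m where m: "m < n_wk Q" "c = ?z m" by auto
  have c0: "0 < c" using coefficient_pos[OF t(1) m(1) t(2)] m(2) by simp
  have cl: "c \<le> ?z i" if "i < n_wk Q" for i unfolding c_def using that by (intro Min_le) auto
  have cu: "?z i \<le> 36 * c" if "i < n_wk Q" for i using coefficient_ratio[OF t(1) that m(1)] m(2) by simp
  have A: "0 \<le> s * al s (smp S i)" if "s \<in> {1, -1}" "i < n_wk Q" for s i
    using good that unfolding good_def by blast
  have inner_w: "inn u ?w = (\<Sum>i<n_wk Q. ?z i * inn u (smp S i))" for u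
    unfolding inner_d_commute[of _ u ?w] inner_w_iter
    by (rule sum.cong[OF refl]) (rule arg_cong[OF inner_d_commute])
  have alw: "al s ?w = (\<Sum>i<n_wk Q. ?z i * al s (smp S i))" "be s ?w = (\<Sum>i<n_wk Q. ?z i * be s (smp S i))" for s
    by (simp_all add: al_def be_def inner_w sum_divide_distrib)
  have count: "nw * qe / 4 \<le> (\<Sum>i<n_wk Q. y * al y (smp S i))"
    "(\<Sum>i<n_wk Q. \<bar>be y (smp S i)\<bar>) \<le> 2 * nw * p_b Q" if "y \<in> {1, -1}" for y
    using good that unfolding good_def by blast+
  have mean: "c * (nw * qe / 4) \<le> y * al y ?w" if y: "y \<in> {1, -1}" for y
  proof -
    have "c * (nw * qe / 4) \<le> c * (\<Sum>i<n_wk Q. y * al y (smp S i))"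
      using c0 by (intro mult_left_mono count(1)[OF y]) simp
    also have "\<dots> \<le> (\<Sum>i<n_wk Q. ?z i * (y * al y (smp S i)))"
      unfolding sum_distrib_left by (intro sum_mono mult_right_mono cl A y) auto
    also have "\<dots> = y * al y ?w" by (simp add: alw sum_distrib_left mult_ac)
    finally show ?thesis .
  qed
  have fluct: "\<bar>be y ?w\<bar> \<le> 36 * c * (2 * nw * p_b Q)" if y: "y \<in> {1, -1}" for y
  proof -
    have "\<bar>be y ?w\<bar> \<le> (\<Sum>i<n_wk Q. \<bar>?z i * be y (smp S i)\<bar>)" unfolding alw by (rule sum_abs)
    also have "\<dots> \<le> (\<Sum>i<n_wk Q. 36 * c * \<bar>be y (smp S i)\<bar>)"
      unfolding abs_mult using cu coefficient_growth(1)[OF t(1)] by (intro sum_mono mult_right_mono) auto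
    also have "\<dots> \<le> 36 * c * (2 * nw * p_b Q)"
      unfolding sum_distrib_left[symmetric] using c0 by (intro mult_left_mono count(2)[OF y]) simp
    finally show ?thesis .
  qed
  define M where "M = ?a * (c * (nw * qe / 4))"
  have M0: "0 \<le> M" using c0 p_pos by (simp add: M_def)
  have M1: "M \<le> ?a * (y * al y ?w)" if "y \<in> {1, -1}" for y
    unfolding M_def by (intro mult_left_mono mean that) auto
  have M2: "?b * \<bar>be y ?w\<bar> \<le> M / 2" if "y \<in> {1, -1}" for y
  proof -
    have "?b * \<bar>be y ?w\<bar> \<le> ?b * (36 * c * (2 * nw * p_b Q))" by (intro mult_left_mono fluct that) auto
    \<comment> \<open>576 = 36 * 2 * 8, so any C >= 576 makes the hard component at most half of
      M.\<close>
    also have "\<dots> = c * nw / 8 * (576 * (p_b Q * ?b))" by simp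
    also have "\<dots> \<le> c * nw / 8 * (C * (p_b Q * ?b))"
      using c0 C p_pos by (intro mult_left_mono mult_right_mono) auto
    also have "\<dots> \<le> c * nw / 8 * (qe * ?a)"
      using c0 mu_nu by (intro mult_left_mono) (auto simp: mult.assoc)
    also have "\<dots> = M / 2" by (simp add: M_def)
    finally show ?thesis .
  qed
  have D: "0 < D" using sigma_pos d by simp
  \<comment> \<open>2592 is 2 * 36^2. The Gram bounds give 36^2 (9/8 + 1/8) = 1620: n diagonal
    entries of 9/8 D, and n^2 terms of D / (8 n).\<close>
  define V where "V = \<sigma>\<^sup>2 * (2592 * c\<^sup>2 * nw * D)"
  have V0: "0 < V" using sigma_pos c0 n D by (simp add: V_def)
  have "inn (proj ?w) (proj ?w) \<le> 2592 * c\<^sup>2 * nw * D"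
  proof -
    let ?P = "\<lambda>i j. inn (proj (smp S i)) (proj (smp S j))"
    have "proj ?w i = (\<Sum>j<n_wk Q. ?z j * proj (smp S j) i)" if "i < dimn Q" for i
    proof -
      have "proj ?w i = proj (\<lambda>i. \<Sum>j<n_wk Q. ?z j * smp S j i) i"
        using w_iter_coef[OF that, of S t] by (simp add: proj_def alw al_sum be_sum)
      then show ?thesis by (simp add: proj_sum)
    qed
    then have "inn (proj ?w) (proj ?w) = inn (\<lambda>i. \<Sum>j<n_wk Q. ?z j * proj (smp S j) i) (\<lambda>i. \<Sum>j<n_wk Q. ?z j * proj (smp S j) i)"
      by (simp add: inner_d_def)
    also have "\<dots> = (\<Sum>i<n_wk Q. \<Sum>j<n_wk Q. ?z i * ?z j * ?P i j)"
      by (simp add: inner_d_sum sum_distrib_left mult.assoc inner_d_commute)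
    also have "\<dots> \<le> (\<Sum>i<n_wk Q. \<Sum>j<n_wk Q. (36 * c) * (36 * c) * ((if j = i then 9 / 8 * D else 0) + D / (8 * nw)))"
    proof (intro sum_mono)
      fix i j assume "i \<in> {..<n_wk Q}" "j \<in> {..<n_wk Q}"
      then have ij: "i < n_wk Q" "j < n_wk Q" by auto
      have "\<bar>?P i j\<bar> \<le> (if j = i then 9 / 8 * D else 0) + D / (8 * nw)"
      proof (cases "i = j")
        case True
        have "\<bar>?P i i - D\<bar> \<le> D / (8 * L)" using good ij unfolding good_def by blast
        moreover have "D / (8 * L) \<le> D / 8" using D L by (intro divide_left_mono) auto
        moreover have "0 \<le> D / (8 * nw)" using D by simp
        moreover have "0 \<le> ?P i i" by simp
        ultimately have "\<bar>?P i i\<bar> \<le> 9 / 8 * D + D / (8 * nw)" by linarith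
        then show ?thesis using True by simp
      next
        case False
        have "\<bar>?P i j\<bar> \<le> D / (8 * nw * L)" using good ij False unfolding good_def by blast
        also have "\<dots> \<le> D / (8 * nw)" using D L n by (intro divide_left_mono) auto
        finally show ?thesis using False by simp
      qed
      moreover have "?z i * ?z j * ?P i j \<le> \<bar>?z i\<bar> * \<bar>?z j\<bar> * \<bar>?P i j\<bar>"
        by (metis abs_ge_self abs_mult)
      moreover have "\<bar>?z i\<bar> * \<bar>?z j\<bar> * \<bar>?P i j\<bar> \<le> (36 * c) * (36 * c) * \<bar>?P i j\<bar>"
        using cu ij coefficient_growth(1)[OF t(1)] c0 by (intro mult_right_mono mult_mono) auto
      moreover have "(36 * c) * (36 * c) * \<bar>?P i j\<bar> \<le> (36 * c) * (36 * c) * ((if j = i then 9 / 8 * D else 0) + D / (8 * nw))"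
        using calculation(1) c0 by (intro mult_left_mono) auto
      ultimately show "?z i * ?z j * ?P i j \<le> (36 * c) * (36 * c) * ((if j = i then 9 / 8 * D else 0) + D / (8 * nw))"
        by linarith
    qed
    also have "\<dots> = (36 * c) * (36 * c) * (nw * (9 / 8 * D) + nw * D / 8)"
      using n by (simp add: sum_distrib_left[symmetric] sum.distrib)
    also have "\<dots> = 1620 * c\<^sup>2 * nw * D" by (simp add: power2_eq_square)
    also have "\<dots> \<le> 2592 * c\<^sup>2 * nw * D" using D by (intro mult_right_mono) auto
    finally show ?thesis .
  qed
  then have V: "\<sigma>\<^sup>2 * inn (proj ?w) (proj ?w) \<le> V" unfolding V_def by (intro mult_left_mono) auto
  have tail: "emeasure (data_law Q (return_pmf k)) {Z. inn ?w (labelled_sum Z) < 0} \<le> ennreal (exp (- ((M / 2)\<^sup>2 / (2 * V))))"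
    if "k \<noteq> Hard" for k
    using that by (intro data_law_margin_tail V V0 inner_test_signal M1 M2 M0) (use M0 in auto)
  have "test_error Q ?w \<le> exp (- ((M / 2)\<^sup>2 / (2 * V)))"
    by (intro test_error_le tail) auto
  also have "(M / 2)\<^sup>2 / (2 * V) = nw * qe\<^sup>2 * norm_mu Q ^ 4 / (331776 * \<sigma> ^ 4 * real (dimn Q))"
    unfolding M_def V_def using c0 n sigma_pos d
    by (simp add: field_simps power2_eq_square power4_eq_xxxx)
  finally show "test_error Q (w_iter Q S t) \<le> test_bound 331776 Q" by (simp add: test_bound_def)
qed

subsection \<open>Extracting the parameter conditions\<close>

text \<open>As d >= 1, d^(-3/2) <= 1/d; the step condition thus controls lr times D, the rate of the
  scalar recursion up to the factor 1/n.\<close>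

lemma step_size:
  assumes lr: "lr Q \<le> inverse C * \<sigma> powr (-2) * real (dimn Q) powr (-3/2)"
    and C: "4096 \<le> C" and d: "0 < dimn Q"
  shows "lr Q * D \<le> 1 / C"
proof -
  have s: "\<sigma> powr (-2) = 1 / \<sigma>\<^sup>2"
    using sigma_pos by (simp add: powr_minus powr_numeral divide_inverse)
  have "real (dimn Q) powr (-3/2) \<le> real (dimn Q) powr (-1)"
    using d by (intro powr_mono) auto
  also have "\<dots> = 1 / real (dimn Q)" using d by (simp add: powr_minus divide_inverse)
  finally have "inverse C * \<sigma> powr (-2) * real (dimn Q) powr (-3/2) \<le> inverse C * (1 / \<sigma>\<^sup>2) * (1 / real (dimn Q))"
    unfolding s using C by (intro mult_left_mono) auto
  then have "lr Q \<le> inverse C * (1 / \<sigma>\<^sup>2) * (1 / real (dimn Q))" using lr by linarith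
  then have "lr Q * D \<le> inverse C * (1 / \<sigma>\<^sup>2) * (1 / real (dimn Q)) * D" by (rule mult_right_mono) simp
  also have "\<dots> = 1 / C" using sigma_pos d C by (simp add: field_simps)
  finally show ?thesis .
qed

lemma simplified_conditions:
  assumes dim: "real (dimn Q) \<ge> C * max (nw\<^sup>2 * ln (C * nw\<^sup>2 / delta Q))
      (real (n_st Q) * ln (C * real (n_st Q) / delta Q)) * (ln (T_star P Q))\<^sup>2"
    and size: "nw \<ge> C * Max {1 / (p_e Q)\<^sup>2, 1 / (p_b Q)\<^sup>2, 1 / (p_h Q)\<^sup>2} * ln (C / delta Q)"
    and p_b: "p_b Q \<ge> C * max (p_h Q) (\<sigma> * norm_mu Q / (norm_nu Q)\<^sup>2 * sqrt (ln (T_star P Q)))"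
    and C: "4096 \<le> C"
  shows "real (dimn Q) \<ge> C * (nw\<^sup>2 * ln (C * nw\<^sup>2 / delta Q)) * (ln (T_star P Q))\<^sup>2"
    and "nw \<ge> C * (1 / (p_b Q)\<^sup>2) * ln (C / delta Q)"
    and "8 * p_h Q \<le> p_b Q"
proof -
  let ?L = "ln (T_star P Q)"
  have "C * (nw\<^sup>2 * ln (C * nw\<^sup>2 / delta Q)) * ?L\<^sup>2
      \<le> C * max (nw\<^sup>2 * ln (C * nw\<^sup>2 / delta Q)) (real (n_st Q) * ln (C * real (n_st Q) / delta Q)) * ?L\<^sup>2"
    using C by (intro mult_right_mono mult_left_mono max.cobounded1) auto
  also have "\<dots> \<le> real (dimn Q)" by (rule dim)
  finally show "real (dimn Q) \<ge> C * (nw\<^sup>2 * ln (C * nw\<^sup>2 / delta Q)) * ?L\<^sup>2" .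
  have delta: "0 < delta Q" "delta Q < 1" using params_ok by (auto simp: params_ok_def)
  have "C * (1 / (p_b Q)\<^sup>2) * ln (C / delta Q)
      \<le> C * Max {1 / (p_e Q)\<^sup>2, 1 / (p_b Q)\<^sup>2, 1 / (p_h Q)\<^sup>2} * ln (C / delta Q)"
  proof (intro mult_right_mono mult_left_mono)
    show "0 \<le> ln (C / delta Q)" using delta C by (intro ln_ge_zero) (simp add: field_simps)
  qed (use C in \<open>auto intro: Max_ge\<close>)
  also have "\<dots> \<le> nw" by (rule size)
  finally show "nw \<ge> C * (1 / (p_b Q)\<^sup>2) * ln (C / delta Q)" .
  have "8 * p_h Q \<le> C * p_h Q" using C p_pos by (intro mult_right_mono) auto
  also have "\<dots> \<le> C * max (p_h Q) (\<sigma> * norm_mu Q / (norm_nu Q)\<^sup>2 * sqrt ?L)"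
    using C by (intro mult_left_mono) auto
  also have "\<dots> \<le> p_b Q" by (rule p_b)
  finally show "8 * p_h Q \<le> p_b Q" .
qed

lemma data_scarceD:
  assumes scarce: "nw \<le> inverse C * \<sigma>\<^sup>2 * real (dimn Q) / (qe * (norm_mu Q)\<^sup>2 * ln (T_star P Q))"
    and "4096 \<le> C" "1 \<le> ln (T_star P Q)"
  shows "C * ln (T_star P Q) * (nw * qe * (norm_mu Q)\<^sup>2) \<le> D"
proof -
  have pos: "0 < C * (qe * (norm_mu Q)\<^sup>2 * ln (T_star P Q))"
    using assms(2,3) p_pos norm_mu_pos by (intro mult_pos_pos add_pos_pos) auto
  have "inverse C * \<sigma>\<^sup>2 * real (dimn Q) / (qe * (norm_mu Q)\<^sup>2 * ln (T_star P Q))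
      = D / (C * (qe * (norm_mu Q)\<^sup>2 * ln (T_star P Q)))"
    by (simp add: divide_inverse)
  with scarce have "nw \<le> D / (C * (qe * (norm_mu Q)\<^sup>2 * ln (T_star P Q)))" by simp
  then show ?thesis using pos by (simp add: pos_le_divide_eq mult_ac)
qed

text \<open>If \<open>T*\<close> is below the bound on the warm-up time, the range of \<open>t\<close> can be made empty; otherwise
  \<open>log T*\<close> is bounded below, which is all that is needed of the size of \<open>T*\<close>.\<close>

schematic_goal training_succeeds:
  assumes lr: "lr Q \<le> inverse C * \<sigma> powr (-2) * real (dimn Q) powr (-3/2)"
    and dim: "real (dimn Q) \<ge> C * max (nw\<^sup>2 * ln (C * nw\<^sup>2 / delta Q))
      (real (n_st Q) * ln (C * real (n_st Q) / delta Q)) * (ln (T_star P Q))\<^sup>2"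
    and size: "nw \<ge> C * Max {1 / (p_e Q)\<^sup>2, 1 / (p_b Q)\<^sup>2, 1 / (p_h Q)\<^sup>2} * ln (C / delta Q)"
    and p_b: "p_b Q \<ge> C * max (p_h Q) (\<sigma> * norm_mu Q / (norm_nu Q)\<^sup>2 * sqrt (ln (T_star P Q)))"
    and mu_nu: "C * p_b Q * (norm_nu Q)\<^sup>2 \<le> qe * (norm_mu Q)\<^sup>2"
    and scarce: "nw \<le> inverse C * \<sigma>\<^sup>2 * real (dimn Q) / (qe * (norm_mu Q)\<^sup>2 * ln (T_star P Q))"
    and C: "4096 \<le> C" and n: "1 \<le> nw" and d: "0 < dimn Q" and eps: "1 \<le> inverse (eps Q)"
  shows "\<P>(S in training_sets Q. \<exists>T::nat. real T \<le> T_wk_bound ?K ?q Q \<and>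
      (\<forall>t::nat. T \<le> t \<and> real t \<le> T_star P Q \<longrightarrow>
         L_wk Q S (w_iter Q S t) < eps Q \<and> test_error Q (w_iter Q S t) \<le> test_bound ?C1 Q)) \<ge> 1 - delta Q"
proof -
  interpret P: prob_space "training_sets Q" by (rule prob_space_training)
  let ?goal = "\<lambda>S. \<exists>T::nat. real T \<le> T_wk_bound 20 0 Q \<and>
      (\<forall>t::nat. T \<le> t \<and> real t \<le> T_star P Q \<longrightarrow>
         L_wk Q S (w_iter Q S t) < eps Q \<and> test_error Q (w_iter Q S t) \<le> test_bound 331776 Q)"
  \<comment> \<open>Up to a constant, the time at which the loss bound 18 n / (lr D t) reaches
    eps.\<close>
  define B where "B = nw / (lr Q * D * eps Q)"
  have TB: "T_wk_bound 20 0 Q = 20 * B" by (simp add: T_wk_bound_def B_def mult_ac)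
  have pos: "0 < lr Q" "0 < eps Q" "0 < delta Q" using params_ok by (auto simp: params_ok_def)
  have D: "0 < D" using sigma_pos d by simp
  have lrD: "0 < lr Q * D" "lr Q * D \<le> 1 / 6" "lr Q * D \<le> 1"
  proof -
    show "0 < lr Q * D" using pos D by simp
    have "1 / C \<le> 1 / 6" using C by (intro divide_left_mono) auto
    then show "lr Q * D \<le> 1 / 6" "lr Q * D \<le> 1" using step_size[OF lr C d] by linarith+
  qed
  have eps1: "eps Q \<le> 1" using eps pos(2) by (simp add: one_le_inverse_iff)
  have denom: "0 < lr Q * D * eps Q" using lrD(1) pos(2) by (rule mult_pos_pos)
  have "lr Q * D * eps Q \<le> 1 * 1" using lrD(3) eps1 pos(2) by (intro mult_mono) auto
  then have "lr Q * D * eps Q \<le> nw" using n by linarith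
  then have B1: "1 \<le> B" unfolding B_def using denom by (subst le_divide_eq_1_pos)
  show "\<P>(S in training_sets Q. \<exists>T::nat. real T \<le> T_wk_bound 20 0 Q \<and>
      (\<forall>t::nat. T \<le> t \<and> real t \<le> T_star P Q \<longrightarrow>
         L_wk Q S (w_iter Q S t) < eps Q \<and> test_error Q (w_iter Q S t) \<le> test_bound 331776 Q)) \<ge> 1 - delta Q"
  proof (cases "T_star P Q < 20 * B - 1")
    case True
    have "?goal S" for S
    proof (intro exI[of _ "nat \<lfloor>20 * B\<rfloor>"] conjI allI impI)
      have T: "real (nat \<lfloor>20 * B\<rfloor>) \<le> 20 * B" "20 * B - 1 < real (nat \<lfloor>20 * B\<rfloor>)" using B1 by linarith+
      show "real (nat \<lfloor>20 * B\<rfloor>) \<le> T_wk_bound 20 0 Q" using T(1) TB by simp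
      fix t assume "nat \<lfloor>20 * B\<rfloor> \<le> t \<and> real t \<le> T_star P Q"
      then have False using T(2) True by linarith
      then show "L_wk Q S (w_iter Q S t) < eps Q" "test_error Q (w_iter Q S t) \<le> test_bound 331776 Q" by auto
    qed
    then have "{S \<in> space (training_sets Q). ?goal S} = space (training_sets Q)" by blast
    then show ?thesis using pos P.prob_space by simp
  next
    case False
    define L where "L = ln (T_star P Q)"
    \<comment> \<open>B >= 1 gives T* >= 19 > e, hence L >= 1.\<close>
    have Tstar: "19 \<le> T_star P Q" using False B1 by linarith
    then have eL: "exp L = T_star P Q" by (simp add: L_def)
    then have "exp 1 \<le> exp L" using Tstar exp_one_le_3 by linarith
    then have L: "1 \<le> L" by simp
    note bc = simplified_conditions[OF dim size p_b C, folded L_def]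
    note sc = data_scarceD[OF scarce C L[unfolded L_def], folded L_def]
    have bad: "emeasure (training_sets Q) {S \<in> space (training_sets Q). \<not> good L S} \<le> ennreal (delta Q)"
      by (rule training_good[OF L d n bc(3) C bc(1,2)])
    have "?goal S" if good: "good L S" for S
    \<comment> \<open>18 is the constant of \<open>good_loss\<close>; the added 1 gives t > 18 B, as
      the strict loss bound demands. Since B >= 1, the total stays below 18 B + 2 <= 20 B, whence K
      = 20 with log exponent 0.\<close>
    proof (intro exI[of _ "nat \<lceil>18 * B\<rceil> + 1"] conjI allI impI)
      show "real (nat \<lceil>18 * B\<rceil> + 1) \<le> T_wk_bound 20 0 Q" unfolding TB using B1 by linarith
      fix t assume t: "nat \<lceil>18 * B\<rceil> + 1 \<le> t \<and> real t \<le> T_star P Q"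
      then have t0: "0 < t" and tB: "18 * B < real t" by linarith+
      have tL: "t \<le> nat \<lfloor>exp L\<rfloor>" using t eL by (simp add: le_nat_floor)
      note desc = good_descent[OF good L n C d mu_nu sc lrD(2)]
      show "test_error Q (w_iter Q S t) \<le> test_bound 331776 Q"
        by (rule good_test_error[OF good L n C d mu_nu desc tL t0])
      have "L_wk Q S (w_iter Q S t) \<le> 18 / (rate * D * real t)"
        by (rule good_loss[OF desc tL t0 n])
      also have "\<dots> < eps Q"
      proof -
        have eq: "rate * D * real t = lr Q * D * real t / nw" by simp
        have "18 * nw / (lr Q * D * eps Q) < real t" using tB by (simp add: B_def)
        then have "18 * nw < real t * (lr Q * D * eps Q)" using denom by (simp only: pos_divide_less_eq)
        moreover have "0 < lr Q * D * real t" using lrD(1) t0 by simp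
        ultimately have "18 * nw / (lr Q * D * real t) < eps Q"
          by (simp only: pos_divide_less_eq) (simp add: mult_ac)
        then show ?thesis unfolding eq by simp
      qed
      finally show "L_wk Q S (w_iter Q S t) < eps Q" .
    qed
    then have sub: "{S \<in> space (training_sets Q). good L S} \<subseteq> {S \<in> space (training_sets Q). ?goal S}" by blast
    have "P.prob {S \<in> space (training_sets Q). \<not> good L S} \<le> delta Q"
      using bad pos by (simp add: P.emeasure_eq_measure)
    moreover have "P.prob {S \<in> space (training_sets Q). \<not> good L S} = 1 - P.prob {S \<in> space (training_sets Q). good L S}"
      by (rule P.prob_neg) measurable
    ultimately have "1 - delta Q \<le> P.prob {S \<in> space (training_sets Q). good L S}" by simp
    also have "\<dots> \<le> P.prob {S \<in> space (training_sets Q). ?goal S}"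
      using sub by (rule P.finite_measure_mono) measurable
    finally show ?thesis .
  qed
qed

end

\<comment> \<open>The limit is 0. The exponent is n / (C1 r) with r the rate in
  \<open>sample_size_growth\<close>, so the growth condition with constant C1 Z lifts it above any
  Z; d >= 1 makes r positive.\<close>
schematic_goal test_bound_tendsto_0:
  assumes "C1 > 0" and ok: "\<And>k. params_ok (Q k)" and "sample_size_growth Q"
    and d: "filterlim (\<lambda>k. dimn (Q k)) at_top sequentially"
  shows "(\<lambda>k. test_bound C1 (Q k)) \<longlonglongrightarrow> ?l"
proof -
  define r where "r k = sigma_p (Q k) ^ 4 * real (dimn (Q k))
    / ((2 * p_e (Q k) + p_b (Q k))\<^sup>2 * norm_mu (Q k) ^ 4)" for k
  define E where "E k = real (n_wk (Q k)) * (2 * p_e (Q k) + p_b (Q k))\<^sup>2 * norm_mu (Q k) ^ 4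
    / (C1 * sigma_p (Q k) ^ 4 * real (dimn (Q k)))" for k
  have growth: "(\<lambda>k. real (n_wk (Q k))) \<in> \<omega>[sequentially](r)"
    using assms(3) by (simp add: sample_size_growth_def Let_def r_def[abs_def])
  have "filterlim E at_top sequentially"
  proof (subst filterlim_at_top_gt[of _ _ 0], intro allI impI)
    fix Z :: real assume "0 < Z"
    then have "\<forall>\<^sub>F k in sequentially. (C1 * Z) * norm (r k) \<le> norm (real (n_wk (Q k)))"
      using growth \<open>C1 > 0\<close> by (intro landau_omega.smallD) auto
    moreover have "\<forall>\<^sub>F k in sequentially. 1 \<le> dimn (Q k)"
      using d by (simp add: filterlim_at_top)
    ultimately show "\<forall>\<^sub>F k in sequentially. Z \<le> E k"
    proof eventually_elim
      case (elim k)
      interpret weak_model "Q k" by unfold_locales (rule ok)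
      have q: "0 < 2 * p_e (Q k) + p_b (Q k)" using p_pos by simp
      have rpos: "0 < r k" unfolding r_def using q sigma_pos norm_mu_pos elim(2) by (intro divide_pos_pos mult_pos_pos) auto
      have Er: "E k = real (n_wk (Q k)) / (C1 * r k)"
        unfolding E_def r_def using q norm_mu_pos sigma_pos \<open>C1 > 0\<close> by (simp add: field_simps)
      have "Z * (C1 * r k) \<le> real (n_wk (Q k))" using elim(1) rpos by (simp add: mult_ac)
      then show ?case unfolding Er using rpos \<open>C1 > 0\<close> by (subst pos_le_divide_eq) auto
    qed
  qed
  then have "filterlim (\<lambda>k. - E k) at_bot sequentially"
    by (rule filterlim_uminus_at_bot_at_top[THEN filterlim_compose])
  then have "(\<lambda>k. exp (- E k)) \<longlonglongrightarrow> 0"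
    by (rule filterlim_compose[OF exp_at_bot])
  then show "(\<lambda>k. test_bound C1 (Q k)) \<longlonglongrightarrow> 0" by (simp add: test_bound_def E_def)
qed

theorem theorem3p3:
  shows "\<exists>C1>0. \<exists>K>0. \<exists>q::nat. \<exists>C0>0. \<exists>P0. polynomial5 P0 \<and>
    (\<forall>P C (Q :: nat \<Rightarrow> params).
       polynomial5 P \<and>
       (\<forall>x1\<ge>1. \<forall>x2\<ge>1. \<forall>x3\<ge>1. \<forall>x4\<ge>1. \<forall>x5\<ge>1. P0 x1 x2 x3 x4 x5 \<le> P x1 x2 x3 x4 x5) \<and>
       C0 \<le> C \<and> large_regime Q \<and> data_scarce_conditions C P Q \<longrightarrow>
       (\<forall>\<^sub>F k in sequentially.
          \<P>(S in training_sets (Q k).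
             \<exists>T::nat. real T \<le> T_wk_bound K q (Q k) \<and>
               (\<forall>t::nat. T \<le> t \<and> real t \<le> T_star P (Q k) \<longrightarrow>
                  L_wk (Q k) S (w_iter (Q k) S t) < eps (Q k) \<and>
                  test_error (Q k) (w_iter (Q k) S t) \<le> test_bound C1 (Q k)))
          \<ge> 1 - delta (Q k)) \<and>
       (\<lambda>k. test_bound C1 (Q k)) \<longlonglongrightarrow> 0)"
proof -
  have poly0: "polynomial5 (\<lambda>x1 x2 x3 x4 x5. 0)"
    unfolding polynomial5_def by (intro exI[of _ "{}"]) simp
  have main: "(\<forall>\<^sub>F k in sequentially.
          \<P>(S in training_sets (Q k).
             \<exists>T::nat. real T \<le> T_wk_bound 20 0 (Q k) \<and>
               (\<forall>t::nat. T \<le> t \<and> real t \<le> T_star P (Q k) \<longrightarrow>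
                  L_wk (Q k) S (w_iter (Q k) S t) < eps (Q k) \<and>
                  test_error (Q k) (w_iter (Q k) S t) \<le> test_bound 331776 (Q k)))
          \<ge> 1 - delta (Q k)) \<and>
       (\<lambda>k. test_bound 331776 (Q k)) \<longlonglongrightarrow> 0"
    if C: "4096 \<le> C" and large: "large_regime Q" and scarce: "data_scarce_conditions C P Q"
    for P C and Q :: "nat \<Rightarrow> params"
  proof
    have cond: "params_ok (Q k)" "base_conditions C P (Q k)" "data_scarce_bound C P (Q k)" for k
      using scarce by (auto simp: data_scarce_conditions_def)
    have "\<forall>\<^sub>F k in sequentially. 1 \<le> inverse (eps (Q k))" "\<forall>\<^sub>F k in sequentially. 1 \<le> dimn (Q k)"
      "\<forall>\<^sub>F k in sequentially. 1 \<le> n_wk (Q k)"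
      using large by (simp_all add: large_regime_def filterlim_at_top)
    then show "\<forall>\<^sub>F k in sequentially.
          \<P>(S in training_sets (Q k).
             \<exists>T::nat. real T \<le> T_wk_bound 20 0 (Q k) \<and>
               (\<forall>t::nat. T \<le> t \<and> real t \<le> T_star P (Q k) \<longrightarrow>
                  L_wk (Q k) S (w_iter (Q k) S t) < eps (Q k) \<and>
                  test_error (Q k) (w_iter (Q k) S t) \<le> test_bound 331776 (Q k)))
          \<ge> 1 - delta (Q k)"
    proof eventually_elim
      case (elim k)
      interpret weak_model "Q k" by unfold_locales (rule cond)
      note base = cond(2)[of k, unfolded base_conditions_def Let_def]
      show ?case
      proof (rule training_succeeds[OF _ _ _ _ _ _ C])
        show "lr (Q k) \<le> inverse C * \<sigma> powr (-2) * real (dimn (Q k)) powr (-3/2)"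
          "real (dimn (Q k)) \<ge> C * max (nw\<^sup>2 * ln (C * nw\<^sup>2 / delta (Q k)))
            (real (n_st (Q k)) * ln (C * real (n_st (Q k)) / delta (Q k))) * (ln (T_star P (Q k)))\<^sup>2"
          "nw \<ge> C * Max {1 / (p_e (Q k))\<^sup>2, 1 / (p_b (Q k))\<^sup>2, 1 / (p_h (Q k))\<^sup>2} * ln (C / delta (Q k))"
          "p_b (Q k) \<ge> C * max (p_h (Q k)) (\<sigma> * norm_mu (Q k) / (norm_nu (Q k))\<^sup>2 * sqrt (ln (T_star P (Q k))))"
          "C * p_b (Q k) * (norm_nu (Q k))\<^sup>2 \<le> qe * (norm_mu (Q k))\<^sup>2"
          using base by auto
        show "nw \<le> inverse C * \<sigma>\<^sup>2 * real (dimn (Q k)) / (qe * (norm_mu (Q k))\<^sup>2 * ln (T_star P (Q k)))"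
          using cond(3)[of k] by (simp add: data_scarce_bound_def Let_def)
      qed (use elim in auto)
    qed
    show "(\<lambda>k. test_bound 331776 (Q k)) \<longlonglongrightarrow> 0"
      using scarce large cond(1)
      by (intro test_bound_tendsto_0) (auto simp: data_scarce_conditions_def large_regime_def)
  qed
  \<comment> \<open>The witnesses are C1 = 331776 from \<open>good_test_error\<close>, K = 20 and
    log exponent 0 from \<open>training_succeeds\<close>, C0 = 4096 from the norm tail, and the zero
    polynomial as lower bound for P.\<close>
  show ?thesis
    by (rule exI[of _ 331776], intro conjI, simp, rule exI[of _ 20], intro conjI, simp,
        rule exI[of _ 0], rule exI[of _ 4096], intro conjI, simp,
        rule exI[of _ "\<lambda>x1 x2 x3 x4 x5. 0"], intro conjI poly0)
      (use main in blast)
qed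

end
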